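(* Let $R$ be a noetherian commutative ring, let $C$ be a locally projective $R$-coalgebra and let $N$ be a right $C$-comodule. 1. If $N$ is coreflexive, then $N^{\ast\Box}=N^{\ast\circ}$. 2. Let the right $C^{\ast}$-module $N^{\ast}$ be cofinitely $R$-cogenerated. (a) If $N\simeq N^{\ast\circ}$ (via the canonical map $\Phi_N:N\to N^{\ast\ast}$), then $N$ is coreflexive. (b) Let $N$ be weakly coreflexive. Then $N$ is coreflexive if and only if $N\simeq N^{\ast\circ}$ (via $\Phi_N$).
   Context: $R$ is a commutative ring with $1\neq 0$; $\otimes,\mathrm{Hom}$ are over $R$, $L^{\ast}=\mathrm{Hom}_R(L,R)$. For an $R$-coalgebra $(C,\Delta,\varepsilon)$ (coassociative, counital), $C^{\ast}$ is an $R$-algebra under convolution $(f\star g)(c)=\sum f(c_1)g(c_2)$ with unit $\varepsilon$. $C$ is locally projective if for every $R$-module $X$ the canonical map $X\otimes C\to\mathrm{Hom}_R(C^{\ast},X)$, $\sum x_i\otimes c_i\mapsto[f\mapsto\sum x_if(c_i)]$ is injective. A right $C$-comodule $N$ is a left $C^{\ast}$-module by $gn=\sum n_{<0>}g(n_{<1>})$, and $N^{\ast}$ is a right $C^{\ast}$-module by $(fg)(n)=f(gn)$. For a right $C^{\ast}$-module $M$, $M^{\ast}$ is a left $C^{\ast}$-module by $(gf)(m)=f(mg)$. For a left $C^{\ast}$-module $X$, $\mathrm{Rat}^C({}_{C^{\ast}}X)=\{x\in X\mid\exists\sum x_i\otimes c_i\in X\otimes C\text{ with } gx=\sum x_ig(c_i)\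 \forall g\in C^{\ast}\}$. For a right $C^{\ast}$-module $M$: $M^{\Box}:=\mathrm{Rat}^C({}_{C^{\ast}}M^{\ast})$, and $M^{\circ}:=\{f\in M^{\ast}\mid f(L)=0\text{ for some } R\text{-cofinite } C^{\ast}\text{-submodule } L\subseteq M\}$, where $L\subseteq M$ is $R$-cofinite if $M/L$ is a finitely generated $R$-module. Thus $N^{\ast\Box}=(N^{\ast})^{\Box}$ and $N^{\ast\circ}=(N^{\ast})^{\circ}$ are submodules of $N^{\ast\ast}$. $M$ is cofinitely $R$-cogenerated if $M/L$ embeds in a product of copies of $R$ for every $R$-cofinite $C^{\ast}$-submodule $L$. $N^{\ast}[\mathfrak{T}_{ls}(N)]$ (the finite topology) has neighbourhood basis of $0$ given by $\{f\in N^{\ast}\mid f(K)=0\}$, $K\subseteq N$ a finitely generated $R$-submodule. $\mathrm{Cf}(N^{\ast})$ has neighbourhood basis of $0$ given by all $R$-cofinite right $C^{\ast}$-submodules of $N^{\ast}$. $N$ is coreflexive if $N^{\ast}[\mathfrak{T}_{ls}(N)]=\mathrm{Cf}(N^{\ast})$; $N$ is weakly coreflexive if $N=N^{\ast\Box}$ via $\Phi_N$ (i.e. $\Phi_N:N\to N^{\ast\ast}$ is injective with image $N^{\ast\Box}$). "$N\simeq N^{\ast\circ}$ via $\Phi_N$" means $\Phi_N$ is injective with image $N^{\ast\circ}$. *)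

theory Defs
  imports "HOL-Analysis.Abstract_Topology" "HOL-Algebra.Ring_Divisibility" "HOL-Algebra.Module"
begin

section \<open>Modules\<close>

text \<open>Modules are \<^locale>\<open>module\<close> records; the fields \<^const>\<open>mult\<close> and \<^const>\<open>one\<close> of such a record
  are irrelevant and mostly left \<^const>\<open>undefined\<close> below.  Maps between carriers are
  extensional functions.\<close>

definition regular_module :: "('r,'k) ring_scheme \<Rightarrow> ('r,'r) module" where
  "regular_module R =
     \<lparr>carrier = carrier R, mult = mult R, one = one R, zero = zero R, add = add R, smult = mult R\<rparr>"

definition lin_maps ::
  "('r,'k) ring_scheme \<Rightarrow> ('r,'m,'e) module_scheme \<Rightarrow> ('r,'p,'d) module_scheme \<Rightarrow> ('m \<Rightarrow> 'p) set" where
  "lin_maps R M P = {f \<in> carrier M \<rightarrow>\<^sub>E carrier P.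
     (\<forall>x\<in>carrier M. \<forall>y\<in>carrier M. f (x \<oplus>\<^bsub>M\<^esub> y) = f x \<oplus>\<^bsub>P\<^esub> f y) \<and>
     (\<forall>r\<in>carrier R. \<forall>x\<in>carrier M. f (r \<odot>\<^bsub>M\<^esub> x) = r \<odot>\<^bsub>P\<^esub> f x)}"

definition hom_module ::
  "('r,'k) ring_scheme \<Rightarrow> ('r,'m,'e) module_scheme \<Rightarrow> ('r,'p,'d) module_scheme
    \<Rightarrow> ('r, 'm \<Rightarrow> 'p) module" where
  "hom_module R M P =
     \<lparr>carrier = lin_maps R M P, mult = undefined, one = undefined,
      zero = (\<lambda>x\<in>carrier M. \<zero>\<^bsub>P\<^esub>),
      add = (\<lambda>f g. \<lambda>x\<in>carrier M. f x \<oplus>\<^bsub>P\<^esub> g x),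
      smult = (\<lambda>r f. \<lambda>x\<in>carrier M. r \<odot>\<^bsub>P\<^esub> f x)\<rparr>"

definition dual_module ::
  "('r,'k) ring_scheme \<Rightarrow> ('r,'m,'e) module_scheme \<Rightarrow> ('r, 'm \<Rightarrow> 'r) module" where
  "dual_module R M = hom_module R M (regular_module R)"

definition eval_map ::
  "('r,'k) ring_scheme \<Rightarrow> ('r,'m,'e) module_scheme \<Rightarrow> 'm \<Rightarrow> ('m \<Rightarrow> 'r) \<Rightarrow> 'r" where
  "eval_map R M = (\<lambda>x\<in>carrier M. \<lambda>f\<in>carrier (dual_module R M). f x)"

definition lin_span ::
  "('r,'k) ring_scheme \<Rightarrow> ('r,'m,'e) module_scheme \<Rightarrow> 'm set \<Rightarrow> 'm set" where
  "lin_span R M A = \<Inter>{H. submodule H R M \<and> A \<subseteq> H}"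

definition fin_gen :: "('r,'k) ring_scheme \<Rightarrow> ('r,'m,'e) module_scheme \<Rightarrow> bool" where
  "fin_gen R M \<longleftrightarrow> (\<exists>A. finite A \<and> A \<subseteq> carrier M \<and> carrier M = lin_span R M A)"

definition quot_module ::
  "('r,'k) ring_scheme \<Rightarrow> ('r,'m,'e) module_scheme \<Rightarrow> 'm set \<Rightarrow> ('r, 'm set) module" where
  "quot_module R M L =
     \<lparr>carrier = a_rcosets\<^bsub>M\<^esub> L, mult = undefined, one = undefined,
      zero = L, add = set_add M, smult = (\<lambda>r A. \<Union>x\<in>A. L +>\<^bsub>M\<^esub> (r \<odot>\<^bsub>M\<^esub> x))\<rparr>"

text \<open>The product \<open>R\<^sup>S\<close> of copies of \<open>R\<close>, and the free module on \<open>S\<close> inside it.\<close>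

definition power_module :: "('r,'k) ring_scheme \<Rightarrow> 's set \<Rightarrow> ('r, 's \<Rightarrow> 'r) module" where
  "power_module R S =
     \<lparr>carrier = S \<rightarrow>\<^sub>E carrier R, mult = undefined, one = undefined,
      zero = (\<lambda>p\<in>S. \<zero>\<^bsub>R\<^esub>),
      add = (\<lambda>u v. \<lambda>p\<in>S. u p \<oplus>\<^bsub>R\<^esub> v p),
      smult = (\<lambda>r u. \<lambda>p\<in>S. r \<otimes>\<^bsub>R\<^esub> u p)\<rparr>"

definition supp :: "('r,'k) ring_scheme \<Rightarrow> 's set \<Rightarrow> ('s \<Rightarrow> 'r) \<Rightarrow> 's set" where
  "supp R S u = {p \<in> S. u p \<noteq> \<zero>\<^bsub>R\<^esub>}"

definition free_module :: "('r,'k) ring_scheme \<Rightarrow> 's set \<Rightarrow> ('r, 's \<Rightarrow> 'r) module" where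
  "free_module R S = (power_module R S)\<lparr>carrier := {u \<in> S \<rightarrow>\<^sub>E carrier R. finite (supp R S u)}\<rparr>"

definition free_gen :: "('r,'k) ring_scheme \<Rightarrow> 's set \<Rightarrow> 's \<Rightarrow> 's \<Rightarrow> 'r" where
  "free_gen R S p = (\<lambda>q\<in>S. if q = p then \<one>\<^bsub>R\<^esub> else \<zero>\<^bsub>R\<^esub>)"

definition free_ext ::
  "('r,'k) ring_scheme \<Rightarrow> 's set \<Rightarrow> ('r,'q,'d) module_scheme \<Rightarrow> ('s \<Rightarrow> 'q) \<Rightarrow> ('s \<Rightarrow> 'r) \<Rightarrow> 'q" where
  "free_ext R S Q b u = (\<Oplus>\<^bsub>Q\<^esub> p\<in>supp R S u. u p \<odot>\<^bsub>Q\<^esub> b p)"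

section \<open>Tensor products\<close>

definition tensor_free ::
  "('r,'k) ring_scheme \<Rightarrow> ('r,'m,'e) module_scheme \<Rightarrow> ('r,'p,'d) module_scheme
    \<Rightarrow> ('r, 'm \<times> 'p \<Rightarrow> 'r) module" where
  "tensor_free R M P = free_module R (carrier M \<times> carrier P)"

definition tensor_free_gen ::
  "('r,'k) ring_scheme \<Rightarrow> ('r,'m,'e) module_scheme \<Rightarrow> ('r,'p,'d) module_scheme
    \<Rightarrow> 'm \<Rightarrow> 'p \<Rightarrow> 'm \<times> 'p \<Rightarrow> 'r" where
  "tensor_free_gen R M P x y = free_gen R (carrier M \<times> carrier P) (x, y)"

text \<open>\<open>M \<otimes> P\<close> is the free module on the pairs \<open>(x, y)\<close> modulo the relations making \<open>(x, y)\<close>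
  bilinear; \<open>tens\<close> is \<open>x \<otimes> y\<close>.\<close>

definition tensor_rels ::
  "('r,'k) ring_scheme \<Rightarrow> ('r,'m,'e) module_scheme \<Rightarrow> ('r,'p,'d) module_scheme
    \<Rightarrow> ('m \<times> 'p \<Rightarrow> 'r) set" where
  "tensor_rels R M P = (let F = tensor_free R M P; d = tensor_free_gen R M P in
     {d (x \<oplus>\<^bsub>M\<^esub> x') y \<ominus>\<^bsub>F\<^esub> (d x y \<oplus>\<^bsub>F\<^esub> d x' y) | x x' y.
        x \<in> carrier M \<and> x' \<in> carrier M \<and> y \<in> carrier P} \<union>
     {d x (y \<oplus>\<^bsub>P\<^esub> y') \<ominus>\<^bsub>F\<^esub> (d x y \<oplus>\<^bsub>F\<^esub> d x y') | x y y'.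
        x \<in> carrier M \<and> y \<in> carrier P \<and> y' \<in> carrier P} \<union>
     {d (r \<odot>\<^bsub>M\<^esub> x) y \<ominus>\<^bsub>F\<^esub> (r \<odot>\<^bsub>F\<^esub> d x y) | r x y.
        r \<in> carrier R \<and> x \<in> carrier M \<and> y \<in> carrier P} \<union>
     {d x (r \<odot>\<^bsub>P\<^esub> y) \<ominus>\<^bsub>F\<^esub> (r \<odot>\<^bsub>F\<^esub> d x y) | r x y.
        r \<in> carrier R \<and> x \<in> carrier M \<and> y \<in> carrier P})"

definition tensor_null ::
  "('r,'k) ring_scheme \<Rightarrow> ('r,'m,'e) module_scheme \<Rightarrow> ('r,'p,'d) module_scheme
    \<Rightarrow> ('m \<times> 'p \<Rightarrow> 'r) set" where
  "tensor_null R M P = lin_span R (tensor_free R M P) (tensor_rels R M P)"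

definition tensor ::
  "('r,'k) ring_scheme \<Rightarrow> ('r,'m,'e) module_scheme \<Rightarrow> ('r,'p,'d) module_scheme
    \<Rightarrow> ('r, ('m \<times> 'p \<Rightarrow> 'r) set) module" where
  "tensor R M P = quot_module R (tensor_free R M P) (tensor_null R M P)"

definition tens ::
  "('r,'k) ring_scheme \<Rightarrow> ('r,'m,'e) module_scheme \<Rightarrow> ('r,'p,'d) module_scheme
    \<Rightarrow> 'm \<Rightarrow> 'p \<Rightarrow> ('m \<times> 'p \<Rightarrow> 'r) set" where
  "tens R M P x y = tensor_null R M P +>\<^bsub>tensor_free R M P\<^esub> tensor_free_gen R M P x y"

text \<open>The map \<open>M \<otimes> P \<rightarrow> Q\<close> induced by an \<open>R\<close>-bilinear \<open>b\<close>: the value is computed on any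
  representative of the coset \<open>t\<close> (see \<open>tensor_lift_tens\<close> and \<open>tensor_lift_lin\<close> below).\<close>

definition tensor_lift ::
  "('r,'k) ring_scheme \<Rightarrow> ('r,'m,'e) module_scheme \<Rightarrow> ('r,'p,'d) module_scheme
    \<Rightarrow> ('r,'q,'f) module_scheme \<Rightarrow> ('m \<Rightarrow> 'p \<Rightarrow> 'q) \<Rightarrow> ('m \<times> 'p \<Rightarrow> 'r) set \<Rightarrow> 'q" where
  "tensor_lift R M P Q b t =
     the_elem (free_ext R (carrier M \<times> carrier P) Q (case_prod b) ` t)"

definition bilinear_map ::
  "('r,'k) ring_scheme \<Rightarrow> ('r,'m,'e) module_scheme \<Rightarrow> ('r,'p,'d) module_scheme
    \<Rightarrow> ('r,'q,'f) module_scheme \<Rightarrow> ('m \<Rightarrow> 'p \<Rightarrow> 'q) \<Rightarrow> bool" where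
  "bilinear_map R M P Q b \<longleftrightarrow>
     (\<forall>x\<in>carrier M. (\<lambda>y\<in>carrier P. b x y) \<in> lin_maps R P Q) \<and>
     (\<forall>y\<in>carrier P. (\<lambda>x\<in>carrier M. b x y) \<in> lin_maps R M Q)"

definition tensor_map ::
  "('r,'k) ring_scheme \<Rightarrow> ('r,'m,'e) module_scheme \<Rightarrow> ('r,'p,'d) module_scheme
    \<Rightarrow> ('r,'m1,'e1) module_scheme \<Rightarrow> ('r,'p1,'d1) module_scheme
    \<Rightarrow> ('m \<Rightarrow> 'm1) \<Rightarrow> ('p \<Rightarrow> 'p1) \<Rightarrow> ('m \<times> 'p \<Rightarrow> 'r) set \<Rightarrow> ('m1 \<times> 'p1 \<Rightarrow> 'r) set" where
  "tensor_map R M P M' P' f g =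
     tensor_lift R M P (tensor R M' P') (\<lambda>x y. tens R M' P' (f x) (g y))"

definition tensor_assoc ::
  "('r,'k) ring_scheme \<Rightarrow> ('r,'m,'e) module_scheme \<Rightarrow> ('r,'p,'d) module_scheme
    \<Rightarrow> ('r,'q,'f) module_scheme
    \<Rightarrow> (('m \<times> 'p \<Rightarrow> 'r) set \<times> 'q \<Rightarrow> 'r) set \<Rightarrow> ('m \<times> ('p \<times> 'q \<Rightarrow> 'r) set \<Rightarrow> 'r) set" where
  "tensor_assoc R M P Q =
     tensor_lift R (tensor R M P) Q (tensor R M (tensor R P Q))
       (\<lambda>t z. tensor_lift R M P (tensor R M (tensor R P Q))
          (\<lambda>x y. tens R M (tensor R P Q) x (tens R P Q y z)) t)"

section \<open>Coalgebras and comodules\<close>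

text \<open>The canonical map \<open>X \<otimes> C \<rightarrow> Hom(C\<^sup>*, X)\<close>.\<close>

definition loc_proj_map ::
  "('r,'k) ring_scheme \<Rightarrow> ('r,'c,'e) module_scheme \<Rightarrow> ('r,'x,'d) module_scheme
    \<Rightarrow> ('x \<times> 'c \<Rightarrow> 'r) set \<Rightarrow> ('c \<Rightarrow> 'r) \<Rightarrow> 'x" where
  "loc_proj_map R C X t =
     (\<lambda>f\<in>carrier (dual_module R C). tensor_lift R X C X (\<lambda>x c. f c \<odot>\<^bsub>X\<^esub> x) t)"

text \<open>HOL cannot quantify over all module types at once.  The test modules with carrier in
  \<^typ>\<open>(nat \<Rightarrow> 'r) set\<close> suffice: they contain all quotients of the modules \<open>R\<^sup>n\<close>, hence every finitely
  generated module up to isomorphism, and a tensor in the kernel for \<open>X\<close> lives in the kernel for a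
  finitely generated submodule of \<open>X\<close>.  The theorem \<open>locally_projective_any_module\<close> below gives
  injectivity for modules over arbitrary types.\<close>

definition locally_projective ::
  "('r,'k) ring_scheme \<Rightarrow> ('r,'c,'e) module_scheme \<Rightarrow> bool" where
  "locally_projective R C \<longleftrightarrow>
     (\<forall>X :: ('r, (nat \<Rightarrow> 'r) set) module. module R X \<longrightarrow>
        inj_on (loc_proj_map R C X) (carrier (tensor R X C)))"

locale coalgebra = module R C for R (structure) and C (structure) +
  fixes \<Delta> \<epsilon>
  assumes comult_lin: "\<Delta> \<in> lin_maps R C (tensor R C C)"
    and counit_lin: "\<epsilon> \<in> lin_maps R C (regular_module R)"
    and coassoc: "c \<in> carrier C \<Longrightarrow>
      tensor_assoc R C C C (tensor_map R C C (tensor R C C) C \<Delta> (\<lambda>x. x) (\<Delta> c))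
        = tensor_map R C C C (tensor R C C) (\<lambda>x. x) \<Delta> (\<Delta> c)"
    and counit_left: "c \<in> carrier C \<Longrightarrow>
      tensor_lift R C C C (\<lambda>x y. \<epsilon> x \<odot>\<^bsub>C\<^esub> y) (\<Delta> c) = c"
    and counit_right: "c \<in> carrier C \<Longrightarrow>
      tensor_lift R C C C (\<lambda>x y. \<epsilon> y \<odot>\<^bsub>C\<^esub> x) (\<Delta> c) = c"

locale right_comodule = coalgebra R C \<Delta> \<epsilon> + N: module R N
  for R (structure) and C (structure) and \<Delta> and \<epsilon> and N (structure) +
  fixes \<rho>
  assumes coact_lin: "\<rho> \<in> lin_maps R N (tensor R N C)"
    and coact_coassoc: "n \<in> carrier N \<Longrightarrow>
      tensor_assoc R N C C (tensor_map R N C (tensor R N C) C \<rho> (\<lambda>x. x) (\<rho> n))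
        = tensor_map R N C N (tensor R C C) (\<lambda>x. x) \<Delta> (\<rho> n)"
    and coact_counit: "n \<in> carrier N \<Longrightarrow>
      tensor_lift R N C N (\<lambda>x c. \<epsilon> c \<odot>\<^bsub>N\<^esub> x) (\<rho> n) = n"

definition convolution ::
  "('r,'k) ring_scheme \<Rightarrow> ('r,'c,'e) module_scheme \<Rightarrow> ('c \<Rightarrow> ('c \<times> 'c \<Rightarrow> 'r) set)
    \<Rightarrow> ('c \<Rightarrow> 'r) \<Rightarrow> ('c \<Rightarrow> 'r) \<Rightarrow> 'c \<Rightarrow> 'r" where
  "convolution R C \<Delta> f g =
     (\<lambda>c\<in>carrier C. tensor_lift R C C (regular_module R) (\<lambda>x y. f x \<otimes>\<^bsub>R\<^esub> g y) (\<Delta> c))"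

text \<open>The left action of \<open>C\<^sup>*\<close> on a right comodule.\<close>

definition comodule_act ::
  "('r,'k) ring_scheme \<Rightarrow> ('r,'c,'e) module_scheme \<Rightarrow> ('r,'n,'d) module_scheme
    \<Rightarrow> ('n \<Rightarrow> ('n \<times> 'c \<Rightarrow> 'r) set) \<Rightarrow> ('c \<Rightarrow> 'r) \<Rightarrow> 'n \<Rightarrow> 'n" where
  "comodule_act R C N \<rho> g n = tensor_lift R N C N (\<lambda>x c. g c \<odot>\<^bsub>N\<^esub> x) (\<rho> n)"

section \<open>Actions of \<open>C\<^sup>*\<close> on duals, rational parts and topologies\<close>

text \<open>Below, a left (right) \<open>C\<^sup>*\<close>-module is an \<open>R\<close>-module \<open>M\<close> together with its action, a function
  \<open>la g x\<close> (\<open>ra x g\<close>) of \<open>g \<in> C\<^sup>*\<close> and \<open>x \<in> M\<close>.\<close>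

definition dual_right_act ::
  "('r,'m,'e) module_scheme \<Rightarrow> ('g \<Rightarrow> 'm \<Rightarrow> 'm) \<Rightarrow> ('m \<Rightarrow> 'r) \<Rightarrow> 'g \<Rightarrow> 'm \<Rightarrow> 'r" where
  "dual_right_act M la f g = (\<lambda>x\<in>carrier M. f (la g x))"

definition dual_left_act ::
  "('r,'m,'e) module_scheme \<Rightarrow> ('m \<Rightarrow> 'g \<Rightarrow> 'm) \<Rightarrow> 'g \<Rightarrow> ('m \<Rightarrow> 'r) \<Rightarrow> 'm \<Rightarrow> 'r" where
  "dual_left_act M ra g f = (\<lambda>x\<in>carrier M. f (ra x g))"

definition rational_part ::
  "('r,'k) ring_scheme \<Rightarrow> ('r,'c,'e) module_scheme \<Rightarrow> ('r,'x,'d) module_scheme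
    \<Rightarrow> (('c \<Rightarrow> 'r) \<Rightarrow> 'x \<Rightarrow> 'x) \<Rightarrow> 'x set" where
  "rational_part R C X la = {x \<in> carrier X. \<exists>t\<in>carrier (tensor R X C).
     \<forall>g\<in>carrier (dual_module R C). la g x = tensor_lift R X C X (\<lambda>y c. g c \<odot>\<^bsub>X\<^esub> y) t}"

text \<open>\<open>C\<^sup>*\<close>-submodules that are \<open>R\<close>-cofinite.  Being a \<open>C\<^sup>*\<close>-submodule depends on \<open>C\<^sup>*\<close> only
  through its elements.\<close>

definition right_submodule ::
  "('r,'k) ring_scheme \<Rightarrow> ('r,'c,'e) module_scheme \<Rightarrow> ('r,'m,'d) module_scheme
    \<Rightarrow> ('m \<Rightarrow> ('c \<Rightarrow> 'r) \<Rightarrow> 'm) \<Rightarrow> 'm set \<Rightarrow> bool" where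
  "right_submodule R C M ra L \<longleftrightarrow>
     submodule L R M \<and> (\<forall>x\<in>L. \<forall>g\<in>carrier (dual_module R C). ra x g \<in> L)"

definition cofinite_submodules ::
  "('r,'k) ring_scheme \<Rightarrow> ('r,'c,'e) module_scheme \<Rightarrow> ('r,'m,'d) module_scheme
    \<Rightarrow> ('m \<Rightarrow> ('c \<Rightarrow> 'r) \<Rightarrow> 'm) \<Rightarrow> 'm set set" where
  "cofinite_submodules R C M ra =
     {L. right_submodule R C M ra L \<and> fin_gen R (quot_module R M L)}"

text \<open>\<open>M\<^sup>\<box>\<close> and \<open>M\<^sup>\<circ>\<close> for a right \<open>C\<^sup>*\<close>-module \<open>M\<close>.\<close>

definition box_dual ::
  "('r,'k) ring_scheme \<Rightarrow> ('r,'c,'e) module_scheme \<Rightarrow> ('r,'m,'d) module_scheme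
    \<Rightarrow> ('m \<Rightarrow> ('c \<Rightarrow> 'r) \<Rightarrow> 'm) \<Rightarrow> ('m \<Rightarrow> 'r) set" where
  "box_dual R C M ra = rational_part R C (dual_module R M) (dual_left_act M ra)"

definition circ_dual ::
  "('r,'k) ring_scheme \<Rightarrow> ('r,'c,'e) module_scheme \<Rightarrow> ('r,'m,'d) module_scheme
    \<Rightarrow> ('m \<Rightarrow> ('c \<Rightarrow> 'r) \<Rightarrow> 'm) \<Rightarrow> ('m \<Rightarrow> 'r) set" where
  "circ_dual R C M ra = {f \<in> carrier (dual_module R M).
     \<exists>L\<in>cofinite_submodules R C M ra. \<forall>x\<in>L. f x = \<zero>\<^bsub>R\<^esub>}"

text \<open>The exponents \<open>I\<close> can be taken in \<^typ>\<open>('m \<Rightarrow> 'r) set\<close> without loss of generality,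
  see \<open>embeds_in_powerI\<close>.\<close>

definition embeds_in_power ::
  "('r,'k) ring_scheme \<Rightarrow> ('r,'m,'e) module_scheme \<Rightarrow> bool" where
  "embeds_in_power R M \<longleftrightarrow>
     (\<exists>(I :: ('m \<Rightarrow> 'r) set) \<phi>. \<phi> \<in> lin_maps R M (power_module R I) \<and> inj_on \<phi> (carrier M))"

definition cofinitely_cogenerated ::
  "('r,'k) ring_scheme \<Rightarrow> ('r,'c,'e) module_scheme \<Rightarrow> ('r,'m,'d) module_scheme
    \<Rightarrow> ('m \<Rightarrow> ('c \<Rightarrow> 'r) \<Rightarrow> 'm) \<Rightarrow> bool" where
  "cofinitely_cogenerated R C M ra \<longleftrightarrow>
     (\<forall>L\<in>cofinite_submodules R C M ra. embeds_in_power R (quot_module R M L))"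

text \<open>The group topology in which the members of \<open>\<B>\<close> are a neighbourhood basis of zero
  (see \<open>openin_linear_topology\<close>).\<close>

definition linear_topology :: "('r,'m,'e) module_scheme \<Rightarrow> 'm set set \<Rightarrow> 'm topology" where
  "linear_topology M \<B> = topology_generated_by {H +>\<^bsub>M\<^esub> x | H x. H \<in> \<B> \<and> x \<in> carrier M}"

text \<open>The finite topology on \<open>N\<^sup>*\<close>, and the cofinite topology \<open>Cf(M)\<close>.\<close>

definition finite_topology ::
  "('r,'k) ring_scheme \<Rightarrow> ('r,'n,'d) module_scheme \<Rightarrow> ('n \<Rightarrow> 'r) topology" where
  "finite_topology R N = linear_topology (dual_module R N)
     {{f \<in> carrier (dual_module R N). \<forall>x\<in>K. f x = \<zero>\<^bsub>R\<^esub>} | K.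
        submodule K R N \<and> fin_gen R (N\<lparr>carrier := K\<rparr>)}"

definition cofinite_topology ::
  "('r,'k) ring_scheme \<Rightarrow> ('r,'c,'e) module_scheme \<Rightarrow> ('r,'m,'d) module_scheme
    \<Rightarrow> ('m \<Rightarrow> ('c \<Rightarrow> 'r) \<Rightarrow> 'm) \<Rightarrow> 'm topology" where
  "cofinite_topology R C M ra = linear_topology M (cofinite_submodules R C M ra)"

section \<open>Coreflexive comodules\<close>

text \<open>The right action of \<open>C\<^sup>*\<close> on \<open>N\<^sup>*\<close> for a right \<open>C\<close>-comodule \<open>(N, \<rho>)\<close>.\<close>

definition comodule_dual_act ::
  "('r,'k) ring_scheme \<Rightarrow> ('r,'c,'e) module_scheme \<Rightarrow> ('r,'n,'d) module_scheme
    \<Rightarrow> ('n \<Rightarrow> ('n \<times> 'c \<Rightarrow> 'r) set) \<Rightarrow> ('n \<Rightarrow> 'r) \<Rightarrow> ('c \<Rightarrow> 'r) \<Rightarrow> 'n \<Rightarrow> 'r" where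
  "comodule_dual_act R C N \<rho> = dual_right_act N (comodule_act R C N \<rho>)"

definition coreflexive ::
  "('r,'k) ring_scheme \<Rightarrow> ('r,'c,'e) module_scheme \<Rightarrow> ('r,'n,'d) module_scheme
    \<Rightarrow> ('n \<Rightarrow> ('n \<times> 'c \<Rightarrow> 'r) set) \<Rightarrow> bool" where
  "coreflexive R C N \<rho> \<longleftrightarrow>
     finite_topology R N = cofinite_topology R C (dual_module R N) (comodule_dual_act R C N \<rho>)"

text \<open>\<open>N\<close> is identified with the subset \<open>S\<close> of \<open>N\<^sup>*\<^sup>*\<close> via the canonical map.\<close>

definition eval_iso ::
  "('r,'k) ring_scheme \<Rightarrow> ('r,'n,'d) module_scheme \<Rightarrow> (('n \<Rightarrow> 'r) \<Rightarrow> 'r) set \<Rightarrow> bool" where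
  "eval_iso R N S \<longleftrightarrow> inj_on (eval_map R N) (carrier N) \<and> eval_map R N ` carrier N = S"

definition weakly_coreflexive ::
  "('r,'k) ring_scheme \<Rightarrow> ('r,'c,'e) module_scheme \<Rightarrow> ('r,'n,'d) module_scheme
    \<Rightarrow> ('n \<Rightarrow> ('n \<times> 'c \<Rightarrow> 'r) set) \<Rightarrow> bool" where
  "weakly_coreflexive R C N \<rho> \<longleftrightarrow>
     eval_iso R N (box_dual R C (dual_module R N) (comodule_dual_act R C N \<rho>))"

section \<open>Facts about the definitions\<close>

lemma cring_abelian: "cring R \<Longrightarrow> abelian_group R"
  by (simp add: cring_def ring_def)

lemma power_module_module:
  assumes "cring R" shows "module R (power_module R S)"
proof -
  interpret R: cring R by fact
  have g: "abelian_group (power_module R S)"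
  proof (rule abelian_groupI)
    fix u assume u: "u \<in> carrier (power_module R S)"
    show "\<exists>y\<in>carrier (power_module R S). y \<oplus>\<^bsub>power_module R S\<^esub> u = \<zero>\<^bsub>power_module R S\<^esub>"
      using u by (intro bexI[of _ "\<lambda>p\<in>S. \<ominus>\<^bsub>R\<^esub> u p"])
        (auto simp: power_module_def R.l_neg PiE_iff fun_eq_iff)
  qed (auto simp: power_module_def fun_eq_iff PiE_iff extensional_def R.a_ac)
  show ?thesis
    by (rule moduleI[OF assms g])
      (auto simp: power_module_def fun_eq_iff PiE_iff extensional_def R.l_distr R.r_distr R.m_assoc)
qed

lemma regular_module_module:
  assumes "cring R" shows "module R (regular_module R)"
proof -
  interpret R: cring R by fact
  have g: "abelian_group (regular_module R)"
    by (rule abelian_groupI)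
      (auto simp: regular_module_def R.a_ac intro: R.l_neg intro!: bexI[of _ "\<ominus>\<^bsub>R\<^esub> _"])
  show ?thesis
    by (rule moduleI[OF assms g]) (auto simp: regular_module_def R.l_distr R.r_distr R.m_assoc)
qed

lemma power_module_a_inv:
  assumes "cring R" "u \<in> carrier (power_module R S)"
  shows "\<ominus>\<^bsub>power_module R S\<^esub> u = (\<lambda>p\<in>S. \<ominus>\<^bsub>R\<^esub> u p)"
proof -
  interpret R: cring R by fact
  interpret P: module R "power_module R S" by (rule power_module_module) fact
  show ?thesis using assms(2)
    by (intro P.minus_equality) (auto simp: power_module_def R.l_neg PiE_iff fun_eq_iff)
qed

lemma free_carrier_submodule:
  assumes "cring R" shows "submodule (carrier (free_module R S)) R (power_module R S)"
proof -
  interpret R: cring R by fact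
  interpret P: module R "power_module R S" by (rule power_module_module) fact
  have c: "carrier (free_module R S) = {u \<in> carrier (power_module R S). finite (supp R S u)}"
    by (simp add: free_module_def power_module_def)
  show ?thesis
  proof (rule P.submoduleI)
    fix a assume a: "a \<in> carrier (free_module R S)"
    then have "supp R S (\<ominus>\<^bsub>power_module R S\<^esub> a) \<subseteq> supp R S a"
      by (auto simp: supp_def c power_module_a_inv[OF assms])
    with a show "\<ominus>\<^bsub>power_module R S\<^esub> a \<in> carrier (free_module R S)"
      unfolding c by (blast intro: finite_subset P.a_inv_closed)
  next
    fix a b assume ab: "a \<in> carrier (free_module R S)" "b \<in> carrier (free_module R S)"
    have "supp R S (a \<oplus>\<^bsub>power_module R S\<^esub> b) \<subseteq> supp R S a \<union> supp R S b"
      by (auto simp: supp_def power_module_def)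
    with ab show "a \<oplus>\<^bsub>power_module R S\<^esub> b \<in> carrier (free_module R S)"
      unfolding c by (blast intro: finite_subset P.a_closed finite_UnI)
  next
    fix a b assume ab: "a \<in> carrier R" "b \<in> carrier (free_module R S)"
    then have "supp R S (a \<odot>\<^bsub>power_module R S\<^esub> b) \<subseteq> supp R S b"
      by (auto simp: supp_def power_module_def)
    with ab show "a \<odot>\<^bsub>power_module R S\<^esub> b \<in> carrier (free_module R S)"
      unfolding c by (blast intro: finite_subset P.smult_closed)
  next
    have "supp R S \<zero>\<^bsub>power_module R S\<^esub> = {}" by (auto simp: supp_def power_module_def)
    then show "\<zero>\<^bsub>power_module R S\<^esub> \<in> carrier (free_module R S)" by (simp add: c)
  qed (auto simp: c)
qed

lemma free_module_module:
  assumes "cring R" shows "module R (free_module R S)"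
  using submodule.submodule_is_module[OF free_carrier_submodule[OF assms] power_module_module[OF assms]]
  by (simp add: free_module_def)

lemma lin_span_submodule:
  assumes "module R M" "A \<subseteq> carrier M" shows "submodule (lin_span R M A) R M"
proof -
  interpret M: module R M by fact
  show ?thesis
  proof (rule M.submoduleI)
    show "lin_span R M A \<subseteq> carrier M"
      using M.carrier_is_submodule assms(2) by (auto simp: lin_span_def)
    show "\<zero>\<^bsub>M\<^esub> \<in> lin_span R M A"
      by (auto simp: lin_span_def submodule_def dest: subgroup.one_closed)
  qed (auto simp: lin_span_def dest: M.submoduleE)
qed

lemma lin_span_minimal: "submodule H R M \<Longrightarrow> A \<subseteq> H \<Longrightarrow> lin_span R M A \<subseteq> H"
  by (auto simp: lin_span_def)

lemma lin_span_superset: "A \<subseteq> lin_span R M A"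
  by (auto simp: lin_span_def)

lemma submodule_abelian_subgroup:
  assumes "module R M" "submodule L R M" shows "abelian_subgroup L M"
proof -
  interpret M: module R M by fact
  show ?thesis
    using assms(2) by (intro abelian_subgroupI3 additive_subgroup.intro M.abelian_group_axioms)
      (simp add: submodule_def)
qed

lemma lin_mapsD:
  assumes "f \<in> lin_maps R M P"
  shows "x \<in> carrier M \<Longrightarrow> f x \<in> carrier P"
    and "x \<in> carrier M \<Longrightarrow> y \<in> carrier M \<Longrightarrow> f (x \<oplus>\<^bsub>M\<^esub> y) = f x \<oplus>\<^bsub>P\<^esub> f y"
    and "r \<in> carrier R \<Longrightarrow> x \<in> carrier M \<Longrightarrow> f (r \<odot>\<^bsub>M\<^esub> x) = r \<odot>\<^bsub>P\<^esub> f x"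
    and "f \<in> extensional (carrier M)"
  using assms by (auto simp: lin_maps_def PiE_iff)

lemma lin_maps_zero:
  assumes "module R M" "module R P" "f \<in> lin_maps R M P" shows "f \<zero>\<^bsub>M\<^esub> = \<zero>\<^bsub>P\<^esub>"
proof -
  interpret M: module R M by fact
  interpret P: module R P by fact
  have "f (\<zero>\<^bsub>R\<^esub> \<odot>\<^bsub>M\<^esub> \<zero>\<^bsub>M\<^esub>) = \<zero>\<^bsub>R\<^esub> \<odot>\<^bsub>P\<^esub> f \<zero>\<^bsub>M\<^esub>"
    by (intro lin_mapsD(3)[OF assms(3)]) auto
  then show ?thesis using lin_mapsD(1)[OF assms(3) M.zero_closed] by simp
qed

lemma lin_maps_a_inv:
  assumes "module R M" "module R P" "f \<in> lin_maps R M P" "x \<in> carrier M"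
  shows "f (\<ominus>\<^bsub>M\<^esub> x) = \<ominus>\<^bsub>P\<^esub> f x"
proof -
  interpret M: module R M by fact
  interpret P: module R P by fact
  have "f (\<ominus>\<^bsub>M\<^esub> x) \<oplus>\<^bsub>P\<^esub> f x = \<zero>\<^bsub>P\<^esub>"
    using assms lin_mapsD(2)[OF assms(3), of "\<ominus>\<^bsub>M\<^esub> x" x] lin_maps_zero[OF assms(1-3)]
    by (simp add: M.l_neg)
  then show ?thesis
    using assms(4) lin_mapsD(1)[OF assms(3)] by (metis P.minus_equality M.a_inv_closed)
qed

lemma lin_maps_minus:
  assumes "module R M" "module R P" "f \<in> lin_maps R M P" "x \<in> carrier M" "y \<in> carrier M"
  shows "f (x \<ominus>\<^bsub>M\<^esub> y) = f x \<ominus>\<^bsub>P\<^esub> f y"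
proof -
  interpret M: module R M by fact
  show ?thesis
    using assms by (simp add: a_minus_def lin_mapsD(2)[OF assms(3)] lin_maps_a_inv)
qed

lemma lin_maps_finsum:
  assumes "module R M" "module R P" "f \<in> lin_maps R M P" "finite A" "g \<in> A \<rightarrow> carrier M"
  shows "f (\<Oplus>\<^bsub>M\<^esub>i\<in>A. g i) = (\<Oplus>\<^bsub>P\<^esub>i\<in>A. f (g i))"
proof -
  interpret M: module R M by fact
  interpret P: module R P by fact
  show ?thesis using assms(4,5)
  proof (induction A)
    case empty then show ?case using lin_maps_zero[OF assms(1-3)] by simp
  next
    case (insert a A)
    then have "(\<lambda>i. f (g i)) \<in> A \<rightarrow> carrier P" "f (g a) \<in> carrier P"
      using lin_mapsD(1)[OF assms(3)] by auto
    with insert show ?case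
      by (simp add: lin_mapsD(2)[OF assms(3)])
  qed
qed

lemma lin_maps_kernel_submodule:
  assumes "module R M" "module R P" "f \<in> lin_maps R M P"
  shows "submodule {x \<in> carrier M. f x = \<zero>\<^bsub>P\<^esub>} R M"
proof -
  interpret M: module R M by fact
  interpret P: module R P by fact
  show ?thesis
    by (intro M.submoduleI) (auto simp: lin_maps_zero[OF assms] lin_maps_a_inv[OF assms] lin_mapsD[OF assms(3)])
qed

lemma quot_carrier: "carrier (quot_module R M L) = (\<lambda>x. L +>\<^bsub>M\<^esub> x) ` carrier M"
  by (auto simp: quot_module_def A_RCOSETS_def')

lemma quot_add:
  assumes "module R M" "submodule L R M" "x \<in> carrier M" "y \<in> carrier M"
  shows "(L +>\<^bsub>M\<^esub> x) \<oplus>\<^bsub>quot_module R M L\<^esub> (L +>\<^bsub>M\<^esub> y) = L +>\<^bsub>M\<^esub> (x \<oplus>\<^bsub>M\<^esub> y)"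
  using abelian_subgroup.a_rcos_sum[OF submodule_abelian_subgroup[OF assms(1,2)] assms(3,4)]
  by (simp add: quot_module_def)

lemma quot_smult:
  assumes "module R M" "submodule L R M" "r \<in> carrier R" "x \<in> carrier M"
  shows "r \<odot>\<^bsub>quot_module R M L\<^esub> (L +>\<^bsub>M\<^esub> x) = L +>\<^bsub>M\<^esub> (r \<odot>\<^bsub>M\<^esub> x)"
proof -
  interpret M: module R M by fact
  interpret L: abelian_subgroup L M by (rule submodule_abelian_subgroup) fact+
  have "L +>\<^bsub>M\<^esub> (r \<odot>\<^bsub>M\<^esub> y) = L +>\<^bsub>M\<^esub> (r \<odot>\<^bsub>M\<^esub> x)" if "y \<in> L +>\<^bsub>M\<^esub> x" for y
  proof -
    from that obtain l where l: "l \<in> L" "y = l \<oplus>\<^bsub>M\<^esub> x" by (auto simp: a_r_coset_def')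
    then have "r \<odot>\<^bsub>M\<^esub> y = r \<odot>\<^bsub>M\<^esub> l \<oplus>\<^bsub>M\<^esub> r \<odot>\<^bsub>M\<^esub> x" "r \<odot>\<^bsub>M\<^esub> l \<in> L"
      using assms(3,4) submodule.smult_closed[OF assms(2)] by (auto simp: M.smult_r_distr)
    then have "r \<odot>\<^bsub>M\<^esub> y \<in> L +>\<^bsub>M\<^esub> (r \<odot>\<^bsub>M\<^esub> x)" by (auto simp: a_r_coset_def')
    then show ?thesis using L.a_repr_independence' assms(3,4) by blast
  qed
  then show ?thesis
    using L.a_rcos_self[OF assms(4)] unfolding quot_module_def module.simps
    by (intro SUP_eq_const) blast
qed

lemma quot_zero: "\<zero>\<^bsub>quot_module R M L\<^esub> = L"
  by (simp add: quot_module_def)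

lemma quot_coset_zero:
  assumes "module R M" "submodule L R M"
  shows "L +>\<^bsub>M\<^esub> \<zero>\<^bsub>M\<^esub> = L"
proof -
  interpret M: module R M by fact
  show ?thesis
    using M.submoduleE(1)[OF assms(2)] by (rule M.a_coset_add_zero)
qed

lemma quot_coset_eq_zero_iff:
  assumes "module R M" "submodule L R M" "x \<in> carrier M"
  shows "L +>\<^bsub>M\<^esub> x = L \<longleftrightarrow> x \<in> L"
proof -
  interpret L: abelian_subgroup L M by (rule submodule_abelian_subgroup) fact+
  show ?thesis using L.a_rcos_self[OF assms(3)] L.a_rcos_const by auto
qed

lemma quot_module_module:
  assumes "module R M" "submodule L R M" shows "module R (quot_module R M L)"
proof -
  interpret M: module R M by fact
  let ?Q = "quot_module R M L"
  have z: "\<zero>\<^bsub>?Q\<^esub> = L +>\<^bsub>M\<^esub> \<zero>\<^bsub>M\<^esub>" by (simp add: quot_coset_zero[OF assms] quot_zero)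
  note q = quot_carrier quot_add[OF assms] quot_smult[OF assms] z
  have g: "abelian_group ?Q"
  proof (rule abelian_groupI)
    fix x assume "x \<in> carrier ?Q"
    then obtain y where "y \<in> carrier M" "x = L +>\<^bsub>M\<^esub> y" by (auto simp: q)
    then show "\<exists>y\<in>carrier ?Q. y \<oplus>\<^bsub>?Q\<^esub> x = \<zero>\<^bsub>?Q\<^esub>"
      by (intro bexI[of _ "L +>\<^bsub>M\<^esub> (\<ominus>\<^bsub>M\<^esub> y)"]) (auto simp: q M.l_neg)
  qed (auto simp: q M.a_ac)
  show ?thesis
    by (rule moduleI[OF M.cring_axioms g])
      (auto simp: q M.smult_l_distr M.smult_r_distr M.smult_assoc1)
qed

lemma quot_proj_lin:
  assumes "module R M" "submodule L R M"
  shows "(\<lambda>x\<in>carrier M. L +>\<^bsub>M\<^esub> x) \<in> lin_maps R M (quot_module R M L)"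
proof -
  interpret M: module R M by fact
  show ?thesis
    by (auto simp: lin_maps_def quot_carrier quot_add[OF assms] quot_smult[OF assms])
qed

subsection \<open>The universal property of free modules\<close>

lemma free_carrier: "carrier (free_module R S) = {u \<in> S \<rightarrow>\<^sub>E carrier R. finite (supp R S u)}"
  by (simp add: free_module_def)

lemma free_gen_closed:
  assumes "cring R" shows "free_gen R S p \<in> carrier (free_module R S)"
proof -
  interpret R: cring R by fact
  have "supp R S (free_gen R S p) \<subseteq> {p}" by (auto simp: supp_def free_gen_def)
  then have "finite (supp R S (free_gen R S p))" by (rule finite_subset) simp
  then show ?thesis by (auto simp: free_carrier free_gen_def)
qed

lemma free_ext_superset:
  assumes "module R Q" "b \<in> S \<rightarrow> carrier Q" "u \<in> S \<rightarrow> carrier R"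
    and "finite A" "supp R S u \<subseteq> A" "A \<subseteq> S"
  shows "free_ext R S Q b u = (\<Oplus>\<^bsub>Q\<^esub>p\<in>A. u p \<odot>\<^bsub>Q\<^esub> b p)"
proof -
  interpret Q: module R Q by fact
  have "u p \<odot>\<^bsub>Q\<^esub> b p = \<zero>\<^bsub>Q\<^esub>" if "p \<in> A - supp R S u" for p
  proof -
    have "u p = \<zero>\<^bsub>R\<^esub>" "p \<in> S" using that assms(6) by (auto simp: supp_def)
    then show ?thesis using assms(2) by (auto intro: Q.smult_l_null)
  qed
  moreover have "(\<lambda>p. u p \<odot>\<^bsub>Q\<^esub> b p) \<in> A \<rightarrow> carrier Q" using assms(2,3,6) by (auto simp: Pi_iff subset_iff)
  ultimately show ?thesis
    unfolding free_ext_def using assms(4,5) by (intro Q.add.finprod_mono_neutral_cong_left) auto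
qed

lemma free_ext_lin:
  assumes "module R Q" "b \<in> S \<rightarrow> carrier Q"
  shows "(\<lambda>u\<in>carrier (free_module R S). free_ext R S Q b u) \<in> lin_maps R (free_module R S) Q"
proof -
  interpret Q: module R Q by fact
  interpret F: module R "free_module R S" by (rule free_module_module) (rule Q.cring_axioms)
  have cl: "(\<lambda>p. u p \<odot>\<^bsub>Q\<^esub> b p) \<in> A \<rightarrow> carrier Q"
    if "u \<in> carrier (free_module R S)" "A \<subseteq> S" for u A
    using that assms(2) by (auto simp: free_carrier PiE_iff Pi_iff subset_iff)
  have sub: "supp R S u \<subseteq> S" for u by (auto simp: supp_def)
  have pi: "u \<in> S \<rightarrow> carrier R" if "u \<in> carrier (free_module R S)" for u
    using that by (auto simp: free_carrier)
  have fin: "finite (supp R S u)" if "u \<in> carrier (free_module R S)" for u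
    using that by (auto simp: free_carrier)
  have add: "(u \<oplus>\<^bsub>free_module R S\<^esub> v) p = u p \<oplus>\<^bsub>R\<^esub> v p" if "p \<in> S" for u v p
    using that by (simp add: free_module_def power_module_def)
  have sm: "(r \<odot>\<^bsub>free_module R S\<^esub> v) p = r \<otimes>\<^bsub>R\<^esub> v p" if "p \<in> S" for r v p
    using that by (simp add: free_module_def power_module_def)
  have 1: "free_ext R S Q b u \<in> carrier Q" if "u \<in> carrier (free_module R S)" for u
    unfolding free_ext_def by (rule Q.finsum_closed) (rule cl[OF that sub])
  have 2: "free_ext R S Q b (u \<oplus>\<^bsub>free_module R S\<^esub> v) = free_ext R S Q b u \<oplus>\<^bsub>Q\<^esub> free_ext R S Q b v"
    if u: "u \<in> carrier (free_module R S)" and v: "v \<in> carrier (free_module R S)" for u v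
  proof -
    let ?A = "supp R S u \<union> supp R S v"
    have A: "finite ?A" "?A \<subseteq> S" using fin u v sub by auto
    have s: "supp R S (u \<oplus>\<^bsub>free_module R S\<^esub> v) \<subseteq> ?A" by (auto simp: supp_def add)
    have "free_ext R S Q b (u \<oplus>\<^bsub>free_module R S\<^esub> v)
        = (\<Oplus>\<^bsub>Q\<^esub>p\<in>?A. (u \<oplus>\<^bsub>free_module R S\<^esub> v) p \<odot>\<^bsub>Q\<^esub> b p)"
      using u v by (intro free_ext_superset[OF assms] pi A s) auto
    also have "\<dots> = (\<Oplus>\<^bsub>Q\<^esub>p\<in>?A. u p \<odot>\<^bsub>Q\<^esub> b p \<oplus>\<^bsub>Q\<^esub> v p \<odot>\<^bsub>Q\<^esub> b p)"
    proof (rule Q.finsum_cong')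
      show "(\<lambda>p. u p \<odot>\<^bsub>Q\<^esub> b p \<oplus>\<^bsub>Q\<^esub> v p \<odot>\<^bsub>Q\<^esub> b p) \<in> ?A \<rightarrow> carrier Q"
        using cl[OF u A(2)] cl[OF v A(2)] by auto
      fix p assume "p \<in> ?A"
      then have "p \<in> S" using A(2) by auto
      then show "(u \<oplus>\<^bsub>free_module R S\<^esub> v) p \<odot>\<^bsub>Q\<^esub> b p = u p \<odot>\<^bsub>Q\<^esub> b p \<oplus>\<^bsub>Q\<^esub> v p \<odot>\<^bsub>Q\<^esub> b p"
        using pi[OF u] pi[OF v] assms(2) by (subst Q.smult_l_distr[symmetric]) (auto simp: add)
    qed simp
    also have "\<dots> = (\<Oplus>\<^bsub>Q\<^esub>p\<in>?A. u p \<odot>\<^bsub>Q\<^esub> b p) \<oplus>\<^bsub>Q\<^esub> (\<Oplus>\<^bsub>Q\<^esub>p\<in>?A. v p \<odot>\<^bsub>Q\<^esub> b p)"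
      by (rule Q.finsum_addf) (rule cl[OF u A(2)] cl[OF v A(2)])+
    also have "\<dots> = free_ext R S Q b u \<oplus>\<^bsub>Q\<^esub> free_ext R S Q b v"
      by (simp add: free_ext_superset[OF assms pi[OF u] A(1) _ A(2)]
          free_ext_superset[OF assms pi[OF v] A(1) _ A(2)])
    finally show ?thesis .
  qed
  have 3: "free_ext R S Q b (r \<odot>\<^bsub>free_module R S\<^esub> u) = r \<odot>\<^bsub>Q\<^esub> free_ext R S Q b u"
    if r: "r \<in> carrier R" and u: "u \<in> carrier (free_module R S)" for r u
  proof -
    let ?A = "supp R S u"
    have s: "supp R S (r \<odot>\<^bsub>free_module R S\<^esub> u) \<subseteq> ?A" using r by (auto simp: supp_def sm)
    have "free_ext R S Q b (r \<odot>\<^bsub>free_module R S\<^esub> u)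
        = (\<Oplus>\<^bsub>Q\<^esub>p\<in>?A. (r \<odot>\<^bsub>free_module R S\<^esub> u) p \<odot>\<^bsub>Q\<^esub> b p)"
      using u r by (intro free_ext_superset[OF assms] pi s fin sub) auto
    also have "\<dots> = (\<Oplus>\<^bsub>Q\<^esub>p\<in>?A. r \<odot>\<^bsub>Q\<^esub> (u p \<odot>\<^bsub>Q\<^esub> b p))"
    proof (rule Q.finsum_cong')
      show "(\<lambda>p. r \<odot>\<^bsub>Q\<^esub> (u p \<odot>\<^bsub>Q\<^esub> b p)) \<in> ?A \<rightarrow> carrier Q"
        using cl[OF u sub] r by auto
      fix p assume "p \<in> ?A"
      then have "p \<in> S" using sub by auto
      then show "(r \<odot>\<^bsub>free_module R S\<^esub> u) p \<odot>\<^bsub>Q\<^esub> b p = r \<odot>\<^bsub>Q\<^esub> (u p \<odot>\<^bsub>Q\<^esub> b p)"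
        using pi[OF u] r assms(2) by (subst Q.smult_assoc1[symmetric]) (auto simp: sm)
    qed simp
    also have "\<dots> = r \<odot>\<^bsub>Q\<^esub> free_ext R S Q b u"
      unfolding free_ext_def
      by (rule Q.finsum_smult_ldistr[symmetric]) (rule fin[OF u] r cl[OF u sub])+
    finally show ?thesis .
  qed
  show ?thesis by (auto simp: lin_maps_def 1 2 3)
qed

lemma free_ext_gen:
  assumes "module R Q" "b \<in> S \<rightarrow> carrier Q" "p \<in> S"
  shows "free_ext R S Q b (free_gen R S p) = b p"
proof -
  interpret Q: module R Q by fact
  have "free_ext R S Q b (free_gen R S p) = (\<Oplus>\<^bsub>Q\<^esub>q\<in>{p}. free_gen R S p q \<odot>\<^bsub>Q\<^esub> b q)"
    using assms(3) by (intro free_ext_superset[OF assms(1,2)]) (auto simp: supp_def free_gen_def)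
  also have "\<dots> = b p"
  proof -
    have "b p \<in> carrier Q" using assms(2,3) by auto
    then show ?thesis using assms(3) by (simp add: free_gen_def)
  qed
  finally show ?thesis .
qed

lemma free_lin_unique:
  assumes "module R Q" "f \<in> lin_maps R (free_module R S) Q" "g \<in> lin_maps R (free_module R S) Q"
    and eq: "\<And>p. p \<in> S \<Longrightarrow> f (free_gen R S p) = g (free_gen R S p)"
    and "u \<in> carrier (free_module R S)"
  shows "f u = g u"
proof -
  interpret Q: module R Q by fact
  let ?F = "free_module R S"
  interpret F: module R ?F by (rule free_module_module) (rule Q.cring_axioms)
  note gc = free_gen_closed[OF Q.cring_axioms]
  have "finite (supp R S u)" using assms(5) by (auto simp: free_carrier)
  then show ?thesis using assms(5)
  proof (induction "supp R S u" arbitrary: u rule: finite_induct)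
    case empty
    then have "u = \<zero>\<^bsub>?F\<^esub>"
      by (auto simp: supp_def free_module_def power_module_def fun_eq_iff PiE_iff extensional_def)
    then show ?case
      using lin_maps_zero[OF F.module_axioms assms(1,2)] lin_maps_zero[OF F.module_axioms assms(1,3)] by simp
  next
    case (insert p A)
    define v where "v = u(p := \<zero>\<^bsub>R\<^esub>)"
    have p: "p \<in> S" using insert(4) by (auto simp: supp_def)
    have sv: "A = supp R S v" using insert(2,4) by (auto simp: supp_def v_def)
    have v: "v \<in> carrier ?F"
      using insert(1,5) p sv by (auto simp: free_carrier v_def PiE_iff extensional_def)
    have up: "u p \<in> carrier R" using insert(5) p by (auto simp: free_carrier)
    have "u = u p \<odot>\<^bsub>?F\<^esub> free_gen R S p \<oplus>\<^bsub>?F\<^esub> v"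
      using insert(5) p up
      by (auto simp: v_def fun_eq_iff free_module_def power_module_def free_gen_def PiE_iff extensional_def)
    moreover have "f (u p \<odot>\<^bsub>?F\<^esub> free_gen R S p \<oplus>\<^bsub>?F\<^esub> v) = g (u p \<odot>\<^bsub>?F\<^esub> free_gen R S p \<oplus>\<^bsub>?F\<^esub> v)"
      using v up gc[of S p] eq[OF p] insert(3)[OF sv v]
      by (simp add: lin_mapsD[OF assms(2)] lin_mapsD[OF assms(3)])
    ultimately show ?case by simp
  qed
qed

lemma quot_coset_eqI:
  assumes "module R M" "submodule L R M" "x \<in> carrier M" "y \<in> carrier M" "x \<ominus>\<^bsub>M\<^esub> y \<in> L"
  shows "L +>\<^bsub>M\<^esub> x = L +>\<^bsub>M\<^esub> y"
proof -
  interpret L: abelian_subgroup L M by (rule submodule_abelian_subgroup) fact+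
  have "x \<in> L +>\<^bsub>M\<^esub> y" using L.a_rcos_module[of y x] assms(3-5) by (simp add: a_minus_def)
  then show ?thesis using L.a_repr_independence' assms(4) by blast
qed

lemma quot_lift_coset:
  assumes "module R M" "module R Q" "submodule L R M" "f \<in> lin_maps R M Q"
    and "\<And>x. x \<in> L \<Longrightarrow> f x = \<zero>\<^bsub>Q\<^esub>" and "x \<in> carrier M"
  shows "the_elem (f ` (L +>\<^bsub>M\<^esub> x)) = f x"
proof -
  interpret M: module R M by fact
  interpret Q: module R Q by fact
  interpret L: abelian_subgroup L M by (rule submodule_abelian_subgroup) fact+
  have "f y = f x" if "y \<in> L +>\<^bsub>M\<^esub> x" for y
  proof -
    from that obtain l where "l \<in> L" "y = l \<oplus>\<^bsub>M\<^esub> x" by (auto simp: a_r_coset_def')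
    then show ?thesis using assms(5,6) lin_mapsD[OF assms(4)] by simp
  qed
  moreover have "x \<in> L +>\<^bsub>M\<^esub> x" by (rule L.a_rcos_self) fact
  ultimately have "f ` (L +>\<^bsub>M\<^esub> x) = {f x}" by blast
  then show ?thesis by simp
qed

lemma quot_lift_lin:
  assumes "module R M" "module R Q" "submodule L R M" "f \<in> lin_maps R M Q"
    and "\<And>x. x \<in> L \<Longrightarrow> f x = \<zero>\<^bsub>Q\<^esub>"
  shows "(\<lambda>A\<in>carrier (quot_module R M L). the_elem (f ` A)) \<in> lin_maps R (quot_module R M L) Q"
proof -
  interpret M: module R M by fact
  note c = quot_lift_coset[OF assms]
  interpret MQ: module R "quot_module R M L" by (rule quot_module_module) fact+
  let ?h = "\<lambda>A\<in>carrier (quot_module R M L). the_elem (f ` A)"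
  have h: "?h (L +>\<^bsub>M\<^esub> x) = f x" if "x \<in> carrier M" for x
    using that by (simp add: c quot_carrier)
  have 1: "?h A \<in> carrier Q" if "A \<in> carrier (quot_module R M L)" for A
    using that h lin_mapsD(1)[OF assms(4)] by (auto simp: quot_carrier)
  have 2: "?h (A \<oplus>\<^bsub>quot_module R M L\<^esub> B) = ?h A \<oplus>\<^bsub>Q\<^esub> ?h B"
    if "A \<in> carrier (quot_module R M L)" "B \<in> carrier (quot_module R M L)" for A B
  proof -
    from that obtain x y where "x \<in> carrier M" "y \<in> carrier M" "A = L +>\<^bsub>M\<^esub> x" "B = L +>\<^bsub>M\<^esub> y"
      by (auto simp: quot_carrier)
    then show ?thesis
      using h lin_mapsD(2)[OF assms(4)] by (simp only: quot_add[OF assms(1,3)] M.a_closed)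
  qed
  have 3: "?h (r \<odot>\<^bsub>quot_module R M L\<^esub> A) = r \<odot>\<^bsub>Q\<^esub> ?h A"
    if "A \<in> carrier (quot_module R M L)" "r \<in> carrier R" for A r
  proof -
    from that obtain x where "x \<in> carrier M" "A = L +>\<^bsub>M\<^esub> x"
      by (auto simp: quot_carrier)
    then show ?thesis
      using h lin_mapsD(3)[OF assms(4)] that(2) by (simp only: quot_smult[OF assms(1,3)] M.smult_closed)
  qed
  have "?h \<in> carrier (quot_module R M L) \<rightarrow>\<^sub>E carrier Q"
    using 1 by (intro PiE_I) (simp_all only: restrict_apply if_False)
  then show ?thesis unfolding lin_maps_def using 2 3 by blast
qed

subsection \<open>The universal property of the tensor product\<close>

lemma bilinear_mapI:
  assumes "\<And>x y. x \<in> carrier M \<Longrightarrow> y \<in> carrier P \<Longrightarrow> b x y \<in> carrier Q"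
    and "\<And>x x' y. x \<in> carrier M \<Longrightarrow> x' \<in> carrier M \<Longrightarrow> y \<in> carrier P \<Longrightarrow>
           b (x \<oplus>\<^bsub>M\<^esub> x') y = b x y \<oplus>\<^bsub>Q\<^esub> b x' y"
    and "\<And>x y y'. x \<in> carrier M \<Longrightarrow> y \<in> carrier P \<Longrightarrow> y' \<in> carrier P \<Longrightarrow>
           b x (y \<oplus>\<^bsub>P\<^esub> y') = b x y \<oplus>\<^bsub>Q\<^esub> b x y'"
    and "\<And>r x y. r \<in> carrier R \<Longrightarrow> x \<in> carrier M \<Longrightarrow> y \<in> carrier P \<Longrightarrow>
           b (r \<odot>\<^bsub>M\<^esub> x) y = r \<odot>\<^bsub>Q\<^esub> b x y"
    and "\<And>r x y. r \<in> carrier R \<Longrightarrow> x \<in> carrier M \<Longrightarrow> y \<in> carrier P \<Longrightarrow>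
           b x (r \<odot>\<^bsub>P\<^esub> y) = r \<odot>\<^bsub>Q\<^esub> b x y"
    and "module R M" "module R P"
  shows "bilinear_map R M P Q b"
proof -
  interpret M: module R M by fact
  interpret P: module R P by fact
  show ?thesis using assms(1-5) by (simp add: bilinear_map_def lin_maps_def)
qed

lemma bilinear_mapD:
  assumes "bilinear_map R M P Q b" "module R M" "module R P"
  shows "x \<in> carrier M \<Longrightarrow> y \<in> carrier P \<Longrightarrow> b x y \<in> carrier Q"
    and "x \<in> carrier M \<Longrightarrow> x' \<in> carrier M \<Longrightarrow> y \<in> carrier P \<Longrightarrow>
           b (x \<oplus>\<^bsub>M\<^esub> x') y = b x y \<oplus>\<^bsub>Q\<^esub> b x' y"
    and "x \<in> carrier M \<Longrightarrow> y \<in> carrier P \<Longrightarrow> y' \<in> carrier P \<Longrightarrow>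
           b x (y \<oplus>\<^bsub>P\<^esub> y') = b x y \<oplus>\<^bsub>Q\<^esub> b x y'"
    and "r \<in> carrier R \<Longrightarrow> x \<in> carrier M \<Longrightarrow> y \<in> carrier P \<Longrightarrow>
           b (r \<odot>\<^bsub>M\<^esub> x) y = r \<odot>\<^bsub>Q\<^esub> b x y"
    and "r \<in> carrier R \<Longrightarrow> x \<in> carrier M \<Longrightarrow> y \<in> carrier P \<Longrightarrow>
           b x (r \<odot>\<^bsub>P\<^esub> y) = r \<odot>\<^bsub>Q\<^esub> b x y"
proof -
  interpret M: module R M by fact
  interpret P: module R P by fact
  note l = assms(1)[unfolded bilinear_map_def, THEN conjunct1, rule_format]
    and r = assms(1)[unfolded bilinear_map_def, THEN conjunct2, rule_format]
  show "x \<in> carrier M \<Longrightarrow> y \<in> carrier P \<Longrightarrow> b x y \<in> carrier Q"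
    using lin_mapsD(1)[OF l, of x y] by simp
  show "x \<in> carrier M \<Longrightarrow> x' \<in> carrier M \<Longrightarrow> y \<in> carrier P \<Longrightarrow>
           b (x \<oplus>\<^bsub>M\<^esub> x') y = b x y \<oplus>\<^bsub>Q\<^esub> b x' y"
    using lin_mapsD(2)[OF r, of y x x'] by simp
  show "x \<in> carrier M \<Longrightarrow> y \<in> carrier P \<Longrightarrow> y' \<in> carrier P \<Longrightarrow>
           b x (y \<oplus>\<^bsub>P\<^esub> y') = b x y \<oplus>\<^bsub>Q\<^esub> b x y'"
    using lin_mapsD(2)[OF l, of x y y'] by simp
  show "r \<in> carrier R \<Longrightarrow> x \<in> carrier M \<Longrightarrow> y \<in> carrier P \<Longrightarrow>
           b (r \<odot>\<^bsub>M\<^esub> x) y = r \<odot>\<^bsub>Q\<^esub> b x y"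
    using lin_mapsD(3)[OF r, of y r x] by simp
  show "r \<in> carrier R \<Longrightarrow> x \<in> carrier M \<Longrightarrow> y \<in> carrier P \<Longrightarrow>
           b x (r \<odot>\<^bsub>P\<^esub> y) = r \<odot>\<^bsub>Q\<^esub> b x y"
    using lin_mapsD(3)[OF l, of x r y] by simp
qed

lemma tensor_free_module: "cring R \<Longrightarrow> module R (tensor_free R M P)"
  unfolding tensor_free_def by (rule free_module_module)

lemma tensor_free_gen_closed:
  "cring R \<Longrightarrow> tensor_free_gen R M P x y \<in> carrier (tensor_free R M P)"
  unfolding tensor_free_def tensor_free_gen_def by (rule free_gen_closed)

lemma tensor_rels_subset:
  assumes "cring R" shows "tensor_rels R M P \<subseteq> carrier (tensor_free R M P)"
proof -
  interpret F: module R "tensor_free R M P" by (rule tensor_free_module) fact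
  show ?thesis
    using tensor_free_gen_closed[OF assms, of M P]
    by (auto simp: tensor_rels_def Let_def intro!: F.minus_closed)
qed

lemma tensor_null_submodule:
  "cring R \<Longrightarrow> submodule (tensor_null R M P) R (tensor_free R M P)"
  unfolding tensor_null_def by (intro lin_span_submodule tensor_free_module tensor_rels_subset)

lemma tensor_module: "cring R \<Longrightarrow> module R (tensor R M P)"
  unfolding tensor_def by (intro quot_module_module tensor_free_module tensor_null_submodule)

lemma tensor_carrierE:
  assumes "t \<in> carrier (tensor R M P)"
  obtains u where "u \<in> carrier (tensor_free R M P)"
    "t = tensor_null R M P +>\<^bsub>tensor_free R M P\<^esub> u"
  using assms by (auto simp: tensor_def quot_carrier)

lemma tens_closed: "cring R \<Longrightarrow> tens R M P x y \<in> carrier (tensor R M P)"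
  by (simp add: tens_def tensor_def quot_carrier tensor_free_gen_closed)

lemma tens_bilinear:
  assumes "module R M" "module R P"
  shows "bilinear_map R M P (tensor R M P) (tens R M P)"
proof -
  interpret M: module R M by fact
  let ?F = "tensor_free R M P" and ?d = "tensor_free_gen R M P"
  note cr = M.cring_axioms
  note ns = tensor_null_submodule[OF cr, of M P]
  interpret F: module R ?F by (rule tensor_free_module) (rule cr)
  note d = tensor_free_gen_closed[OF cr, of M P]
  note eqI = quot_coset_eqI[OF F.module_axioms ns]
  note a = quot_add[OF F.module_axioms ns, symmetric]
  note s = quot_smult[OF F.module_axioms ns, symmetric]
  have rel: "z \<in> tensor_null R M P" if "z \<in> tensor_rels R M P" for z
    using that lin_span_superset[of "tensor_rels R M P" R ?F] by (auto simp: tensor_null_def)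
  show ?thesis
  proof (rule bilinear_mapI[OF _ _ _ _ _ assms])
    show "tens R M P x y \<in> carrier (tensor R M P)" for x y by (rule tens_closed) (rule cr)
  next
    fix x x' y assume *: "x \<in> carrier M" "x' \<in> carrier M" "y \<in> carrier P"
    have "?d (x \<oplus>\<^bsub>M\<^esub> x') y \<ominus>\<^bsub>?F\<^esub> (?d x y \<oplus>\<^bsub>?F\<^esub> ?d x' y) \<in> tensor_null R M P"
      using * by (intro rel) (auto simp: tensor_rels_def Let_def)
    then show "tens R M P (x \<oplus>\<^bsub>M\<^esub> x') y = tens R M P x y \<oplus>\<^bsub>tensor R M P\<^esub> tens R M P x' y"
      unfolding tens_def tensor_def a[OF d d, symmetric] by (intro eqI d F.a_closed)
  next
    fix x y y' assume *: "x \<in> carrier M" "y \<in> carrier P" "y' \<in> carrier P"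
    have "?d x (y \<oplus>\<^bsub>P\<^esub> y') \<ominus>\<^bsub>?F\<^esub> (?d x y \<oplus>\<^bsub>?F\<^esub> ?d x y') \<in> tensor_null R M P"
      using * by (intro rel) (unfold tensor_rels_def Let_def, blast)
    then show "tens R M P x (y \<oplus>\<^bsub>P\<^esub> y') = tens R M P x y \<oplus>\<^bsub>tensor R M P\<^esub> tens R M P x y'"
      unfolding tens_def tensor_def a[OF d d, symmetric] by (intro eqI d F.a_closed)
  next
    fix r x y assume *: "r \<in> carrier R" "x \<in> carrier M" "y \<in> carrier P"
    have "?d (r \<odot>\<^bsub>M\<^esub> x) y \<ominus>\<^bsub>?F\<^esub> (r \<odot>\<^bsub>?F\<^esub> ?d x y) \<in> tensor_null R M P"
      using * by (intro rel) (unfold tensor_rels_def Let_def, blast)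
    then show "tens R M P (r \<odot>\<^bsub>M\<^esub> x) y = r \<odot>\<^bsub>tensor R M P\<^esub> tens R M P x y"
      unfolding tens_def tensor_def s[OF *(1) d, symmetric] by (intro eqI d F.smult_closed *(1))
  next
    fix r x y assume *: "r \<in> carrier R" "x \<in> carrier M" "y \<in> carrier P"
    have "?d x (r \<odot>\<^bsub>P\<^esub> y) \<ominus>\<^bsub>?F\<^esub> (r \<odot>\<^bsub>?F\<^esub> ?d x y) \<in> tensor_null R M P"
      using * by (intro rel) (unfold tensor_rels_def Let_def, blast)
    then show "tens R M P x (r \<odot>\<^bsub>P\<^esub> y) = r \<odot>\<^bsub>tensor R M P\<^esub> tens R M P x y"
      unfolding tens_def tensor_def s[OF *(1) d, symmetric] by (intro eqI d F.smult_closed *(1))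
  qed
qed

lemma bilinear_free_ext:
  assumes "module R M" "module R P" "module R Q" "bilinear_map R M P Q b"
  defines "f \<equiv> \<lambda>u\<in>carrier (tensor_free R M P). free_ext R (carrier M \<times> carrier P) Q (case_prod b) u"
  shows "f \<in> lin_maps R (tensor_free R M P) Q"
    and "x \<in> carrier M \<Longrightarrow> y \<in> carrier P \<Longrightarrow> f (tensor_free_gen R M P x y) = b x y"
    and "u \<in> tensor_null R M P \<Longrightarrow> f u = \<zero>\<^bsub>Q\<^esub>"
proof -
  interpret M: module R M by fact
  interpret P: module R P by fact
  interpret Q: module R Q by fact
  let ?F = "tensor_free R M P" and ?d = "tensor_free_gen R M P"
  interpret F: module R ?F by (rule tensor_free_module) (rule M.cring_axioms)
  note bl = bilinear_mapD[OF assms(4,1,2)]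
  have bc: "case_prod b \<in> carrier M \<times> carrier P \<rightarrow> carrier Q" using bl(1) by auto
  show f: "f \<in> lin_maps R ?F Q"
    unfolding f_def tensor_free_def by (rule free_ext_lin[OF assms(3) bc])
  note d = tensor_free_gen_closed[OF M.cring_axioms, of M P]
  have fd: "f (?d x y) = b x y" if "x \<in> carrier M" "y \<in> carrier P" for x y
    using free_ext_gen[OF assms(3) bc, of "(x, y)"] d[of x y] that
    by (simp add: f_def tensor_free_gen_def)
  then show "x \<in> carrier M \<Longrightarrow> y \<in> carrier P \<Longrightarrow> f (?d x y) = b x y" .
  let ?K = "{u \<in> carrier ?F. f u = \<zero>\<^bsub>Q\<^esub>}"
  have mi: "f (u \<ominus>\<^bsub>?F\<^esub> v) = \<zero>\<^bsub>Q\<^esub>" if "u \<in> carrier ?F" "v \<in> carrier ?F" "f u = f v" for u v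
    using that lin_maps_minus[OF F.module_axioms assms(3) f that(1,2)] lin_mapsD(1)[OF f that(2)]
    by (simp add: Q.r_neg a_minus_def)
  have "tensor_rels R M P \<subseteq> ?K"
  proof
    fix u assume "u \<in> tensor_rels R M P"
    then have "f u = \<zero>\<^bsub>Q\<^esub>"
      unfolding tensor_rels_def Let_def
    proof (elim UnE CollectE exE conjE, goal_cases)
      case (1 x x' y)
      then show ?case
        unfolding 1(1) using d by (intro mi) (simp_all add: fd bl lin_mapsD[OF f])
    next
      case (2 x y y')
      then show ?case
        unfolding 2(1) using d by (intro mi) (simp_all add: fd bl lin_mapsD[OF f])
    next
      case (3 r x y)
      then show ?case
        unfolding 3(1) using d by (intro mi) (simp_all add: fd bl lin_mapsD[OF f])
    next
      case (4 r x y)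
      then show ?case
        unfolding 4(1) using d by (intro mi) (simp_all add: fd bl lin_mapsD[OF f])
    qed
    then show "u \<in> ?K"
      using \<open>u \<in> tensor_rels R M P\<close> tensor_rels_subset[OF M.cring_axioms] by blast
  qed
  then have "tensor_null R M P \<subseteq> ?K"
    unfolding tensor_null_def
    by (rule lin_span_minimal[OF lin_maps_kernel_submodule[OF F.module_axioms assms(3) f]])
  then show "u \<in> tensor_null R M P \<Longrightarrow> f u = \<zero>\<^bsub>Q\<^esub>" by blast
qed

lemma tensor_lift_coset:
  assumes "module R M" "module R P" "module R Q" "bilinear_map R M P Q b"
    and u: "u \<in> carrier (tensor_free R M P)"
  shows "tensor_lift R M P Q b (tensor_null R M P +>\<^bsub>tensor_free R M P\<^esub> u)
     = free_ext R (carrier M \<times> carrier P) Q (case_prod b) u"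
proof -
  interpret M: module R M by fact
  let ?F = "tensor_free R M P"
  let ?f = "\<lambda>u\<in>carrier ?F. free_ext R (carrier M \<times> carrier P) Q (case_prod b) u"
  note F = tensor_free_module[OF M.cring_axioms, of M P]
  note ns = tensor_null_submodule[OF M.cring_axioms, of M P]
  interpret N: abelian_subgroup "tensor_null R M P" ?F by (rule submodule_abelian_subgroup[OF F ns])
  have "tensor_null R M P +>\<^bsub>?F\<^esub> u \<subseteq> carrier ?F"
    using N.a_elemrcos_carrier[OF u] by blast
  then have "free_ext R (carrier M \<times> carrier P) Q (case_prod b) ` (tensor_null R M P +>\<^bsub>?F\<^esub> u)
      = ?f ` (tensor_null R M P +>\<^bsub>?F\<^esub> u)"
    by (intro image_cong) auto
  then show ?thesis
    using quot_lift_coset[OF F assms(3) ns bilinear_free_ext(1)[OF assms(1-4)] bilinear_free_ext(3)[OF assms(1-4)] u] u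
    by (simp add: tensor_lift_def)
qed

lemma tensor_lift_tens:
  assumes "module R M" "module R P" "module R Q" "bilinear_map R M P Q b"
    and "x \<in> carrier M" "y \<in> carrier P"
  shows "tensor_lift R M P Q b (tens R M P x y) = b x y"
proof -
  interpret M: module R M by fact
  note d = tensor_free_gen_closed[OF M.cring_axioms, of M P x y]
  show ?thesis
    using bilinear_free_ext(2)[OF assms] d
    by (simp add: tens_def tensor_lift_coset[OF assms(1-4) d])
qed

lemma tensor_lift_lin:
  assumes "module R M" "module R P" "module R Q" "bilinear_map R M P Q b"
  shows "(\<lambda>t\<in>carrier (tensor R M P). tensor_lift R M P Q b t) \<in> lin_maps R (tensor R M P) Q"
proof -
  interpret M: module R M by fact
  let ?F = "tensor_free R M P"
  let ?f = "\<lambda>u\<in>carrier ?F. free_ext R (carrier M \<times> carrier P) Q (case_prod b) u"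
  note F = tensor_free_module[OF M.cring_axioms, of M P]
  note ns = tensor_null_submodule[OF M.cring_axioms, of M P]
  have "tensor_lift R M P Q b t = the_elem (?f ` t)" if t: "t \<in> carrier (tensor R M P)" for t
  proof -
    from t obtain u where u: "u \<in> carrier ?F" "t = tensor_null R M P +>\<^bsub>?F\<^esub> u"
      by (rule tensor_carrierE)
    then show ?thesis
      using tensor_lift_coset[OF assms u(1)]
        quot_lift_coset[OF F assms(3) ns bilinear_free_ext(1)[OF assms(1-4)] bilinear_free_ext(3)[OF assms(1-4)] u(1)]
      by simp
  qed
  then have "(\<lambda>t\<in>carrier (tensor R M P). tensor_lift R M P Q b t)
      = (\<lambda>t\<in>carrier (tensor R M P). the_elem (?f ` t))"
    by (intro restrict_ext)
  then show ?thesis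
    using quot_lift_lin[OF F assms(3) ns bilinear_free_ext(1)[OF assms(1-4)] bilinear_free_ext(3)[OF assms(1-4)]]
    by (simp add: tensor_def)
qed

lemma tensor_lin_unique:
  assumes "module R M" "module R P" "module R Q"
    and f: "f \<in> lin_maps R (tensor R M P) Q" and g: "g \<in> lin_maps R (tensor R M P) Q"
    and eq: "\<And>x y. x \<in> carrier M \<Longrightarrow> y \<in> carrier P \<Longrightarrow> f (tens R M P x y) = g (tens R M P x y)"
    and t: "t \<in> carrier (tensor R M P)"
  shows "f t = g t"
proof -
  interpret M: module R M by fact
  let ?F = "tensor_free R M P"
  note F = tensor_free_module[OF M.cring_axioms, of M P]
  interpret F: module R ?F by (rule F)
  note ns = tensor_null_submodule[OF M.cring_axioms, of M P]
  let ?p = "\<lambda>u\<in>carrier ?F. tensor_null R M P +>\<^bsub>?F\<^esub> u"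
  note p = quot_proj_lin[OF F ns, folded tensor_def]
  have comp: "(\<lambda>u\<in>carrier ?F. k (?p u)) \<in> lin_maps R ?F Q" if k: "k \<in> lin_maps R (tensor R M P) Q" for k
    using lin_mapsD(1-3)[OF k] lin_mapsD(1-3)[OF p]
    by (auto simp add: lin_maps_def simp del: restrict_apply cong: restrict_cong intro!: restrict_PiE)
       (simp_all)
  obtain u where u: "u \<in> carrier ?F" "t = tensor_null R M P +>\<^bsub>?F\<^esub> u"
    using t by (rule tensor_carrierE)
  have "(\<lambda>u\<in>carrier ?F. f (?p u)) u = (\<lambda>u\<in>carrier ?F. g (?p u)) u"
  proof (rule free_lin_unique[OF assms(3) comp[OF f, unfolded tensor_free_def] comp[OF g, unfolded tensor_free_def], folded tensor_free_def, OF _ u(1)])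
    fix q assume "q \<in> carrier M \<times> carrier P"
    then obtain x y where q: "q = (x, y)" "x \<in> carrier M" "y \<in> carrier P" by auto
    have "free_gen R (carrier M \<times> carrier P) q = tensor_free_gen R M P x y"
      by (simp add: tensor_free_gen_def q)
    then show "(\<lambda>u\<in>carrier ?F. f (?p u)) (free_gen R (carrier M \<times> carrier P) q)
        = (\<lambda>u\<in>carrier ?F. g (?p u)) (free_gen R (carrier M \<times> carrier P) q)"
      using eq[OF q(2,3)] tensor_free_gen_closed[OF M.cring_axioms, of M P x y] by (simp add: tens_def)
  qed
  then show ?thesis using u by simp
qed

lemma tensor_coset_expansion:
  assumes "module R M" "module R P" "u \<in> carrier (tensor_free R M P)"
  shows "tensor_null R M P +>\<^bsub>tensor_free R M P\<^esub> u
     = free_ext R (carrier M \<times> carrier P) (tensor R M P) (case_prod (tens R M P)) u"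
proof -
  interpret M: module R M by fact
  let ?T = "tensor R M P"
  note T = tensor_module[OF M.cring_axioms, of M P]
  interpret T: module R ?T by (rule T)
  note b = tens_bilinear[OF assms(1,2)]
  let ?t = "tensor_null R M P +>\<^bsub>tensor_free R M P\<^esub> u"
  have t: "?t \<in> carrier ?T" using assms(3) by (simp add: tensor_def quot_carrier)
  have "(\<lambda>t\<in>carrier ?T. t) \<in> lin_maps R ?T ?T" by (auto simp: lin_maps_def)
  then have "(\<lambda>t\<in>carrier ?T. tensor_lift R M P ?T (tens R M P) t) ?t = (\<lambda>t\<in>carrier ?T. t) ?t"
    by (rule tensor_lin_unique[OF assms(1,2) T tensor_lift_lin[OF assms(1,2) T b] _ _ t])
      (simp add: tensor_lift_tens[OF assms(1,2) T b] tens_closed[OF M.cring_axioms])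
  then show ?thesis
    using t tensor_lift_coset[OF assms(1,2) T b assms(3)] by simp
qed

lemma act_bilinear:
  assumes "module R X" "module R C" "f \<in> carrier (dual_module R C)"
  shows "bilinear_map R X C X (\<lambda>x c. f c \<odot>\<^bsub>X\<^esub> x)"
proof -
  interpret X: module R X by fact
  interpret C: module R C by fact
  have f: "f \<in> lin_maps R C (regular_module R)"
    using assms(3) by (simp add: dual_module_def hom_module_def)
  note fD = lin_mapsD(1-3)[OF f, unfolded regular_module_def, simplified]
  show ?thesis
  proof (rule bilinear_mapI[OF _ _ _ _ _ assms(1,2)])
    fix r x c assume "r \<in> carrier R" "x \<in> carrier X" "c \<in> carrier C"
    then show "f c \<odot>\<^bsub>X\<^esub> (r \<odot>\<^bsub>X\<^esub> x) = r \<odot>\<^bsub>X\<^esub> (f c \<odot>\<^bsub>X\<^esub> x)"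
      by (simp add: fD X.smult_assoc1[symmetric] X.m_comm)
  qed (simp_all add: fD X.smult_r_distr X.smult_l_distr X.smult_assoc1)
qed

lemma tensor_liftD:
  assumes "module R M" "module R P" "module R Q" "bilinear_map R M P Q b"
  shows "t \<in> carrier (tensor R M P) \<Longrightarrow> tensor_lift R M P Q b t \<in> carrier Q"
    and "s \<in> carrier (tensor R M P) \<Longrightarrow> t \<in> carrier (tensor R M P) \<Longrightarrow>
      tensor_lift R M P Q b (s \<oplus>\<^bsub>tensor R M P\<^esub> t) = tensor_lift R M P Q b s \<oplus>\<^bsub>Q\<^esub> tensor_lift R M P Q b t"
    and "r \<in> carrier R \<Longrightarrow> t \<in> carrier (tensor R M P) \<Longrightarrow>
      tensor_lift R M P Q b (r \<odot>\<^bsub>tensor R M P\<^esub> t) = r \<odot>\<^bsub>Q\<^esub> tensor_lift R M P Q b t"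
    and "finite A \<Longrightarrow> f \<in> A \<rightarrow> carrier (tensor R M P) \<Longrightarrow>
      tensor_lift R M P Q b (\<Oplus>\<^bsub>tensor R M P\<^esub>i\<in>A. f i) = (\<Oplus>\<^bsub>Q\<^esub>i\<in>A. tensor_lift R M P Q b (f i))"
proof -
  interpret M: module R M by fact
  interpret Q: module R Q by fact
  note T = tensor_module[OF M.cring_axioms, of M P]
  interpret T: module R "tensor R M P" by (rule T)
  note l = tensor_lift_lin[OF assms]
  show c: "t \<in> carrier (tensor R M P) \<Longrightarrow> tensor_lift R M P Q b t \<in> carrier Q" for t
    using lin_mapsD(1)[OF l, of t] by simp
  show "s \<in> carrier (tensor R M P) \<Longrightarrow> t \<in> carrier (tensor R M P) \<Longrightarrow>
      tensor_lift R M P Q b (s \<oplus>\<^bsub>tensor R M P\<^esub> t) = tensor_lift R M P Q b s \<oplus>\<^bsub>Q\<^esub> tensor_lift R M P Q b t"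
    using lin_mapsD(2)[OF l, of s t] by simp
  show "r \<in> carrier R \<Longrightarrow> t \<in> carrier (tensor R M P) \<Longrightarrow>
      tensor_lift R M P Q b (r \<odot>\<^bsub>tensor R M P\<^esub> t) = r \<odot>\<^bsub>Q\<^esub> tensor_lift R M P Q b t"
    using lin_mapsD(3)[OF l, of r t] by simp
  show "tensor_lift R M P Q b (\<Oplus>\<^bsub>tensor R M P\<^esub>i\<in>A. f i) = (\<Oplus>\<^bsub>Q\<^esub>i\<in>A. tensor_lift R M P Q b (f i))"
    if A: "finite A" and f: "f \<in> A \<rightarrow> carrier (tensor R M P)"
  proof -
    have "tensor_lift R M P Q b (\<Oplus>\<^bsub>tensor R M P\<^esub>i\<in>A. f i)
        = (\<Oplus>\<^bsub>Q\<^esub>i\<in>A. (\<lambda>t\<in>carrier (tensor R M P). tensor_lift R M P Q b t) (f i))"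
      using lin_maps_finsum[OF T assms(3) l A f] T.finsum_closed[OF f] by simp
    also have "\<dots> = (\<Oplus>\<^bsub>Q\<^esub>i\<in>A. tensor_lift R M P Q b (f i))"
      using f c by (intro Q.finsum_cong') auto
    finally show ?thesis .
  qed
qed

theorem locally_projective_any_module:
  fixes X :: "('r,'x,'d) module_scheme" and C :: "('r,'c,'e) module_scheme"
  assumes C: "module R C" and lp: "locally_projective R C" and X: "module R X"
  shows "inj_on (loc_proj_map R C X) (carrier (tensor R X C))"
proof (rule inj_onI)
  interpret C: module R C by fact
  interpret X: module R X by fact
  note cr = C.cring_axioms
  let ?T = "tensor R X C"
  note T = tensor_module[OF cr, of X C]
  interpret T: module R ?T by (rule T)
  fix t s assume t: "t \<in> carrier ?T" and s: "s \<in> carrier ?T"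
    and eq: "loc_proj_map R C X t = loc_proj_map R C X s"
  define w where "w = t \<ominus>\<^bsub>?T\<^esub> s"
  have w: "w \<in> carrier ?T" using t s by (simp add: w_def)
  have w0: "tensor_lift R X C X (\<lambda>x c. f c \<odot>\<^bsub>X\<^esub> x) w = \<zero>\<^bsub>X\<^esub>" if f: "f \<in> carrier (dual_module R C)" for f
  proof -
    let ?b = "\<lambda>x c. f c \<odot>\<^bsub>X\<^esub> x"
    note l = tensor_lift_lin[OF X C X act_bilinear[OF X C f]]
    have "tensor_lift R X C X ?b t = tensor_lift R X C X ?b s"
      using fun_cong[OF eq, of f] f by (simp add: loc_proj_map_def)
    then show ?thesis
      using lin_maps_minus[OF T X l t s] lin_mapsD(1)[OF l s] w t s by (simp add: w_def a_minus_def X.r_neg)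
  qed
  obtain u where u: "u \<in> carrier (tensor_free R X C)"
      "w = tensor_null R X C +>\<^bsub>tensor_free R X C\<^esub> u"
    using w by (rule tensor_carrierE)
  define A where "A = supp R (carrier X \<times> carrier C) u"
  have A: "finite A" "A \<subseteq> carrier X \<times> carrier C"
    using u(1) by (auto simp: A_def tensor_free_def free_carrier supp_def)
  have uA: "u p \<in> carrier R" "fst p \<in> carrier X" "snd p \<in> carrier C" if "p \<in> A" for p
    using that u(1) A(2) by (auto simp: tensor_free_def free_carrier PiE_iff)
  have w_eq: "w = (\<Oplus>\<^bsub>?T\<^esub>p\<in>A. u p \<odot>\<^bsub>?T\<^esub> tens R X C (fst p) (snd p))"
    using tensor_coset_expansion[OF X C u(1)] u(2) by (simp add: free_ext_def A_def case_prod_beta')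
  obtain j :: "'x \<times> 'c \<Rightarrow> nat" where j: "inj_on j A"
    using finite_imp_inj_to_nat_seg[OF A(1)] by blast
  define S where "S = j ` A"
  define b where "b = (\<lambda>i. fst (inv_into A j i))"
  have b: "b \<in> S \<rightarrow> carrier X" using uA(2) by (auto simp: b_def S_def inv_into_f_f[OF j])
  have bj: "b (j p) = fst p" if "p \<in> A" for p using that by (simp add: b_def inv_into_f_f[OF j])
  let ?G = "free_module R S"
  note G = free_module_module[OF cr, of S]
  define h where "h = (\<lambda>v\<in>carrier ?G. free_ext R S X b v)"
  have h: "h \<in> lin_maps R ?G X" unfolding h_def by (rule free_ext_lin[OF X b])
  define L where "L = {v \<in> carrier ?G. h v = \<zero>\<^bsub>X\<^esub>}"
  have L: "submodule L R ?G" unfolding L_def by (rule lin_maps_kernel_submodule[OF G X h])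
  have hL: "\<And>v. v \<in> L \<Longrightarrow> h v = \<zero>\<^bsub>X\<^esub>" by (simp add: L_def)
  let ?Y = "quot_module R ?G L"
  note Y = quot_module_module[OF G L]
  interpret Y: module R ?Y by (rule Y)
  define dec where "dec = (\<lambda>A\<in>carrier ?Y. the_elem (h ` A))"
  have dec: "dec \<in> lin_maps R ?Y X" unfolding dec_def by (rule quot_lift_lin[OF G X L h hL])
  have dec_coset: "dec (L +>\<^bsub>?G\<^esub> v) = h v" if "v \<in> carrier ?G" for v
    using that quot_lift_coset[OF G X L h hL that] by (simp add: dec_def quot_carrier)
  have dec0: "y = \<zero>\<^bsub>?Y\<^esub>" if y: "y \<in> carrier ?Y" "dec y = \<zero>\<^bsub>X\<^esub>" for y
  proof -
    from y(1) obtain v where v: "v \<in> carrier ?G" "y = L +>\<^bsub>?G\<^esub> v" by (auto simp: quot_carrier)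
    with y(2) have "h v = \<zero>\<^bsub>X\<^esub>" by (simp add: dec_coset)
    with v(1) have "v \<in> L" by (simp add: L_def)
    then show ?thesis using quot_coset_eq_zero_iff[OF G L v(1)] v(2) by (simp add: quot_zero)
  qed
  define g where "g p = L +>\<^bsub>?G\<^esub> free_gen R S (j p)" for p
  have g: "g p \<in> carrier ?Y" for p
    using free_gen_closed[OF cr, of S "j p"] by (auto simp: g_def quot_carrier)
  have dg: "dec (g p) = fst p" if "p \<in> A" for p
  proof -
    have "j p \<in> S" using that by (simp add: S_def)
    then show ?thesis
      using that free_ext_gen[OF X b, of "j p"] free_gen_closed[OF cr, of S "j p"]
      by (simp add: g_def dec_coset h_def bj)
  qed
  let ?V = "tensor R ?Y C"
  note V = tensor_module[OF cr, of ?Y C]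
  interpret V: module R ?V by (rule V)
  define w' where "w' = (\<Oplus>\<^bsub>?V\<^esub>p\<in>A. u p \<odot>\<^bsub>?V\<^esub> tens R ?Y C (g p) (snd p))"
  have Vt: "(\<lambda>p. u p \<odot>\<^bsub>?V\<^esub> tens R ?Y C (g p) (snd p)) \<in> A \<rightarrow> carrier ?V"
    using uA(1) tens_closed[OF cr, of ?Y C] by auto
  have w': "w' \<in> carrier ?V" unfolding w'_def by (rule V.finsum_closed[OF Vt])
  have lift0: "tensor_lift R ?Y C ?Y (\<lambda>x c. f c \<odot>\<^bsub>?Y\<^esub> x) w' = \<zero>\<^bsub>?Y\<^esub>"
    if f: "f \<in> carrier (dual_module R C)" for f
  proof -
    have fc: "f c \<in> carrier R" if "c \<in> carrier C" for c
      using f that by (auto simp: dual_module_def hom_module_def regular_module_def lin_maps_def)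
    note bY = act_bilinear[OF Y C f] and bX = act_bilinear[OF X C f]
    let ?z = "tensor_lift R ?Y C ?Y (\<lambda>x c. f c \<odot>\<^bsub>?Y\<^esub> x) w'"
    note lY = tensor_liftD[OF Y C Y bY] and lX = tensor_liftD[OF X C X bX]
    have z: "?z \<in> carrier ?Y" by (rule lY(1)[OF w'])
    have "?z = (\<Oplus>\<^bsub>?Y\<^esub>p\<in>A. tensor_lift R ?Y C ?Y (\<lambda>x c. f c \<odot>\<^bsub>?Y\<^esub> x)
         (u p \<odot>\<^bsub>?V\<^esub> tens R ?Y C (g p) (snd p)))"
      unfolding w'_def by (rule lY(4)[OF A(1) Vt])
    also have "\<dots> = (\<Oplus>\<^bsub>?Y\<^esub>p\<in>A. u p \<odot>\<^bsub>?Y\<^esub> (f (snd p) \<odot>\<^bsub>?Y\<^esub> g p))"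
      using uA g fc
      by (intro Y.finsum_cong') (simp_all add: Pi_iff lY(3) tens_closed[OF cr] tensor_lift_tens[OF Y C Y bY])
    finally have "dec ?z = dec (\<Oplus>\<^bsub>?Y\<^esub>p\<in>A. u p \<odot>\<^bsub>?Y\<^esub> (f (snd p) \<odot>\<^bsub>?Y\<^esub> g p))" by (rule arg_cong)
    also have "\<dots> = (\<Oplus>\<^bsub>X\<^esub>p\<in>A. dec (u p \<odot>\<^bsub>?Y\<^esub> (f (snd p) \<odot>\<^bsub>?Y\<^esub> g p)))"
      using uA g fc by (intro lin_maps_finsum[OF Y X dec A(1)]) auto
    also have "\<dots> = (\<Oplus>\<^bsub>X\<^esub>p\<in>A. u p \<odot>\<^bsub>X\<^esub> (f (snd p) \<odot>\<^bsub>X\<^esub> fst p))"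
      using uA g fc by (intro X.finsum_cong') (simp_all add: Pi_iff lin_mapsD(3)[OF dec] dg)
    also have "\<dots> = (\<Oplus>\<^bsub>X\<^esub>p\<in>A. tensor_lift R X C X (\<lambda>x c. f c \<odot>\<^bsub>X\<^esub> x)
         (u p \<odot>\<^bsub>?T\<^esub> tens R X C (fst p) (snd p)))"
      using uA fc tens_closed[OF cr, of X C]
      by (intro X.finsum_cong') (simp_all add: Pi_iff lX(1,3) tensor_lift_tens[OF X C X bX])
    also have "\<dots> = tensor_lift R X C X (\<lambda>x c. f c \<odot>\<^bsub>X\<^esub> x) w"
      unfolding w_eq using uA(1) tens_closed[OF cr, of X C] by (intro lX(4)[symmetric] A(1)) auto
    also have "\<dots> = \<zero>\<^bsub>X\<^esub>" using w w0[OF f] by simp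
    finally show ?thesis using dec0[OF z] by simp
  qed
  have "loc_proj_map R C ?Y w' = loc_proj_map R C ?Y \<zero>\<^bsub>?V\<^esub>"
    unfolding loc_proj_map_def
  proof (rule restrict_ext)
    fix f assume f: "f \<in> carrier (dual_module R C)"
    show "tensor_lift R ?Y C ?Y (\<lambda>x c. f c \<odot>\<^bsub>?Y\<^esub> x) w' = tensor_lift R ?Y C ?Y (\<lambda>x c. f c \<odot>\<^bsub>?Y\<^esub> x) \<zero>\<^bsub>?V\<^esub>"
      using lift0[OF f] lin_maps_zero[OF V Y tensor_lift_lin[OF Y C Y act_bilinear[OF Y C f]]] by simp
  qed
  then have w'0: "w' = \<zero>\<^bsub>?V\<^esub>"
    using lp[unfolded locally_projective_def, rule_format, OF Y] w' by (auto dest: inj_onD)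
  have bT: "bilinear_map R ?Y C ?T (\<lambda>x c. tens R X C (dec x) c)"
    using bilinear_mapD[OF tens_bilinear[OF X C] X C] lin_mapsD(1-3)[OF dec]
    by (intro bilinear_mapI Y C) simp_all
  note lT = tensor_liftD[OF Y C T bT]
  have "tensor_lift R ?Y C ?T (\<lambda>x c. tens R X C (dec x) c) w'
     = (\<Oplus>\<^bsub>?T\<^esub>p\<in>A. tensor_lift R ?Y C ?T (\<lambda>x c. tens R X C (dec x) c)
          (u p \<odot>\<^bsub>?V\<^esub> tens R ?Y C (g p) (snd p)))"
    unfolding w'_def by (rule lT(4)[OF A(1) Vt])
  also have "\<dots> = w"
    unfolding w_eq using uA g
    by (intro T.finsum_cong') (simp_all add: Pi_iff tens_closed[OF cr] lT(3) tensor_lift_tens[OF Y C T bT] dg)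
  finally have "w = \<zero>\<^bsub>?T\<^esub>"
    using lin_maps_zero[OF V T tensor_lift_lin[OF Y C T bT]] w'0 by simp
  then have "\<ominus>\<^bsub>?T\<^esub> (\<ominus>\<^bsub>?T\<^esub> s) = t"
    using t s by (intro T.minus_equality) (auto simp: w_def a_minus_def)
  then show "t = s" using s by simp
qed

lemma tensor_map_bilinear:
  assumes "module R M" "module R P" "module R M'" "module R P'"
    and f: "\<And>x. x \<in> carrier M \<Longrightarrow> f x = f' x" "f' \<in> lin_maps R M M'"
    and g: "\<And>x. x \<in> carrier P \<Longrightarrow> g x = g' x" "g' \<in> lin_maps R P P'"
  shows "bilinear_map R M P (tensor R M' P') (\<lambda>x y. tens R M' P' (f x) (g y))"
proof -
  interpret M: module R M by fact
  interpret P: module R P by fact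
  show ?thesis
    using bilinear_mapD[OF tens_bilinear[OF assms(3,4)] assms(3,4)] lin_mapsD(1-3)[OF f(2)]
      lin_mapsD(1-3)[OF g(2)]
    by (intro bilinear_mapI assms(1,2)) (simp_all add: f(1) g(1))
qed

lemma lin_maps_id: "(\<lambda>x\<in>carrier M. x) \<in> lin_maps R M M" if "module R M"
proof -
  interpret M: module R M by fact
  show ?thesis by (auto simp: lin_maps_def)
qed

lemma lin_maps_compose:
  assumes "module R M" "f \<in> lin_maps R M P" "g \<in> lin_maps R P Q"
  shows "(\<lambda>x\<in>carrier M. g (f x)) \<in> lin_maps R M Q"
proof -
  interpret M: module R M by fact
  show ?thesis
    using lin_mapsD(1-3)[OF assms(2)] lin_mapsD(1-3)[OF assms(3)] by (simp add: lin_maps_def)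
qed

lemma regular_carrier [simp]: "carrier (regular_module R) = carrier R"
  by (simp add: regular_module_def)

lemma dual_carrier: "carrier (dual_module R M) = lin_maps R M (regular_module R)"
  by (simp add: dual_module_def hom_module_def)

lemma dualD:
  assumes "f \<in> carrier (dual_module R M)"
  shows "x \<in> carrier M \<Longrightarrow> f x \<in> carrier R"
    and "x \<in> carrier M \<Longrightarrow> y \<in> carrier M \<Longrightarrow> f (x \<oplus>\<^bsub>M\<^esub> y) = f x \<oplus>\<^bsub>R\<^esub> f y"
    and "r \<in> carrier R \<Longrightarrow> x \<in> carrier M \<Longrightarrow> f (r \<odot>\<^bsub>M\<^esub> x) = r \<otimes>\<^bsub>R\<^esub> f x"
  using lin_mapsD(1-3)[of f R M "regular_module R"] assms
  by (auto simp: dual_carrier regular_module_def)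

lemma lin_maps_add:
  assumes "module R M" "module R P" "f \<in> lin_maps R M P" "g \<in> lin_maps R M P"
  shows "(\<lambda>x\<in>carrier M. f x \<oplus>\<^bsub>P\<^esub> g x) \<in> lin_maps R M P"
proof -
  interpret M: module R M by fact
  interpret P: module R P by fact
  show ?thesis
    using lin_mapsD(1-3)[OF assms(3)] lin_mapsD(1-3)[OF assms(4)]
    by (simp add: lin_maps_def P.smult_r_distr P.a_ac)
qed

lemma lin_maps_smult:
  assumes "module R M" "module R P" "f \<in> lin_maps R M P" "r \<in> carrier R"
  shows "(\<lambda>x\<in>carrier M. r \<odot>\<^bsub>P\<^esub> f x) \<in> lin_maps R M P"
proof -
  interpret M: module R M by fact
  interpret P: module R P by fact
  show ?thesis
    using lin_mapsD(1-3)[OF assms(3)] assms(4)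
    by (simp add: lin_maps_def P.smult_r_distr P.smult_assoc1[symmetric] M.R.m_comm)
qed

lemma hom_module_module:
  assumes "module R M" "module R P" shows "module R (hom_module R M P)"
proof -
  interpret M: module R M by fact
  interpret P: module R P by fact
  note add = lin_maps_add[OF assms] and sm = lin_maps_smult[OF assms]
  have z: "(\<lambda>x\<in>carrier M. \<zero>\<^bsub>P\<^esub>) \<in> lin_maps R M P"
    by (simp add: lin_maps_def)
  have neg: "(\<lambda>x\<in>carrier M. \<ominus>\<^bsub>P\<^esub> f x) \<in> lin_maps R M P" if "f \<in> lin_maps R M P" for f
    using lin_mapsD(1-3)[OF that] by (simp add: lin_maps_def P.minus_add P.smult_r_minus)
  note D = lin_mapsD(1)[of _ R M P]
  have rs: "restrict f (carrier M) = f" if "f \<in> lin_maps R M P" for f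
    using lin_mapsD(4)[OF that] by (rule extensional_restrict)
  have g: "abelian_group (hom_module R M P)"
  proof (rule abelian_groupI)
    fix f assume "f \<in> carrier (hom_module R M P)"
    then have f: "f \<in> lin_maps R M P" by (simp add: hom_module_def)
    show "\<exists>y\<in>carrier (hom_module R M P). y \<oplus>\<^bsub>hom_module R M P\<^esub> f = \<zero>\<^bsub>hom_module R M P\<^esub>"
      using neg[OF f] D[OF f] by (intro bexI[of _ "\<lambda>x\<in>carrier M. \<ominus>\<^bsub>P\<^esub> f x"])
        (auto simp: hom_module_def P.l_neg intro!: restrict_ext)
  qed (use D in \<open>auto simp: hom_module_def add z rs P.a_ac cong: restrict_cong intro!: restrict_ext\<close>)
  show ?thesis
    by (rule moduleI[OF M.cring_axioms g])
      (use D in \<open>auto simp: hom_module_def sm add P.smult_l_distr P.smult_r_distr P.smult_assoc1 rs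
         cong: restrict_cong intro!: restrict_ext\<close>)
qed

lemma dual_module_module:
  assumes "module R M" shows "module R (dual_module R M)"
  unfolding dual_module_def
  using assms by (intro hom_module_module regular_module_module) (auto dest: module.axioms)

context right_comodule
begin

lemma comodule_act_lin:
  assumes "g \<in> carrier (dual_module R C)"
  shows "(\<lambda>n\<in>carrier N. comodule_act R C N \<rho> g n) \<in> lin_maps R N N"
proof -
  note l = tensor_lift_lin[OF N.module_axioms module_axioms N.module_axioms
      act_bilinear[OF N.module_axioms module_axioms assms]]
  have "(\<lambda>n\<in>carrier N. comodule_act R C N \<rho> g n)
      = (\<lambda>n\<in>carrier N. (\<lambda>t\<in>carrier (tensor R N C). tensor_lift R N C N (\<lambda>x c. g c \<odot>\<^bsub>N\<^esub> x) t) (\<rho> n))"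
    using lin_mapsD(1)[OF coact_lin] by (intro restrict_ext) (simp add: comodule_act_def)
  then show ?thesis using lin_maps_compose[OF N.module_axioms coact_lin l] by simp
qed

lemma comodule_act_counit:
  "n \<in> carrier N \<Longrightarrow> comodule_act R C N \<rho> \<epsilon> n = n"
  by (simp add: comodule_act_def coact_counit)

lemma comodule_act_convolution:
  assumes g: "g \<in> carrier (dual_module R C)" and h: "h \<in> carrier (dual_module R C)"
    and n: "n \<in> carrier N"
  shows "comodule_act R C N \<rho> (convolution R C \<Delta> g h) n
       = comodule_act R C N \<rho> g (comodule_act R C N \<rho> h n)"
proof -
  note C = module_axioms and N = N.module_axioms and RR = regular_module_module[OF cring_axioms]
  let ?CC = "tensor R C C" and ?NC = "tensor R N C" and ?U = "tensor R N (tensor R C C)"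
  note CC = tensor_module[OF cring_axioms, of C C] and NC = tensor_module[OF cring_axioms, of N C]
    and U = tensor_module[OF cring_axioms, of N ?CC]
    and NCC = tensor_module[OF cring_axioms, of ?NC C]
  note gD = dualD[OF g] and hD = dualD[OF h]
  have bgh: "bilinear_map R C C (regular_module R) (\<lambda>x y. g x \<otimes> h y)"
    by (rule bilinear_mapI[OF _ _ _ _ _ C C])
      (auto simp: regular_module_def gD hD l_distr r_distr m_ac)
  define gh where "gh = (\<lambda>t\<in>carrier ?CC. tensor_lift R C C (regular_module R) (\<lambda>x y. g x \<otimes> h y) t)"
  have gh: "gh \<in> carrier (dual_module R ?CC)"
    unfolding gh_def dual_carrier by (rule tensor_lift_lin[OF C C RR bgh])
  have gh_tens: "gh (tens R C C x y) = g x \<otimes> h y" if "x \<in> carrier C" "y \<in> carrier C" for x y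
    using that by (simp add: gh_def tens_closed[OF cring_axioms] tensor_lift_tens[OF C C RR bgh])
  have conv: "convolution R C \<Delta> g h c = gh (\<Delta> c)" if "c \<in> carrier C" for c
    using that lin_mapsD(1)[OF comult_lin] by (simp add: convolution_def gh_def)
  have conv_dual: "convolution R C \<Delta> g h \<in> carrier (dual_module R C)"
  proof -
    have "convolution R C \<Delta> g h = (\<lambda>c\<in>carrier C. gh (\<Delta> c))"
      using conv by (auto simp: convolution_def fun_eq_iff)
    then show ?thesis
      using lin_maps_compose[OF C comult_lin gh[unfolded dual_carrier]] by (simp add: dual_carrier)
  qed
  note bth = act_bilinear[OF N CC gh] and bcv = act_bilinear[OF N C conv_dual]
  define th where "th = (\<lambda>t\<in>carrier ?U. tensor_lift R N ?CC N (\<lambda>x t. gh t \<odot>\<^bsub>N\<^esub> x) t)"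
  have th: "th \<in> lin_maps R ?U N" unfolding th_def by (rule tensor_lift_lin[OF N CC N bth])
  have th_tens: "th (tens R N ?CC x t) = gh t \<odot>\<^bsub>N\<^esub> x" if "x \<in> carrier N" "t \<in> carrier ?CC" for x t
    using that by (simp add: th_def tens_closed[OF cring_axioms] tensor_lift_tens[OF N CC N bth])
  have idN: "x \<in> carrier N \<Longrightarrow> x = (\<lambda>x\<in>carrier N. x) x" for x by simp
  have idC: "x \<in> carrier C \<Longrightarrow> x = (\<lambda>x\<in>carrier C. x) x" for x by simp
  note b1 = tensor_map_bilinear[OF N C N CC idN lin_maps_id[OF N] refl comult_lin]
  note b2 = tensor_map_bilinear[OF N C NC C refl coact_lin idC lin_maps_id[OF C]]
  note l1 = tensor_lift_lin[OF N C U b1, folded tensor_map_def]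
  note l2 = tensor_lift_lin[OF N C NCC b2, folded tensor_map_def]
  note bU = bilinear_mapD[OF tens_bilinear[OF N CC] N CC]
    and bCC = bilinear_mapD[OF tens_bilinear[OF C C] C C]
  have bz: "bilinear_map R N C ?U (\<lambda>x y. tens R N ?CC x (tens R C C y z))" if "z \<in> carrier C" for z
    by (rule bilinear_mapI[OF _ _ _ _ _ N C]) (simp_all add: bU bCC that)
  let ?asc = "\<lambda>t z. tensor_lift R N C ?U (\<lambda>x y. tens R N ?CC x (tens R C C y z)) t"
  note lz = tensor_lift_lin[OF N C U bz]
  interpret U: module R ?U by (rule U)
  interpret NC: module R ?NC by (rule NC)
  have asc_tens: "?asc (tens R N C x y) z = tens R N ?CC x (tens R C C y z)"
    if "x \<in> carrier N" "y \<in> carrier C" "z \<in> carrier C" for x y z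
    using tensor_lift_tens[OF N C U bz[OF that(3)] that(1,2)] .
  have basc: "bilinear_map R ?NC C ?U ?asc"
  proof (rule bilinear_mapI[OF _ _ _ _ _ NC C])
    fix t z assume "t \<in> carrier ?NC" "z \<in> carrier C"
    then show "?asc t z \<in> carrier ?U" using lin_mapsD(1)[OF lz, of z t] by simp
  next
    fix t t' z assume "t \<in> carrier ?NC" "t' \<in> carrier ?NC" "z \<in> carrier C"
    then show "?asc (t \<oplus>\<^bsub>?NC\<^esub> t') z = ?asc t z \<oplus>\<^bsub>?U\<^esub> ?asc t' z"
      using lin_mapsD(2)[OF lz, of z t t'] by simp
  next
    fix r t z assume "r \<in> carrier R" "t \<in> carrier ?NC" "z \<in> carrier C"
    then show "?asc (r \<odot>\<^bsub>?NC\<^esub> t) z = r \<odot>\<^bsub>?U\<^esub> ?asc t z"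
      using lin_mapsD(3)[OF lz, of z r t] by simp
  next
    fix t z z' assume *: "t \<in> carrier ?NC" "z \<in> carrier C" "z' \<in> carrier C"
    have zz: "z \<oplus>\<^bsub>C\<^esub> z' \<in> carrier C" using * by simp
    have "(\<lambda>t\<in>carrier ?NC. ?asc t (z \<oplus>\<^bsub>C\<^esub> z')) t
       = (\<lambda>t\<in>carrier ?NC. (\<lambda>t\<in>carrier ?NC. ?asc t z) t  \<oplus>\<^bsub>?U\<^esub> (\<lambda>t\<in>carrier ?NC. ?asc t z') t) t"
      by (rule tensor_lin_unique[OF N C U lz[OF zz] lin_maps_add[OF NC U lz[OF *(2)] lz[OF *(3)]] _ *(1)])
        (use * zz in \<open>simp add: tens_closed[OF cring_axioms] asc_tens bU bCC\<close>)
    then show "?asc t (z \<oplus>\<^bsub>C\<^esub> z') = ?asc t z \<oplus>\<^bsub>?U\<^esub> ?asc t z'" using * by simp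
  next
    fix r t z assume *: "r \<in> carrier R" "t \<in> carrier ?NC" "z \<in> carrier C"
    have rz: "r \<odot>\<^bsub>C\<^esub> z \<in> carrier C" using * by simp
    have "(\<lambda>t\<in>carrier ?NC. ?asc t (r \<odot>\<^bsub>C\<^esub> z)) t
       = (\<lambda>t\<in>carrier ?NC. r \<odot>\<^bsub>?U\<^esub> (\<lambda>t\<in>carrier ?NC. ?asc t z) t) t"
      by (rule tensor_lin_unique[OF N C U lz[OF rz] lin_maps_smult[OF NC U lz[OF *(3)] *(1)] _ *(2)])
        (use * rz in \<open>simp add: tens_closed[OF cring_axioms] asc_tens bU bCC\<close>)
    then show "?asc t (r \<odot>\<^bsub>C\<^esub> z) = r \<odot>\<^bsub>?U\<^esub> ?asc t z" using * by simp
  qed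
  note lasc = tensor_lift_lin[OF NC C U basc, folded tensor_assoc_def]
  note actg = comodule_act_lin[OF g]
  have rho: "\<rho> x \<in> carrier ?NC" if "x \<in> carrier N" for x using that by (rule lin_mapsD(1)[OF coact_lin])
  have 1: "comodule_act R C N \<rho> (convolution R C \<Delta> g h) n
      = th (tensor_map R N C N ?CC (\<lambda>x. x) \<Delta> (\<rho> n))"
  proof -
    let ?k = "\<lambda>t\<in>carrier ?NC. tensor_lift R N C N (\<lambda>x c. convolution R C \<Delta> g h c \<odot>\<^bsub>N\<^esub> x) t"
    let ?m = "\<lambda>t\<in>carrier ?NC. tensor_map R N C N ?CC (\<lambda>x. x) \<Delta> t"
    have "?k (\<rho> n) = (\<lambda>t\<in>carrier ?NC. th (?m t)) (\<rho> n)"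
    proof (rule tensor_lin_unique[OF N C N tensor_lift_lin[OF N C N bcv] lin_maps_compose[OF NC l1 th] _ rho[OF n]])
      fix x c assume "x \<in> carrier N" "c \<in> carrier C"
      then show "?k (tens R N C x c) = (\<lambda>t\<in>carrier ?NC. th (?m t)) (tens R N C x c)"
        using lin_mapsD(1)[OF comult_lin, of c]
        by (simp add: tens_closed[OF cring_axioms] tensor_lift_tens[OF N C N bcv] conv th_tens
            tensor_map_def tensor_lift_tens[OF N C U b1])
    qed
    then show ?thesis using rho[OF n] by (simp add: comodule_act_def)
  qed
  have 2: "th (?asc t c) = h c \<odot>\<^bsub>N\<^esub> tensor_lift R N C N (\<lambda>x c. g c \<odot>\<^bsub>N\<^esub> x) t"
    if t: "t \<in> carrier ?NC" and c: "c \<in> carrier C" for t c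
  proof -
    note bg = act_bilinear[OF N C g]
    note lg = tensor_lift_lin[OF N C N bg]
    let ?lg = "\<lambda>t\<in>carrier ?NC. tensor_lift R N C N (\<lambda>x c. g c \<odot>\<^bsub>N\<^esub> x) t"
    have hs: "(\<lambda>x\<in>carrier N. h c \<odot>\<^bsub>N\<^esub> x) \<in> lin_maps R N N"
      using hD(1)[OF c] by (simp add: lin_maps_def N.smult_r_distr N.smult_assoc1[symmetric] m_comm)
    have "(\<lambda>t\<in>carrier ?NC. th ((\<lambda>t\<in>carrier ?NC. ?asc t c) t)) t
        = (\<lambda>t\<in>carrier ?NC. (\<lambda>x\<in>carrier N. h c \<odot>\<^bsub>N\<^esub> x) (?lg t)) t"
    proof (rule tensor_lin_unique[OF N C N lin_maps_compose[OF NC lz[OF c] th] lin_maps_compose[OF NC lg hs] _ t])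
      fix x y assume "x \<in> carrier N" "y \<in> carrier C"
      then show "(\<lambda>t\<in>carrier ?NC. th ((\<lambda>t\<in>carrier ?NC. ?asc t c) t)) (tens R N C x y)
        = (\<lambda>t\<in>carrier ?NC. (\<lambda>x\<in>carrier N. h c \<odot>\<^bsub>N\<^esub> x) (?lg t)) (tens R N C x y)"
        using c gD(1) hD(1)
        by (simp add: tens_closed[OF cring_axioms] asc_tens th_tens gh_tens
            tensor_lift_tens[OF N C N bg] N.smult_assoc1[symmetric] m_comm)
    qed
    then show ?thesis using t lin_mapsD(1)[OF lg t] by simp
  qed
  have 3: "th (tensor_assoc R N C C (tensor_map R N C ?NC C \<rho> (\<lambda>x. x) (\<rho> n)))
      = comodule_act R C N \<rho> g (comodule_act R C N \<rho> h n)"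
  proof -
    note bh = act_bilinear[OF N C h]
    note lh = tensor_lift_lin[OF N C N bh]
    let ?m = "\<lambda>t\<in>carrier ?NC. tensor_map R N C ?NC C \<rho> (\<lambda>x. x) t"
    let ?a = "\<lambda>t\<in>carrier (tensor R ?NC C). tensor_assoc R N C C t"
    let ?h = "\<lambda>t\<in>carrier ?NC. tensor_lift R N C N (\<lambda>x c. h c \<odot>\<^bsub>N\<^esub> x) t"
    let ?g = "\<lambda>n\<in>carrier N. comodule_act R C N \<rho> g n"
    have m: "?m t \<in> carrier (tensor R ?NC C)" if "t \<in> carrier ?NC" for t
      by (rule lin_mapsD(1)[OF l2 that])
    have "(\<lambda>t\<in>carrier ?NC. th ((\<lambda>t\<in>carrier ?NC. ?a (?m t)) t)) (\<rho> n)
        = (\<lambda>t\<in>carrier ?NC. ?g (?h t)) (\<rho> n)"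
    proof (rule tensor_lin_unique[OF N C N lin_maps_compose[OF NC lin_maps_compose[OF NC l2 lasc] th]
          lin_maps_compose[OF NC lh actg] _ rho[OF n]])
      fix x c assume xc: "x \<in> carrier N" "c \<in> carrier C"
      have "?m (tens R N C x c) = tens R ?NC C (\<rho> x) c"
        using xc by (simp add: tens_closed[OF cring_axioms] tensor_map_def tensor_lift_tens[OF N C NCC b2])
      then have "?a (?m (tens R N C x c)) = ?asc (\<rho> x) c"
        using rho[OF xc(1)] xc
        by (simp only: restrict_apply' tens_closed[OF cring_axioms])
          (simp add: tensor_assoc_def tensor_lift_tens[OF NC C U basc])
      then have "(\<lambda>t\<in>carrier ?NC. th ((\<lambda>t\<in>carrier ?NC. ?a (?m t)) t)) (tens R N C x c)
          = h c \<odot>\<^bsub>N\<^esub> comodule_act R C N \<rho> g x"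
        using 2[OF rho[OF xc(1)] xc(2)]
        by (simp only: restrict_apply' tens_closed[OF cring_axioms] comodule_act_def)
      moreover have "(\<lambda>t\<in>carrier ?NC. ?g (?h t)) (tens R N C x c) = h c \<odot>\<^bsub>N\<^esub> comodule_act R C N \<rho> g x"
        using xc hD(1) lin_mapsD(3)[OF actg, of "h c" x]
        by (simp add: tens_closed[OF cring_axioms] tensor_lift_tens[OF N C N bh])
      ultimately show "(\<lambda>t\<in>carrier ?NC. th ((\<lambda>t\<in>carrier ?NC. ?a (?m t)) t)) (tens R N C x c)
          = (\<lambda>t\<in>carrier ?NC. ?g (?h t)) (tens R N C x c)" by simp
    qed
    then show ?thesis
      using rho[OF n] m[OF rho[OF n]] lin_mapsD(1)[OF lh rho[OF n]]
      by (simp add: comodule_act_def)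
  qed
  show ?thesis using 1 3 coact_coassoc[OF n] by simp
qed

end

text \<open>The following two lemmas make \<open>N\<^sup>*\<close> a right module over the convolution algebra.\<close>

lemma (in right_comodule) comodule_dual_act_closed:
  assumes "f \<in> carrier (dual_module R N)" "g \<in> carrier (dual_module R C)"
  shows "comodule_dual_act R C N \<rho> f g \<in> carrier (dual_module R N)"
proof -
  note l = comodule_act_lin[OF assms(2)]
  have "comodule_dual_act R C N \<rho> f g
      = (\<lambda>n\<in>carrier N. f ((\<lambda>n\<in>carrier N. comodule_act R C N \<rho> g n) n))"
    by (auto simp: comodule_dual_act_def dual_right_act_def)
  then show ?thesis
    using lin_maps_compose[OF N.module_axioms l assms(1)[unfolded dual_carrier]]
    by (simp add: dual_carrier)
qed

lemma (in right_comodule) comodule_dual_act_convolution: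
  assumes "f \<in> carrier (dual_module R N)" "g \<in> carrier (dual_module R C)" "h \<in> carrier (dual_module R C)"
  shows "comodule_dual_act R C N \<rho> f \<epsilon> = f"
    and "comodule_dual_act R C N \<rho> f (convolution R C \<Delta> g h)
       = comodule_dual_act R C N \<rho> (comodule_dual_act R C N \<rho> f g) h"
proof -
  have "f \<in> extensional (carrier N)" using assms(1) lin_mapsD(4) by (auto simp: dual_carrier)
  then show "comodule_dual_act R C N \<rho> f \<epsilon> = f"
    by (auto simp: comodule_dual_act_def dual_right_act_def comodule_act_counit fun_eq_iff extensional_def)
  have "comodule_act R C N \<rho> h n \<in> carrier N" if "n \<in> carrier N" for n
    using lin_mapsD(1)[OF comodule_act_lin[OF assms(3)] that] that by simp
  then show "comodule_dual_act R C N \<rho> f (convolution R C \<Delta> g h)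
       = comodule_dual_act R C N \<rho> (comodule_dual_act R C N \<rho> f g) h"
    by (auto simp: comodule_dual_act_def dual_right_act_def comodule_act_convolution[OF assms(2,3)])
qed

lemma embeds_in_powerI:
  assumes "module R M" and phi: "\<phi> \<in> lin_maps R M (power_module R J)" and inj: "inj_on \<phi> (carrier M)"
  shows "embeds_in_power R M"
proof -
  interpret M: module R M by fact
  define k where "k i = (\<lambda>x\<in>carrier M. \<phi> x i)" for i
  define I where "I = k ` J"
  define \<psi> where "\<psi> = (\<lambda>x\<in>carrier M. \<lambda>f\<in>I. f x)"
  note D = lin_mapsD(1-3)[OF phi]
  have c: "\<phi> x i \<in> carrier R" if "x \<in> carrier M" "i \<in> J" for x i
    using D(1)[OF that(1)] that(2) by (auto simp: power_module_def)
  have "\<psi> \<in> lin_maps R M (power_module R I)"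
    using c by (auto simp: lin_maps_def \<psi>_def power_module_def I_def k_def D intro!: restrict_ext)
  moreover have "inj_on \<psi> (carrier M)"
  proof (rule inj_onI)
    fix x y assume x: "x \<in> carrier M" and y: "y \<in> carrier M" and eq: "\<psi> x = \<psi> y"
    have "\<phi> x i = \<phi> y i" if "i \<in> J" for i
      using fun_cong[OF eq, of "k i"] x y that by (simp add: \<psi>_def I_def k_def)
    then have "\<phi> x = \<phi> y"
      using D(1)[OF x] D(1)[OF y] by (intro PiE_ext[of _ J "\<lambda>_. carrier R"]) (auto simp: power_module_def)
    then show "x = y" using inj x y by (simp add: inj_on_def)
  qed
  ultimately show ?thesis unfolding embeds_in_power_def by blast
qed

lemma openin_linear_topology:
  assumes M: "module R M" and sub: "\<And>H. H \<in> \<B> \<Longrightarrow> submodule H R M"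
    and ne: "\<B> \<noteq> {}" and Int: "\<And>H K. H \<in> \<B> \<Longrightarrow> K \<in> \<B> \<Longrightarrow> \<exists>L\<in>\<B>. L \<subseteq> H \<inter> K"
  shows "openin (linear_topology M \<B>) U \<longleftrightarrow>
     U \<subseteq> carrier M \<and> (\<forall>x\<in>U. \<exists>H\<in>\<B>. H +>\<^bsub>M\<^esub> x \<subseteq> U)"
proof
  interpret M: module R M by fact
  have as: "abelian_subgroup H M" if "H \<in> \<B>" for H
    by (rule submodule_abelian_subgroup[OF M sub[OF that]])
  let ?S = "{H +>\<^bsub>M\<^esub> x | H x. H \<in> \<B> \<and> x \<in> carrier M}"
  have mono: "L +>\<^bsub>M\<^esub> x \<subseteq> H +>\<^bsub>M\<^esub> x" if "L \<subseteq> H" for L H x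
    using that by (auto simp: a_r_coset_def')
  assume "openin (linear_topology M \<B>) U"
  then have "generate_topology_on ?S U"
    unfolding linear_topology_def openin_topology_generated_by_iff .
  then show "U \<subseteq> carrier M \<and> (\<forall>x\<in>U. \<exists>H\<in>\<B>. H +>\<^bsub>M\<^esub> x \<subseteq> U)"
  proof (induction rule: generate_topology_on.induct)
    case (Int U V)
    have "\<exists>L\<in>\<B>. L +>\<^bsub>M\<^esub> x \<subseteq> U \<inter> V" if "x \<in> U \<inter> V" for x
    proof -
      from that Int.IH obtain H K where "H \<in> \<B>" "H +>\<^bsub>M\<^esub> x \<subseteq> U" "K \<in> \<B>" "K +>\<^bsub>M\<^esub> x \<subseteq> V" by blast
      moreover from this assms(4) obtain L where "L \<in> \<B>" "L \<subseteq> H \<inter> K" by blast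
      ultimately show ?thesis using mono[of L H x] mono[of L K x] by (intro bexI[of _ L]) auto
    qed
    with Int.IH show ?case by blast
  next
    case (UN K)
    then show ?case by (meson Union_iff Sup_le_iff subset_trans Union_upper)
  next
    case (Basis U)
    then obtain H x where H: "U = H +>\<^bsub>M\<^esub> x" "H \<in> \<B>" "x \<in> carrier M" by blast
    then show ?case
      using abelian_subgroup.a_repr_independence'[OF as[OF H(2)] _ H(3)]
        abelian_subgroup.a_elemrcos_carrier[OF as[OF H(2)] H(3)] by blast
  qed auto
next
  interpret M: module R M by fact
  assume U: "U \<subseteq> carrier M \<and> (\<forall>x\<in>U. \<exists>H\<in>\<B>. H +>\<^bsub>M\<^esub> x \<subseteq> U)"
  show "openin (linear_topology M \<B>) U"
  proof (subst openin_subopen, intro ballI)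
    fix x assume x: "x \<in> U"
    with U obtain H where H: "H \<in> \<B>" "H +>\<^bsub>M\<^esub> x \<subseteq> U" "x \<in> carrier M" by blast
    then have "openin (linear_topology M \<B>) (H +>\<^bsub>M\<^esub> x)"
      unfolding linear_topology_def by (intro topology_generated_by_Basis) blast
    moreover have "x \<in> H +>\<^bsub>M\<^esub> x"
      by (rule abelian_subgroup.a_rcos_self[OF submodule_abelian_subgroup[OF M sub[OF H(1)]] H(3)])
    ultimately show "\<exists>T. openin (linear_topology M \<B>) T \<and> x \<in> T \<and> T \<subseteq> U" using H(2) by blast
  qed
qed

end

theory Submission
  imports Defs
begin

text \<open>
  Write \<open>N\<^sup>*\<close> for the dual with its right \<open>C\<^sup>*\<close>-action, and \<open>S\<^sup>\<bottom>\<close> for the functionals on \<open>N\<close> that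
  vanish on \<open>S\<close>.  The sets \<open>S\<^sup>\<bottom>\<close> with \<open>S\<close> finite are a neighbourhood basis of zero for the finite
  topology.  Hence \<open>N\<close> is coreflexive iff these sets and the cofinite \<open>C\<^sup>*\<close>-submodules of \<open>N\<^sup>*\<close> are
  cofinal in each other (\<open>coreflexive_iff\<close>).

  The inclusion \<open>N\<^sup>*\<^sup>\<box> \<subseteq> N\<^sup>*\<^sup>\<circ>\<close> is a matter of finiteness.  If
  \<open>g f = \<Sum> g(c\<^sub>i) f\<^sub>i\<close> for all \<open>g\<close>, then \<open>{h. f(h g) = 0 for all g}\<close> is a \<open>C\<^sup>*\<close>-submodule inside the kernel
  of \<open>f\<close>, and it is cofinite because it contains the common kernel of the finitely many \<open>f\<^sub>i\<close>
  (\<open>circ_dualI_finite_orbit\<close>).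

  For the converse inclusion, coreflexivity makes an \<open>f \<in> N\<^sup>*\<^sup>\<circ>\<close> vanish on some \<open>S\<^sup>\<bottom>\<close> with \<open>S\<close> finite, and
  every such \<open>f\<close> is rational (\<open>box_dualI_finite_support\<close>).  A map \<open>F\<close> from \<open>C\<^sup>*\<close> to a module \<open>X\<close> is called
  representable here if \<open>F(g) = \<Sum> g(c\<^sub>i) x\<^sub>i\<close> for a fixed tensor \<open>\<Sum> x\<^sub>i \<otimes> c\<^sub>i \<in> X \<otimes> C\<close>; that \<open>f\<close> is rational
  says that \<open>g \<mapsto> g f\<close> is representable in \<open>N\<^sup>*\<^sup>*\<close>.  Local projectivity allows one to shrink the module: a map
  that is representable in \<open>Y\<close> and has all its values in the image of \<open>X\<close> is represented by a tensor from
  \<open>X \<otimes> C\<close> (\<open>locally_projective_lift\<close>).  A map into \<open>R\<^sup>S\<close>, \<open>S\<close> finite, is representable as soon as its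
  coordinates are evaluations at elements of \<open>C\<close>.  So one only needs finitely many coordinates on a
  suitable \<open>X\<close> (\<open>representable_coordinatewise\<close>).  This is used twice:
  first with \<open>X = N\<^sup>*\<close> and the coordinates \<open>h \<mapsto> (h x)\<^sub>x\<close>, \<open>x \<in> S\<close>, to see that \<open>g \<mapsto> f(h g)\<close> is evaluation at an
  element of \<open>C\<close> for each \<open>h\<close>; then with \<open>X \<subseteq> N\<^sup>*\<^sup>*\<close> the functionals that vanish on \<open>V\<^sup>\<bottom>\<close>, where \<open>V\<close> is a
  finite set such that \<open>C\<^sup>* S\<close> lies in the span of \<open>V\<close>.  By noetherianity, \<open>N\<^sup>* / V\<^sup>\<bottom> \<subseteq> R\<^sup>V\<close> is
  finitely generated, so an element of \<open>X\<close> is determined by its values at finitely many \<open>h\<close>.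

  Now let \<open>N \<simeq> N\<^sup>*\<^sup>\<circ>\<close> and let \<open>N\<^sup>*\<close> be cofinitely cogenerated.  Each element of \<open>N\<close> vanishes on a cofinite
  submodule, and these are closed under intersection, so every \<open>S\<^sup>\<bottom>\<close> contains one.  Conversely, let \<open>L\<close> be a
  cofinite submodule and \<open>K \<subseteq> N\<close> its orthogonal.  Functionals separate the points of \<open>N\<^sup>* / L\<close>; they belong to
  \<open>N\<^sup>*\<^sup>\<circ> = N\<close>, that is to \<open>K\<close>, whence \<open>K\<^sup>\<bottom> \<subseteq> L\<close>.  Moreover \<open>K\<close> embeds in the dual of the finitely
  generated module \<open>N\<^sup>* / L\<close> and is therefore finitely generated.  This gives coreflexivity; the equivalence for
  weakly coreflexive \<open>N\<close> combines it with the equality \<open>N\<^sup>*\<^sup>\<box> = N\<^sup>*\<^sup>\<circ>\<close> above.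
\<close>

section \<open>Submodules of finitely generated modules over noetherian rings\<close>

context module
begin

lemma submodule_zero: "submodule H R M \<Longrightarrow> \<zero>\<^bsub>M\<^esub> \<in> H"
  by (auto simp: submodule_def dest: subgroup.one_closed)

lemma submodule_diff: "submodule H R M \<Longrightarrow> x \<in> H \<Longrightarrow> y \<in> H \<Longrightarrow> x \<ominus>\<^bsub>M\<^esub> y \<in> H"
  by (simp add: a_minus_def submoduleE)

lemma submodule_Int:
  assumes "submodule H R M" "submodule K R M"
  shows "submodule (H \<inter> K) R M"
  using submoduleE[OF assms(1)] submoduleE[OF assms(2)] submodule_zero[OF assms(1)] submodule_zero[OF assms(2)]
  by (intro submoduleI) auto

lemma submodule_finsum:
  assumes "submodule H R M" "f \<in> A \<rightarrow> H"
  shows "(\<Oplus>\<^bsub>M\<^esub>i\<in>A. f i) \<in> H"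
proof (cases "finite A")
  case True
  then show ?thesis using assms(2)
  proof (induction A)
    case empty then show ?case using submodule_zero[OF assms(1)] by simp
  next
    case (insert a A)
    then have "f \<in> A \<rightarrow> carrier M" "f a \<in> carrier M" using submoduleE(1)[OF assms(1)] by auto
    with insert show ?case using submoduleE(5)[OF assms(1)] by auto
  qed
qed (use submodule_zero[OF assms(1)] in \<open>simp add: M.add.finprod_infinite\<close>)

lemma lin_span_closed: "A \<subseteq> carrier M \<Longrightarrow> lin_span R M A \<subseteq> carrier M"
  by (rule lin_span_minimal[OF carrier_is_submodule])

lemma lin_span_mono: "A \<subseteq> B \<Longrightarrow> lin_span R M A \<subseteq> lin_span R M B"
  by (auto simp: lin_span_def)

lemma lin_span_insertE:
  assumes "x \<in> lin_span R M (insert a A)" "a \<in> carrier M" "A \<subseteq> carrier M"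
  obtains r s where "r \<in> carrier R" "s \<in> lin_span R M A" "x = r \<odot>\<^bsub>M\<^esub> a \<oplus>\<^bsub>M\<^esub> s"
proof -
  note S = lin_span_submodule[OF module_axioms assms(3)]
  note SE = submoduleE[OF S]
  let ?H = "{r \<odot>\<^bsub>M\<^esub> a \<oplus>\<^bsub>M\<^esub> s | r s. r \<in> carrier R \<and> s \<in> lin_span R M A}"
  have c: "s \<in> carrier M" if "s \<in> lin_span R M A" for s using that SE(1) by blast
  have memI: "r \<odot>\<^bsub>M\<^esub> a \<oplus>\<^bsub>M\<^esub> s \<in> ?H" if "r \<in> carrier R" "s \<in> lin_span R M A" for r s
    using that by blast
  have "submodule ?H R M"
  proof (rule submoduleI)
    show "?H \<subseteq> carrier M" using c assms(2) by auto
    show "\<zero>\<^bsub>M\<^esub> \<in> ?H" using memI[OF R.zero_closed submodule_zero[OF S]] assms(2) by simp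
  next
    fix x assume "x \<in> ?H"
    then obtain r s where x: "x = r \<odot>\<^bsub>M\<^esub> a \<oplus>\<^bsub>M\<^esub> s" "r \<in> carrier R" "s \<in> lin_span R M A" by blast
    have "\<ominus>\<^bsub>M\<^esub> x = (\<ominus> r) \<odot>\<^bsub>M\<^esub> a \<oplus>\<^bsub>M\<^esub> (\<ominus>\<^bsub>M\<^esub> s)"
      using x c assms(2) by (simp add: M.minus_add smult_l_minus)
    then show "\<ominus>\<^bsub>M\<^esub> x \<in> ?H" using memI x SE(3) by simp
  next
    fix x y assume "x \<in> ?H" "y \<in> ?H"
    then obtain r s r' s' where x: "x = r \<odot>\<^bsub>M\<^esub> a \<oplus>\<^bsub>M\<^esub> s" "r \<in> carrier R" "s \<in> lin_span R M A"
      and y: "y = r' \<odot>\<^bsub>M\<^esub> a \<oplus>\<^bsub>M\<^esub> s'" "r' \<in> carrier R" "s' \<in> lin_span R M A" by blast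
    have "x \<oplus>\<^bsub>M\<^esub> y = (r \<oplus> r') \<odot>\<^bsub>M\<^esub> a \<oplus>\<^bsub>M\<^esub> (s \<oplus>\<^bsub>M\<^esub> s')"
      using x y c assms(2) by (simp add: smult_l_distr M.a_ac)
    then show "x \<oplus>\<^bsub>M\<^esub> y \<in> ?H" using memI x y SE(5) by simp
  next
    fix t x assume t: "t \<in> carrier R" and "x \<in> ?H"
    then obtain r s where x: "x = r \<odot>\<^bsub>M\<^esub> a \<oplus>\<^bsub>M\<^esub> s" "r \<in> carrier R" "s \<in> lin_span R M A" by blast
    have "t \<odot>\<^bsub>M\<^esub> x = (t \<otimes> r) \<odot>\<^bsub>M\<^esub> a \<oplus>\<^bsub>M\<^esub> (t \<odot>\<^bsub>M\<^esub> s)"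
      using x t c assms(2) by (simp add: smult_r_distr smult_assoc1)
    then show "t \<odot>\<^bsub>M\<^esub> x \<in> ?H" using memI x t SE(4) by simp
  qed
  moreover have "insert a A \<subseteq> ?H"
  proof (intro insert_subsetI subsetI)
    show "a \<in> ?H" using memI[OF R.one_closed submodule_zero[OF S]] assms(2) by simp
    fix b assume "b \<in> A"
    then show "b \<in> ?H"
      using memI[OF R.zero_closed, of b] lin_span_superset[of A R M] assms(2,3) by (auto simp: subset_iff)
  qed
  ultimately have "x \<in> ?H" using lin_span_minimal assms(1) by blast
  then show ?thesis using that by blast
qed

text \<open>If \<open>S\<close> is the span of some elements, this is the ideal of coefficients at a further generator \<open>a\<close> of the
  elements of \<open>H\<close>, like the leading coefficients in Hilbert's basis theorem.\<close>

lemma coefficient_ideal: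
  assumes H: "submodule H R M" and S: "submodule S R M" and a: "a \<in> carrier M"
  shows "ideal {r \<in> carrier R. \<exists>s\<in>S. r \<odot>\<^bsub>M\<^esub> a \<oplus>\<^bsub>M\<^esub> s \<in> H} R"
proof -
  note HE = submoduleE[OF H] and SE = submoduleE[OF S]
  let ?I = "{r \<in> carrier R. \<exists>s\<in>S. r \<odot>\<^bsub>M\<^esub> a \<oplus>\<^bsub>M\<^esub> s \<in> H}"
  have c: "s \<in> carrier M" if "s \<in> S" for s using that SE(1) by blast
  have sm: "t \<otimes> r \<in> ?I" if t: "t \<in> carrier R" and "r \<in> ?I" for t r
  proof -
    from that obtain s where r: "r \<in> carrier R" "s \<in> S" "r \<odot>\<^bsub>M\<^esub> a \<oplus>\<^bsub>M\<^esub> s \<in> H" by blast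
    have "(t \<otimes> r) \<odot>\<^bsub>M\<^esub> a \<oplus>\<^bsub>M\<^esub> (t \<odot>\<^bsub>M\<^esub> s) = t \<odot>\<^bsub>M\<^esub> (r \<odot>\<^bsub>M\<^esub> a \<oplus>\<^bsub>M\<^esub> s)"
      using r t c a by (simp add: smult_r_distr smult_assoc1)
    then have "(t \<otimes> r) \<odot>\<^bsub>M\<^esub> a \<oplus>\<^bsub>M\<^esub> (t \<odot>\<^bsub>M\<^esub> s) \<in> H" using HE(4)[OF t r(3)] by simp
    then show ?thesis using SE(4)[OF t r(2)] t r(1) by blast
  qed
  have neg: "\<ominus> r \<in> ?I" if "r \<in> ?I" for r
    using sm[of "\<ominus> \<one>" r] that by (simp add: l_minus)
  have add: "r \<oplus> r' \<in> ?I" if "r \<in> ?I" "r' \<in> ?I" for r r'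
  proof -
    from that obtain s s' where r: "r \<in> carrier R" "s \<in> S" "r \<odot>\<^bsub>M\<^esub> a \<oplus>\<^bsub>M\<^esub> s \<in> H"
      and r': "r' \<in> carrier R" "s' \<in> S" "r' \<odot>\<^bsub>M\<^esub> a \<oplus>\<^bsub>M\<^esub> s' \<in> H" by blast
    have "(r \<oplus> r') \<odot>\<^bsub>M\<^esub> a \<oplus>\<^bsub>M\<^esub> (s \<oplus>\<^bsub>M\<^esub> s') = (r \<odot>\<^bsub>M\<^esub> a \<oplus>\<^bsub>M\<^esub> s) \<oplus>\<^bsub>M\<^esub> (r' \<odot>\<^bsub>M\<^esub> a \<oplus>\<^bsub>M\<^esub> s')"
      using r r' c a by (simp add: smult_l_distr M.a_ac)
    then have "(r \<oplus> r') \<odot>\<^bsub>M\<^esub> a \<oplus>\<^bsub>M\<^esub> (s \<oplus>\<^bsub>M\<^esub> s') \<in> H" using HE(5)[OF r(3) r'(3)] by simp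
    then show ?thesis using SE(5)[OF r(2) r'(2)] r(1) r'(1) by blast
  qed
  have "\<zero> \<in> ?I" using a submodule_zero[OF S] submodule_zero[OF H] by (auto intro!: bexI[of _ "\<zero>\<^bsub>M\<^esub>"])
  then have "subgroup ?I (add_monoid R)"
    using add neg by (intro R.add.subgroupI) (blast, blast, simp add: a_inv_def, simp)
  moreover have "r \<otimes> t \<in> ?I" if "t \<in> carrier R" "r \<in> ?I" for r t
  proof -
    have "r \<otimes> t = t \<otimes> r" using that by (auto intro: m_comm)
    then show ?thesis using sm[OF that] by simp
  qed
  ultimately show ?thesis using sm by (intro idealI R.ring_axioms) blast+
qed

text \<open>Induction on the generators.  The ideal of coefficients at the new generator \<open>a\<close> is finitely generated; lift
  its generators to elements of \<open>H\<close>.  Any element of \<open>H\<close> differs from a combination of these lifts by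
  an element of \<open>H\<close> in the span of the old generators, where the induction hypothesis applies.\<close>

theorem submodule_of_noetherian:
  assumes noeth: "noetherian_ring R" and "finite A" "A \<subseteq> carrier M"
    and "submodule H R M" "H \<subseteq> lin_span R M A"
  shows "\<exists>B. finite B \<and> B \<subseteq> H \<and> H = lin_span R M B"
  using assms(2-5)
proof (induction A arbitrary: H)
  case empty
  have "lin_span R M {} \<subseteq> {\<zero>\<^bsub>M\<^esub>}" by (rule lin_span_minimal) (auto intro!: submoduleI)
  with empty have "H = {\<zero>\<^bsub>M\<^esub>}" using submodule_zero[OF empty(2)] by blast
  then show ?case using lin_span_minimal[OF empty(2), of "{\<zero>\<^bsub>M\<^esub>}"] lin_span_superset[of "{\<zero>\<^bsub>M\<^esub>}" R M]
    by (intro exI[of _ "{\<zero>\<^bsub>M\<^esub>}"]) auto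
next
  case (insert a A)
  note HE = submoduleE[OF insert.prems(2)]
  let ?S = "lin_span R M A"
  have aA: "a \<in> carrier M" "A \<subseteq> carrier M" using insert.prems(1) by auto
  note S = lin_span_submodule[OF module_axioms aA(2)]
  define I where "I = {r \<in> carrier R. \<exists>s\<in>?S. r \<odot>\<^bsub>M\<^esub> a \<oplus>\<^bsub>M\<^esub> s \<in> H}"
  have "ideal I R" unfolding I_def by (rule coefficient_ideal[OF insert.prems(2) S aA(1)])
  then obtain G where G: "G \<subseteq> carrier R" "finite G" "I = Idl G"
    using noetherian_ring.finetely_gen[OF noeth] by blast
  have "\<forall>r\<in>G. \<exists>h\<in>H. \<exists>s\<in>?S. h = r \<odot>\<^bsub>M\<^esub> a \<oplus>\<^bsub>M\<^esub> s"
    using genideal_self[OF G(1)] unfolding G(3)[symmetric] I_def by blast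
  then obtain h where h: "\<And>r. r \<in> G \<Longrightarrow> h r \<in> H" "\<And>r. r \<in> G \<Longrightarrow> \<exists>s\<in>?S. h r = r \<odot>\<^bsub>M\<^esub> a \<oplus>\<^bsub>M\<^esub> s"
    by metis
  obtain B where B: "finite B" "B \<subseteq> H \<inter> ?S" "H \<inter> ?S = lin_span R M B"
    using insert.IH[OF aA(2) submodule_Int[OF insert.prems(2) S]] by auto
  define D where "D = B \<union> h ` G"
  have D: "finite D" "D \<subseteq> H" "D \<subseteq> carrier M" using B G(2) h(1) HE(1) by (auto simp: D_def)
  note sD = lin_span_submodule[OF module_axioms D(3)]
  note sDE = submoduleE[OF sD]
  let ?J = "{r \<in> carrier R. \<exists>s\<in>?S. r \<odot>\<^bsub>M\<^esub> a \<oplus>\<^bsub>M\<^esub> s \<in> lin_span R M D}"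
  have "G \<subseteq> ?J"
  proof
    fix r assume r: "r \<in> G"
    have "h r \<in> lin_span R M D" using r lin_span_superset[of D R M] by (auto simp: D_def)
    then show "r \<in> ?J" using h(2)[OF r] r G(1) by auto
  qed
  \<comment> \<open>Every coefficient at \<open>a\<close> that occurs in \<open>H\<close> already occurs in the span of \<open>D\<close>.\<close>
  then have IJ: "I \<subseteq> ?J"
    unfolding G(3) by (rule genideal_minimal[OF coefficient_ideal[OF sD S aA(1)]])
  have DH: "lin_span R M D \<subseteq> H" by (rule lin_span_minimal[OF insert.prems(2) D(2)])
  have "H \<subseteq> lin_span R M D"
  proof
    fix x assume x: "x \<in> H"
    then obtain r s where rs: "r \<in> carrier R" "s \<in> ?S" "x = r \<odot>\<^bsub>M\<^esub> a \<oplus>\<^bsub>M\<^esub> s"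
      using insert.prems(3) by (blast elim: lin_span_insertE[OF _ aA])
    then have "r \<in> I" using x by (auto simp: I_def)
    then obtain s' where s': "s' \<in> ?S" "r \<odot>\<^bsub>M\<^esub> a \<oplus>\<^bsub>M\<^esub> s' \<in> lin_span R M D" using IJ by blast
    have sc: "s \<in> carrier M" "s' \<in> carrier M" using rs(2) s'(1) submoduleE(1)[OF S] by auto
    have "x \<ominus>\<^bsub>M\<^esub> (r \<odot>\<^bsub>M\<^esub> a \<oplus>\<^bsub>M\<^esub> s') = (r \<odot>\<^bsub>M\<^esub> a \<ominus>\<^bsub>M\<^esub> r \<odot>\<^bsub>M\<^esub> a) \<oplus>\<^bsub>M\<^esub> (s \<ominus>\<^bsub>M\<^esub> s')"
      using rs(1,3) sc aA(1) unfolding a_minus_def by (simp add: M.minus_add M.a_ac)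
    then have e: "x \<ominus>\<^bsub>M\<^esub> (r \<odot>\<^bsub>M\<^esub> a \<oplus>\<^bsub>M\<^esub> s') = s \<ominus>\<^bsub>M\<^esub> s'"
      using rs(1) sc aA(1) by (simp add: a_minus_def M.r_neg)
    have "x \<ominus>\<^bsub>M\<^esub> (r \<odot>\<^bsub>M\<^esub> a \<oplus>\<^bsub>M\<^esub> s') \<in> H"
      using submodule_diff[OF insert.prems(2) x] s'(2) DH by blast
    then have "x \<ominus>\<^bsub>M\<^esub> (r \<odot>\<^bsub>M\<^esub> a \<oplus>\<^bsub>M\<^esub> s') \<in> H \<inter> ?S"
      using e submodule_diff[OF S rs(2) s'(1)] by simp
    then have "x \<ominus>\<^bsub>M\<^esub> (r \<odot>\<^bsub>M\<^esub> a \<oplus>\<^bsub>M\<^esub> s') \<in> lin_span R M D"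
      using B(3) lin_span_mono[of B D] by (auto simp: D_def)
    then have "(x \<ominus>\<^bsub>M\<^esub> (r \<odot>\<^bsub>M\<^esub> a \<oplus>\<^bsub>M\<^esub> s')) \<oplus>\<^bsub>M\<^esub> (r \<odot>\<^bsub>M\<^esub> a \<oplus>\<^bsub>M\<^esub> s') \<in> lin_span R M D"
      using s'(2) sDE(5) by blast
    moreover have "x \<in> carrier M" "r \<odot>\<^bsub>M\<^esub> a \<oplus>\<^bsub>M\<^esub> s' \<in> carrier M" using x HE(1) rs(1) sc aA(1) by auto
    ultimately show "x \<in> lin_span R M D" by (simp add: a_minus_def M.a_assoc M.l_neg)
  qed
  then show ?case using DH D by blast
qed

end

lemma lin_maps_span_eqI:
  assumes "module R M" "module R P" "f \<in> lin_maps R M P" "g \<in> lin_maps R M P"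
    and "A \<subseteq> carrier M" "\<And>x. x \<in> A \<Longrightarrow> f x = g x" "x \<in> lin_span R M A"
  shows "f x = g x"
proof -
  interpret M: module R M by fact
  interpret P: module R P by fact
  have "submodule {x \<in> carrier M. f x = g x} R M"
    by (intro M.submoduleI)
      (auto simp: lin_maps_zero[OF assms(1,2)] lin_maps_a_inv[OF assms(1,2)] assms(3,4)
        lin_mapsD[OF assms(3)] lin_mapsD[OF assms(4)])
  then have "lin_span R M A \<subseteq> {x \<in> carrier M. f x = g x}"
    using assms(5,6) by (intro lin_span_minimal) auto
  then show ?thesis using assms(7) by blast
qed

lemma lin_maps_image_submodule:
  assumes "module R M" "module R P" "f \<in> lin_maps R M P" "submodule H R M"
  shows "submodule (f ` H) R P"
proof -
  interpret M: module R M by fact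
  interpret P: module R P by fact
  note HE = M.submoduleE[OF assms(4)] and D = lin_mapsD[OF assms(3)]
  have c: "x \<in> carrier M" if "x \<in> H" for x using that HE(1) by blast
  show ?thesis
  proof (rule P.submoduleI)
    show "f ` H \<subseteq> carrier P" using D(1) c by blast
    show "\<zero>\<^bsub>P\<^esub> \<in> f ` H"
      using lin_maps_zero[OF assms(1-3)] M.submodule_zero[OF assms(4)] by (metis image_eqI)
  qed (auto simp: c lin_maps_a_inv[OF assms(1-3), symmetric] D(2,3)[symmetric] intro!: imageI HE(3-5))
qed

text \<open>This is how the ring being noetherian is used below: modulo the kernel of a map into a finitely generated
  module, every submodule \<open>H\<close> is finitely generated, since \<open>f ` H\<close> is.  The generators are chosen in \<open>H\<close> itself,
  so that no quotient module has to be formed.\<close>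

lemma noetherian_representatives:
  assumes "module R M" "module R P" "noetherian_ring R" "fin_gen R P"
    and f: "f \<in> lin_maps R M P" and H: "submodule H R M"
  obtains B where "finite B" "B \<subseteq> H" "\<And>h. h \<in> H \<Longrightarrow> \<exists>b\<in>lin_span R M B. f h = f b"
proof -
  interpret M: module R M by fact
  interpret P: module R P by fact
  obtain A where A: "finite A" "A \<subseteq> carrier P" "carrier P = lin_span R P A"
    using assms(4) by (auto simp: fin_gen_def)
  have fH: "submodule (f ` H) R P" by (rule lin_maps_image_submodule[OF assms(1,2) f H])
  then have "f ` H \<subseteq> lin_span R P A" using P.submoduleE(1) A(3) by blast
  then obtain D where D: "finite D" "D \<subseteq> f ` H" "f ` H = lin_span R P D"
    using P.submodule_of_noetherian[OF assms(3) A(1,2) fH] by blast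
  then obtain B where B: "finite B" "B \<subseteq> H" "D = f ` B"
    using finite_subset_image[OF D(1,2)] by blast
  have Bc: "B \<subseteq> carrier M" using B(2) M.submoduleE(1)[OF H] by blast
  have "D \<subseteq> f ` lin_span R M B" using B(3) lin_span_superset[of B R M] by blast
  then have "f ` H \<subseteq> f ` lin_span R M B"
    unfolding D(3)
    by (rule lin_span_minimal[OF lin_maps_image_submodule[OF assms(1,2) f lin_span_submodule[OF assms(1) Bc]]])
  then show ?thesis using that[OF B(1,2)] by blast
qed

lemma fin_gen_image:
  assumes "module R M" "module R P" "f \<in> lin_maps R M P"
    and A: "finite A" "A \<subseteq> carrier M" and onto: "f ` lin_span R M A = carrier P"
  shows "fin_gen R P"
proof -
  interpret M: module R M by fact
  interpret P: module R P by fact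
  have fA: "f ` A \<subseteq> carrier P" using A(2) lin_mapsD(1)[OF assms(3)] by auto
  have S: "submodule (lin_span R P (f ` A)) R P" by (rule lin_span_submodule[OF assms(2) fA])
  have "submodule {x \<in> carrier M. f x \<in> lin_span R P (f ` A)} R M"
    by (intro M.submoduleI)
      (auto simp: lin_maps_zero[OF assms(1-3)] lin_maps_a_inv[OF assms(1-3)] lin_mapsD[OF assms(3)]
        P.submodule_zero[OF S] P.submoduleE[OF S])
  moreover have "A \<subseteq> {x \<in> carrier M. f x \<in> lin_span R P (f ` A)}"
    using A(2) lin_span_superset[of "f ` A" R P] by auto
  ultimately have "lin_span R M A \<subseteq> {x \<in> carrier M. f x \<in> lin_span R P (f ` A)}"
    by (rule lin_span_minimal)
  then have "carrier P \<subseteq> lin_span R P (f ` A)" unfolding onto[symmetric] by blast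
  then have "carrier P = lin_span R P (f ` A)" using P.lin_span_closed[OF fA] by (rule antisym)
  then show ?thesis using A(1) fA by (auto simp: fin_gen_def)
qed

text \<open>\<open>M / L\<close> is a quotient of \<open>M / ker f\<close>, which is isomorphic to a submodule of \<open>P\<close>.\<close>

lemma fin_gen_quotI:
  assumes "module R M" "module R P" "noetherian_ring R" "fin_gen R P"
    and f: "f \<in> lin_maps R M P" and L: "submodule L R M"
    and ker: "\<And>x. x \<in> carrier M \<Longrightarrow> f x = \<zero>\<^bsub>P\<^esub> \<Longrightarrow> x \<in> L"
  shows "fin_gen R (quot_module R M L)"
proof -
  interpret M: module R M by fact
  interpret P: module R P by fact
  obtain B where B: "finite B" "B \<subseteq> carrier M" "\<And>h. h \<in> carrier M \<Longrightarrow> \<exists>b\<in>lin_span R M B. f h = f b"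
    using noetherian_representatives[OF assms(1-4) f M.carrier_is_submodule] by blast
  have "\<exists>b\<in>lin_span R M B. L +>\<^bsub>M\<^esub> x = L +>\<^bsub>M\<^esub> b" if x: "x \<in> carrier M" for x
  proof -
    obtain b where b: "b \<in> lin_span R M B" "f x = f b" using B(3)[OF x] by blast
    have bc: "b \<in> carrier M" using b(1) M.lin_span_closed[OF B(2)] by blast
    have "f (x \<ominus>\<^bsub>M\<^esub> b) = \<zero>\<^bsub>P\<^esub>"
      using lin_maps_minus[OF assms(1,2) f x bc] b(2) lin_mapsD(1)[OF f bc] by (simp add: a_minus_def P.r_neg)
    then show ?thesis using quot_coset_eqI[OF assms(1) L x bc ker] b(1) x bc by auto
  qed
  then have "(\<lambda>x\<in>carrier M. L +>\<^bsub>M\<^esub> x) ` lin_span R M B = carrier (quot_module R M L)"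
    using M.lin_span_closed[OF B(2)] unfolding quot_carrier by (auto simp: image_iff subset_iff)
  then show ?thesis
    by (rule fin_gen_image[OF assms(1) quot_module_module[OF assms(1) L] quot_proj_lin[OF assms(1) L] B(1,2)])
qed

text \<open>Modulo \<open>H\<close>, \<open>M\<close> is spanned by a finite set \<open>A\<close>; modulo \<open>H \<inter> K\<close>, \<open>H\<close> is spanned by a finite set \<open>B\<close>, because
  \<open>H / (H \<inter> K)\<close> embeds in \<open>M / K\<close>.  Together \<open>A \<union> B\<close> spans \<open>M\<close> modulo \<open>H \<inter> K\<close>.\<close>

lemma fin_gen_quot_Int:
  assumes M: "module R M" and noeth: "noetherian_ring R"
    and H: "submodule H R M" "fin_gen R (quot_module R M H)"
    and K: "submodule K R M" "fin_gen R (quot_module R M K)"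
  shows "fin_gen R (quot_module R M (H \<inter> K))"
proof -
  interpret M: module R M by fact
  let ?qH = "\<lambda>x\<in>carrier M. H +>\<^bsub>M\<^esub> x" and ?qK = "\<lambda>x\<in>carrier M. K +>\<^bsub>M\<^esub> x"
  note QH = quot_module_module[OF M H(1)] and QK = quot_module_module[OF M K(1)]
  note pH = quot_proj_lin[OF M H(1)] and pK = quot_proj_lin[OF M K(1)]
  note HK = M.submodule_Int[OF H(1) K(1)]
  have eq: "x \<ominus>\<^bsub>M\<^esub> y \<in> L" if L: "submodule L R M" and xy: "x \<in> carrier M" "y \<in> carrier M"
      and e: "L +>\<^bsub>M\<^esub> x = L +>\<^bsub>M\<^esub> y" for L x y
  proof -
    interpret L: abelian_subgroup L M by (rule submodule_abelian_subgroup[OF M L])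
    show ?thesis using L.a_rcos_module[of y x] L.a_rcos_self[OF xy(1)] xy e by (simp add: a_minus_def)
  qed
  obtain A where A: "finite A" "A \<subseteq> carrier M"
      "\<And>x. x \<in> carrier M \<Longrightarrow> \<exists>a\<in>lin_span R M A. ?qH x = ?qH a"
    using noetherian_representatives[OF M QH noeth H(2) pH M.carrier_is_submodule] by blast
  obtain B where B: "finite B" "B \<subseteq> H" "\<And>x. x \<in> H \<Longrightarrow> \<exists>b\<in>lin_span R M B. ?qK x = ?qK b"
    using noetherian_representatives[OF M QK noeth K(2) pK H(1)] by blast
  note HE = M.submoduleE[OF H(1)]
  have Hc: "x \<in> carrier M" if "x \<in> H" for x using that HE(1) by blast
  have AB: "finite (A \<union> B)" "A \<union> B \<subseteq> carrier M" using A B Hc by auto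
  have sAB: "submodule (lin_span R M (A \<union> B)) R M" by (rule lin_span_submodule[OF M AB(2)])
  have BH: "lin_span R M B \<subseteq> H" by (rule lin_span_minimal[OF H(1) B(2)])
  have "\<exists>c\<in>lin_span R M (A \<union> B). (H \<inter> K) +>\<^bsub>M\<^esub> x = (H \<inter> K) +>\<^bsub>M\<^esub> c" if x: "x \<in> carrier M" for x
  proof -
    obtain a where a: "a \<in> lin_span R M A" "?qH x = ?qH a" using A(3)[OF x] by blast
    have ac: "a \<in> carrier M" using a(1) M.lin_span_closed[OF A(2)] by blast
    have xa: "x \<ominus>\<^bsub>M\<^esub> a \<in> H" using eq[OF H(1) x ac] a(2) x ac by simp
    then obtain b where b: "b \<in> lin_span R M B" "?qK (x \<ominus>\<^bsub>M\<^esub> a) = ?qK b" using B(3) by blast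
    have bH: "b \<in> H" using BH b(1) by blast
    have xab: "(x \<ominus>\<^bsub>M\<^esub> a) \<ominus>\<^bsub>M\<^esub> b \<in> H \<inter> K"
      using eq[OF K(1) _ _ , of "x \<ominus>\<^bsub>M\<^esub> a" b] b(2) Hc[OF bH] Hc[OF xa] M.submodule_diff[OF H(1) xa bH] by simp
    have "x \<ominus>\<^bsub>M\<^esub> (a \<oplus>\<^bsub>M\<^esub> b) = (x \<ominus>\<^bsub>M\<^esub> a) \<ominus>\<^bsub>M\<^esub> b"
      using x ac Hc[OF bH] by (simp add: a_minus_def M.minus_add M.a_ac)
    then have "(H \<inter> K) +>\<^bsub>M\<^esub> x = (H \<inter> K) +>\<^bsub>M\<^esub> (a \<oplus>\<^bsub>M\<^esub> b)"
      using xab x ac Hc[OF bH] by (intro quot_coset_eqI[OF M HK]) auto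
    moreover have "a \<oplus>\<^bsub>M\<^esub> b \<in> lin_span R M (A \<union> B)"
      using M.submoduleE(5)[OF sAB] a(1) b(1) M.lin_span_mono[of A "A \<union> B"] M.lin_span_mono[of B "A \<union> B"] by blast
    ultimately show ?thesis by blast
  qed
  then have "(\<lambda>x\<in>carrier M. (H \<inter> K) +>\<^bsub>M\<^esub> x) ` lin_span R M (A \<union> B) = carrier (quot_module R M (H \<inter> K))"
    using M.lin_span_closed[OF AB(2)] unfolding quot_carrier by (auto simp: image_iff subset_iff)
  then show ?thesis
    by (rule fin_gen_image[OF M quot_module_module[OF M HK] quot_proj_lin[OF M HK] AB])
qed

text \<open>The unit vectors span: the projection modulo their span vanishes on every unit vector, hence is zero.\<close>

lemma power_module_fin_gen:
  assumes "cring R" "finite S"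
  shows "fin_gen R (power_module R S)"
proof -
  interpret R: cring R by fact
  have e: "power_module R S = free_module R S"
    using assms(2) by (simp add: free_module_def power_module_def supp_def)
  let ?F = "free_module R S" and ?A = "free_gen R S ` S"
  note F = free_module_module[OF assms(1), of S]
  interpret F: module R ?F by (rule F)
  have A: "?A \<subseteq> carrier ?F" by (auto intro: free_gen_closed[OF assms(1)])
  let ?H = "lin_span R ?F ?A"
  note H = lin_span_submodule[OF F A]
  note Q = quot_module_module[OF F H]
  interpret Q: module R "quot_module R ?F ?H" by (rule Q)
  let ?z = "\<lambda>x\<in>carrier ?F. \<zero>\<^bsub>quot_module R ?F ?H\<^esub>"
  have z: "?z \<in> lin_maps R ?F (quot_module R ?F ?H)" by (simp add: lin_maps_def)
  have "u \<in> ?H" if u: "u \<in> carrier ?F" for u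
  proof -
    have "(\<lambda>x\<in>carrier ?F. ?H +>\<^bsub>?F\<^esub> x) u = ?z u"
    proof (rule free_lin_unique[OF Q quot_proj_lin[OF F H] z _ u])
      fix p assume "p \<in> S"
      then have "free_gen R S p \<in> ?H" using lin_span_superset[of ?A R ?F] by blast
      then show "(\<lambda>x\<in>carrier ?F. ?H +>\<^bsub>?F\<^esub> x) (free_gen R S p) = ?z (free_gen R S p)"
        using free_gen_closed[OF assms(1), of S p] quot_coset_eq_zero_iff[OF F H] by (simp add: quot_zero)
    qed
    then show ?thesis using u quot_coset_eq_zero_iff[OF F H u] by (simp add: quot_zero)
  qed
  then have "carrier ?F = ?H" using F.lin_span_closed[OF A] by blast
  then show ?thesis unfolding e fin_gen_def using A assms(2) by blast
qed

lemma fin_gen_submodule_iff: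
  assumes M: "module R M" and K: "submodule K R M"
  shows "fin_gen R (M\<lparr>carrier := K\<rparr>) \<longleftrightarrow> (\<exists>A. finite A \<and> A \<subseteq> K \<and> K = lin_span R M A)"
proof -
  interpret M: module R M by fact
  note KM = submodule.submodule_is_module[OF K M]
  interpret K: module R "M\<lparr>carrier := K\<rparr>" by (rule KM)
  have incl: "(\<lambda>x\<in>K. x) \<in> lin_maps R (M\<lparr>carrier := K\<rparr>) M"
    using M.submoduleE[OF K] by (auto simp: lin_maps_def)
  have "submodule H R M" if "submodule H R (M\<lparr>carrier := K\<rparr>)" for H
  proof -
    have "H \<subseteq> K" using K.submoduleE(1)[OF that] by simp
    then have "(\<lambda>x\<in>K. x) ` H = H" by auto
    then show ?thesis using lin_maps_image_submodule[OF KM M incl that] by simp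
  qed
  moreover have "submodule (H \<inter> K) R (M\<lparr>carrier := K\<rparr>)" if H: "submodule H R M" for H
  proof (rule K.module_incl_imp_submodule)
    have "module R (M\<lparr>carrier := H \<inter> K\<rparr>)"
      by (rule submodule.submodule_is_module[OF M.submodule_Int[OF H K] M])
    then show "module R (M\<lparr>carrier := K\<rparr>\<lparr>carrier := H \<inter> K\<rparr>)" by simp
  qed simp
  ultimately have "lin_span R (M\<lparr>carrier := K\<rparr>) A = lin_span R M A" if "A \<subseteq> K" for A
    using that K unfolding lin_span_def by blast
  then show ?thesis unfolding fin_gen_def by auto
qed

lemma lin_maps_restrict:
  assumes "module R M" "submodule H R M" "f \<in> lin_maps R M P"
  shows "restrict f H \<in> lin_maps R (M\<lparr>carrier := H\<rparr>) P"
proof -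
  interpret M: module R M by fact
  note HE = M.submoduleE[OF assms(2)]
  have "x \<in> carrier M" if "x \<in> H" for x using that HE(1) by blast
  then show ?thesis using HE(4,5) lin_mapsD(1-3)[OF assms(3)] by (simp add: lin_maps_def)
qed

section \<open>Tensors as representable maps on the dual coalgebra\<close>

text \<open>\<open>\<Sum> x\<^sub>i \<otimes> c\<^sub>i\<close> is contracted to \<open>\<Sum> g(c\<^sub>i) x\<^sub>i\<close>; as a function of \<open>g\<close> this is the canonical image of the
  tensor in \<open>Hom(C\<^sup>*, X)\<close>.  Local projectivity says that a tensor is determined by its contractions.\<close>

abbreviation contract ::
  "('r,'k) ring_scheme \<Rightarrow> ('r,'x,'d) module_scheme \<Rightarrow> ('r,'c,'e) module_scheme
    \<Rightarrow> ('c \<Rightarrow> 'r) \<Rightarrow> ('x \<times> 'c \<Rightarrow> 'r) set \<Rightarrow> 'x" where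
  "contract R X C g t \<equiv> tensor_lift R X C X (\<lambda>x c. g c \<odot>\<^bsub>X\<^esub> x) t"

lemma tensor_map_id_lin:
  assumes "module R X" "module R Y" "module R C" "\<phi> \<in> lin_maps R X Y"
  shows "bilinear_map R X C (tensor R Y C) (\<lambda>x c. tens R Y C (\<phi> x) c)"
    and "(\<lambda>t\<in>carrier (tensor R X C). tensor_map R X C Y C \<phi> (\<lambda>c. c) t) \<in> lin_maps R (tensor R X C) (tensor R Y C)"
proof -
  interpret X: module R X by fact
  show b: "bilinear_map R X C (tensor R Y C) (\<lambda>x c. tens R Y C (\<phi> x) c)"
    by (rule tensor_map_bilinear[OF assms(1,3,2,3) _ assms(4) _ lin_maps_id[OF assms(3)]]) simp_all
  show "(\<lambda>t\<in>carrier (tensor R X C). tensor_map R X C Y C \<phi> (\<lambda>c. c) t) \<in> lin_maps R (tensor R X C) (tensor R Y C)"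
    unfolding tensor_map_def by (rule tensor_lift_lin[OF assms(1,3) tensor_module[OF X.cring_axioms] b])
qed

lemma contract_tensor_map:
  assumes "module R X" "module R Y" "module R C" "\<phi> \<in> lin_maps R X Y"
    and g: "g \<in> carrier (dual_module R C)" and t: "t \<in> carrier (tensor R X C)"
  shows "contract R Y C g (tensor_map R X C Y C \<phi> (\<lambda>c. c) t) = \<phi> (contract R X C g t)"
proof -
  interpret X: module R X by fact
  let ?XC = "tensor R X C" and ?YC = "tensor R Y C"
  note XC = tensor_module[OF X.cring_axioms, of X C] and YC = tensor_module[OF X.cring_axioms, of Y C]
  let ?m = "\<lambda>t\<in>carrier ?XC. tensor_map R X C Y C \<phi> (\<lambda>c. c) t"
  let ?X = "\<lambda>t\<in>carrier ?XC. contract R X C g t" and ?Y = "\<lambda>t\<in>carrier ?YC. contract R Y C g t"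
  note m = tensor_map_id_lin[OF assms(1-4)]
  note bX = act_bilinear[OF assms(1,3) g] and bY = act_bilinear[OF assms(2,3) g]
  note lX = tensor_lift_lin[OF assms(1,3,1) bX] and lY = tensor_lift_lin[OF assms(2,3,2) bY]
  have "(\<lambda>t\<in>carrier ?XC. ?Y (?m t)) t = (\<lambda>t\<in>carrier ?XC. \<phi> (?X t)) t"
  proof (rule tensor_lin_unique[OF assms(1,3,2) lin_maps_compose[OF XC m(2) lY]
        lin_maps_compose[OF XC lX assms(4)] _ t])
    fix x c assume xc: "x \<in> carrier X" "c \<in> carrier C"
    then have "g c \<in> carrier R" "\<phi> x \<in> carrier Y"
      using dualD(1)[OF g] lin_mapsD(1)[OF assms(4)] by auto
    then show "(\<lambda>t\<in>carrier ?XC. ?Y (?m t)) (tens R X C x c) = (\<lambda>t\<in>carrier ?XC. \<phi> (?X t)) (tens R X C x c)"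
      using xc by (simp add: tens_closed[OF X.cring_axioms] tensor_map_def
          tensor_lift_tens[OF assms(1,3) YC m(1)] tensor_lift_tens[OF assms(2,3,2) bY]
          tensor_lift_tens[OF assms(1,3,1) bX] lin_mapsD(3)[OF assms(4)])
  qed
  then show ?thesis using t lin_mapsD(1)[OF m(2) t] by simp
qed

text \<open>The span does not depend on \<open>g\<close>: it is that of the finitely many \<open>x\<^sub>i\<close> in one expression
  \<open>\<Sum> x\<^sub>i \<otimes> c\<^sub>i\<close> of the tensor.\<close>

lemma contract_in_span:
  assumes "module R X" "module R C" and t: "t \<in> carrier (tensor R X C)"
  obtains S where "finite S" "S \<subseteq> carrier X"
    "\<And>g. g \<in> carrier (dual_module R C) \<Longrightarrow> contract R X C g t \<in> lin_span R X S"
proof -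
  interpret X: module R X by fact
  obtain u where u: "u \<in> carrier (tensor_free R X C)"
      "t = tensor_null R X C +>\<^bsub>tensor_free R X C\<^esub> u"
    using t by (rule tensor_carrierE)
  define A where "A = supp R (carrier X \<times> carrier C) u"
  have A: "finite A" "A \<subseteq> carrier X \<times> carrier C"
    using u(1) by (auto simp: A_def tensor_free_def free_carrier supp_def)
  have uA: "u p \<in> carrier R" if "p \<in> A" for p
    using that u(1) A(2) by (auto simp: tensor_free_def free_carrier PiE_iff)
  have SX: "fst ` A \<subseteq> carrier X" using A(2) by auto
  note S = lin_span_submodule[OF assms(1) SX]
  have "contract R X C g t \<in> lin_span R X (fst ` A)" if g: "g \<in> carrier (dual_module R C)" for g
  proof -
    have "contract R X C g t = (\<Oplus>\<^bsub>X\<^esub>p\<in>A. u p \<odot>\<^bsub>X\<^esub> (g (snd p) \<odot>\<^bsub>X\<^esub> fst p))"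
      using tensor_lift_coset[OF assms(1,2,1) act_bilinear[OF assms(1,2) g] u(1)] u(2)
      by (simp add: free_ext_def A_def case_prod_beta')
    also have "\<dots> \<in> lin_span R X (fst ` A)"
    proof (rule X.submodule_finsum[OF S], rule)
      fix p assume p: "p \<in> A"
      then have "fst p \<in> lin_span R X (fst ` A)" using lin_span_superset[of "fst ` A" R X] by auto
      moreover have "g (snd p) \<in> carrier R" using p A(2) dualD(1)[OF g] by auto
      ultimately show "u p \<odot>\<^bsub>X\<^esub> (g (snd p) \<odot>\<^bsub>X\<^esub> fst p) \<in> lin_span R X (fst ` A)"
        using X.submoduleE(4)[OF S] uA[OF p] by blast
    qed
    finally show ?thesis .
  qed
  then show ?thesis using that[of "fst ` A"] A(1) SX by blast
qed

text \<open>Exactness of \<open>X \<otimes> C \<rightarrow> Y \<otimes> C \<rightarrow> (Y / \<iota>X) \<otimes> C\<close> in the middle.  Let \<open>W\<close> be the cokernel of the first map.  Sending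
  \<open>(y + \<iota>X, c)\<close> to the class of \<open>y \<otimes> c\<close> in \<open>W\<close> is well defined and bilinear; the map on \<open>(Y / \<iota>X) \<otimes> C\<close> that
  it induces recovers the projection of \<open>Y \<otimes> C\<close> onto \<open>W\<close>, so a tensor that dies in \<open>(Y / \<iota>X) \<otimes> C\<close> dies in \<open>W\<close>.\<close>

lemma tensor_right_exact:
  assumes X: "module R X" and Y: "module R Y" and C: "module R C" and \<iota>: "\<iota> \<in> lin_maps R X Y"
    and t: "t \<in> carrier (tensor R Y C)"
  defines "Z \<equiv> quot_module R Y (\<iota> ` carrier X)"
  defines "\<pi> \<equiv> \<lambda>y\<in>carrier Y. (\<iota> ` carrier X) +>\<^bsub>Y\<^esub> y"
  assumes zero: "tensor_map R Y C Z C \<pi> (\<lambda>c. c) t = \<zero>\<^bsub>tensor R Z C\<^esub>"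
  obtains s where "s \<in> carrier (tensor R X C)" "tensor_map R X C Y C \<iota> (\<lambda>c. c) s = t"
proof -
  interpret X: module R X by fact
  interpret Y: module R Y by fact
  interpret C: module R C by fact
  let ?XC = "tensor R X C" and ?YC = "tensor R Y C" and ?ZC = "tensor R Z C"
  note cr = X.cring_axioms
  note XC = tensor_module[OF cr, of X C] and YC = tensor_module[OF cr, of Y C]
    and ZC = tensor_module[OF cr, of Z C]
  interpret XC: module R ?XC by (rule XC)
  interpret YC: module R ?YC by (rule YC)
  let ?i = "\<lambda>t\<in>carrier ?XC. tensor_map R X C Y C \<iota> (\<lambda>c. c) t"
  let ?p = "\<lambda>t\<in>carrier ?YC. tensor_map R Y C Z C \<pi> (\<lambda>c. c) t"
  define L where "L = \<iota> ` carrier X"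
  have L: "submodule L R Y"
    unfolding L_def by (rule lin_maps_image_submodule[OF X Y \<iota> X.carrier_is_submodule])
  have Z: "module R Z" unfolding Z_def L_def[symmetric] by (rule quot_module_module[OF Y L])
  have \<pi>: "\<pi> \<in> lin_maps R Y Z" unfolding \<pi>_def Z_def L_def[symmetric] by (rule quot_proj_lin[OF Y L])
  note i = tensor_map_id_lin[OF X Y C \<iota>] and p = tensor_map_id_lin[OF Y Z C \<pi>]
  define K where "K = ?i ` carrier ?XC"
  have K: "submodule K R ?YC"
    unfolding K_def by (rule lin_maps_image_submodule[OF XC YC i(2) XC.carrier_is_submodule])
  let ?W = "quot_module R ?YC K"
  note W = quot_module_module[OF YC K]
  interpret W: module R ?W by (rule W)
  define q where "q = (\<lambda>t\<in>carrier ?YC. K +>\<^bsub>?YC\<^esub> t)"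
  have q: "q \<in> lin_maps R ?YC ?W" unfolding q_def by (rule quot_proj_lin[OF YC K])
  note bt = bilinear_mapD[OF tens_bilinear[OF Y C] Y C]
  define b where "b c = (\<lambda>y\<in>carrier Y. q (tens R Y C y c))" for c
  have b: "b c \<in> lin_maps R Y ?W" if "c \<in> carrier C" for c
    using that bt lin_mapsD(1-3)[OF q] by (simp add: b_def lin_maps_def)
  have bL: "b c y = \<zero>\<^bsub>?W\<^esub>" if c: "c \<in> carrier C" and "y \<in> L" for c y
  proof -
    from \<open>y \<in> L\<close> obtain x where x: "x \<in> carrier X" "y = \<iota> x" by (auto simp: L_def)
    have "?i (tens R X C x c) = tens R Y C y c"
      using x c by (simp add: tens_closed[OF cr] tensor_map_def tensor_lift_tens[OF X C YC i(1)])
    then have "tens R Y C y c \<in> K" unfolding K_def using tens_closed[OF cr, of X C x c] by (metis image_eqI)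
    then have "K +>\<^bsub>?YC\<^esub> tens R Y C y c = K"
      using quot_coset_eq_zero_iff[OF YC K tens_closed[OF cr]] by blast
    then show ?thesis
      using x lin_mapsD(1)[OF \<iota>] by (simp add: b_def q_def tens_closed[OF cr] quot_zero)
  qed
  have the_b: "the_elem (b c ` (L +>\<^bsub>Y\<^esub> y)) = b c y" if "c \<in> carrier C" "y \<in> carrier Y" for c y
    by (rule quot_lift_coset[OF Y W L b[OF that(1)] bL[OF that(1)] that(2)])
  \<comment> \<open>\<open>\<beta> (y + L) c\<close> is the class of \<open>y \<otimes> c\<close> in the cokernel \<open>W\<close>.\<close>
  define \<beta> where "\<beta> A c = the_elem (b c ` A)" for A c
  have \<beta>: "\<beta> (L +>\<^bsub>Y\<^esub> y) c = q (tens R Y C y c)" if "c \<in> carrier C" "y \<in> carrier Y" for c y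
    unfolding \<beta>_def the_b[OF that] using that(2) by (simp add: b_def)
  have bl: "bilinear_map R Z C ?W \<beta>"
    unfolding bilinear_map_def
  proof (intro conjI ballI)
    fix c assume c: "c \<in> carrier C"
    show "(\<lambda>A\<in>carrier Z. \<beta> A c) \<in> lin_maps R Z ?W"
      unfolding \<beta>_def Z_def L_def[symmetric]
      by (rule quot_lift_lin[OF Y W L b[OF c] bL[OF c]])
  next
    fix A assume "A \<in> carrier Z"
    then obtain y where y: "y \<in> carrier Y" "A = L +>\<^bsub>Y\<^esub> y" by (auto simp: Z_def L_def quot_carrier)
    then have "(\<lambda>c\<in>carrier C. \<beta> A c) = (\<lambda>c\<in>carrier C. q (tens R Y C y c))"
      by (intro restrict_ext) (simp add: \<beta>)
    also have "\<dots> \<in> lin_maps R C ?W"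
      using y bt lin_mapsD(1-3)[OF q] by (simp add: lin_maps_def)
    finally show "(\<lambda>c\<in>carrier C. \<beta> A c) \<in> lin_maps R C ?W" .
  qed
  let ?\<theta> = "\<lambda>t\<in>carrier ?ZC. tensor_lift R Z C ?W \<beta> t"
  note \<theta> = tensor_lift_lin[OF Z C W bl]
  have "(\<lambda>t\<in>carrier ?YC. ?\<theta> (?p t)) t = q t"
  proof (rule tensor_lin_unique[OF Y C W lin_maps_compose[OF YC p(2) \<theta>] q _ t])
    fix y c assume yc: "y \<in> carrier Y" "c \<in> carrier C"
    then have "?p (tens R Y C y c) = tens R Z C (\<pi> y) c"
      by (simp add: tens_closed[OF cr] tensor_map_def tensor_lift_tens[OF Y C ZC p(1)])
    moreover have "\<pi> y = L +>\<^bsub>Y\<^esub> y" "L +>\<^bsub>Y\<^esub> y \<in> carrier Z"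
      using yc(1) by (simp_all add: \<pi>_def L_def Z_def quot_carrier)
    ultimately show "(\<lambda>t\<in>carrier ?YC. ?\<theta> (?p t)) (tens R Y C y c) = q (tens R Y C y c)"
      using yc by (simp only: restrict_apply' tens_closed[OF cr] tensor_lift_tens[OF Z C W bl])
        (simp add: \<beta>)
  qed
  moreover have "?p t = \<zero>\<^bsub>?ZC\<^esub>" using zero t by simp
  ultimately have "q t = \<zero>\<^bsub>?W\<^esub>"
    using t lin_maps_zero[OF ZC W \<theta>] by (simp only: restrict_apply')
  then have "t \<in> K" using t quot_coset_eq_zero_iff[OF YC K t] by (simp add: q_def quot_zero)
  then obtain s where s: "s \<in> carrier ?XC" "t = ?i s" unfolding K_def by (rule imageE)
  from s(2) have "tensor_map R X C Y C \<iota> (\<lambda>c. c) s = t" by (simp only: restrict_apply'[OF s(1)])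
  with s(1) show ?thesis by (rule that)
qed

text \<open>All contractions of \<open>t\<close> vanish modulo \<open>\<iota>X\<close>, so by local projectivity \<open>t\<close> dies in
  \<open>(Y / \<iota>X) \<otimes> C\<close>; then right exactness provides a preimage.\<close>

lemma locally_projective_lift:
  assumes X: "module R X" and Y: "module R Y" and C: "module R C" and lp: "locally_projective R C"
    and \<iota>: "\<iota> \<in> lin_maps R X Y" and t: "t \<in> carrier (tensor R Y C)"
    and im: "\<And>g. g \<in> carrier (dual_module R C) \<Longrightarrow> contract R Y C g t \<in> \<iota> ` carrier X"
  obtains s where "s \<in> carrier (tensor R X C)"
    "\<And>g. g \<in> carrier (dual_module R C) \<Longrightarrow> \<iota> (contract R X C g s) = contract R Y C g t"
proof -
  interpret X: module R X by fact
  define L where "L = \<iota> ` carrier X"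
  let ?Z = "quot_module R Y L" and ?\<pi> = "\<lambda>y\<in>carrier Y. L +>\<^bsub>Y\<^esub> y"
  have L: "submodule L R Y"
    unfolding L_def by (rule lin_maps_image_submodule[OF X Y \<iota> X.carrier_is_submodule])
  note Z = quot_module_module[OF Y L] and \<pi> = quot_proj_lin[OF Y L]
  note ZC = tensor_module[OF X.cring_axioms, of ?Z C]
  interpret ZC: module R "tensor R ?Z C" by (rule ZC)
  let ?u = "tensor_map R Y C ?Z C ?\<pi> (\<lambda>c. c) t"
  have u: "?u \<in> carrier (tensor R ?Z C)"
    using lin_mapsD(1)[OF tensor_map_id_lin(2)[OF Y Z C \<pi>] t] t by simp
  have "contract R ?Z C g ?u = contract R ?Z C g \<zero>\<^bsub>tensor R ?Z C\<^esub>" if g: "g \<in> carrier (dual_module R C)" for g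
  proof -
    have "contract R Y C g t \<in> L" using im[OF g] by (simp add: L_def)
    moreover have c: "contract R Y C g t \<in> carrier Y"
      by (rule tensor_liftD(1)[OF Y C Y act_bilinear[OF Y C g] t])
    ultimately have "?\<pi> (contract R Y C g t) = \<zero>\<^bsub>?Z\<^esub>"
      using quot_coset_eq_zero_iff[OF Y L c] by (simp add: quot_zero)
    moreover have "contract R ?Z C g \<zero>\<^bsub>tensor R ?Z C\<^esub> = \<zero>\<^bsub>?Z\<^esub>"
      using lin_maps_zero[OF ZC Z tensor_lift_lin[OF Z C Z act_bilinear[OF Z C g]]] by simp
    ultimately show ?thesis using contract_tensor_map[OF Y Z C \<pi> g t] by simp
  qed
  then have "loc_proj_map R C ?Z ?u = loc_proj_map R C ?Z \<zero>\<^bsub>tensor R ?Z C\<^esub>"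
    unfolding loc_proj_map_def by (intro restrict_ext)
  then have "?u = \<zero>\<^bsub>tensor R ?Z C\<^esub>"
    using locally_projective_any_module[OF C lp Z] u by (auto dest: inj_onD)
  then obtain s where s: "s \<in> carrier (tensor R X C)" "tensor_map R X C Y C \<iota> (\<lambda>c. c) s = t"
    using tensor_right_exact[OF X Y C \<iota> t] unfolding L_def by blast
  then show ?thesis using that[OF s(1)] contract_tensor_map[OF X Y C \<iota> _ s(1)] by simp
qed

lemma power_module_expansion:
  assumes "cring R" "finite S" and u: "u \<in> carrier (power_module R S)"
  shows "u = (\<Oplus>\<^bsub>power_module R S\<^esub>p\<in>S. u p \<odot>\<^bsub>power_module R S\<^esub> free_gen R S p)"
proof -
  have e: "power_module R S = free_module R S"
    using assms(2) by (simp add: free_module_def power_module_def supp_def)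
  let ?F = "free_module R S"
  note F = free_module_module[OF assms(1), of S]
  have b: "free_gen R S \<in> S \<rightarrow> carrier ?F" by (simp add: free_gen_closed[OF assms(1)])
  note u' = u[unfolded e]
  have "(\<lambda>u\<in>carrier ?F. free_ext R S ?F (free_gen R S) u) u = (\<lambda>u\<in>carrier ?F. u) u"
    by (rule free_lin_unique[OF F free_ext_lin[OF F b] lin_maps_id[OF F] _ u'])
      (simp add: free_gen_closed[OF assms(1)] free_ext_gen[OF F b])
  moreover have "u \<in> S \<rightarrow> carrier R" "supp R S u \<subseteq> S" using u' by (auto simp: free_carrier supp_def)
  ultimately show ?thesis
    using free_ext_superset[OF F b _ assms(2)] u' unfolding e by simp
qed

lemma tensor_of_coordinates:
  assumes C: "module R C" and "finite S" and c: "c \<in> S \<rightarrow> carrier C"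
  obtains t where "t \<in> carrier (tensor R (power_module R S) C)"
    "\<And>g. g \<in> carrier (dual_module R C) \<Longrightarrow> contract R (power_module R S) C g t = (\<lambda>p\<in>S. g (c p))"
proof -
  interpret C: module R C by fact
  let ?Y = "power_module R S"
  note cr = C.cring_axioms
  note Y = power_module_module[OF cr, of S]
  interpret Y: module R ?Y by (rule Y)
  let ?YC = "tensor R ?Y C"
  interpret YC: module R ?YC by (rule tensor_module[OF cr])
  let ?t = "\<Oplus>\<^bsub>?YC\<^esub>p\<in>S. tens R ?Y C (free_gen R S p) (c p)"
  have fg: "free_gen R S p \<in> carrier ?Y" for p
    using free_gen_closed[OF cr, of S p] by (auto simp: free_carrier power_module_def)
  have tc: "(\<lambda>p. tens R ?Y C (free_gen R S p) (c p)) \<in> S \<rightarrow> carrier ?YC" by (simp add: tens_closed[OF cr])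
  have "contract R ?Y C g ?t = (\<lambda>p\<in>S. g (c p))" if g: "g \<in> carrier (dual_module R C)" for g
  proof -
    let ?u = "\<lambda>p\<in>S. g (c p)"
    note b = act_bilinear[OF Y C g]
    have gc: "g (c p) \<in> carrier R" if "p \<in> S" for p using that c dualD(1)[OF g] by blast
    have u: "?u \<in> carrier ?Y" using gc by (auto simp: power_module_def)
    have "contract R ?Y C g ?t = (\<Oplus>\<^bsub>?Y\<^esub>p\<in>S. contract R ?Y C g (tens R ?Y C (free_gen R S p) (c p)))"
      by (rule tensor_liftD(4)[OF Y C Y b assms(2) tc])
    also have "\<dots> = (\<Oplus>\<^bsub>?Y\<^esub>p\<in>S. ?u p \<odot>\<^bsub>?Y\<^esub> free_gen R S p)"
      using fg gc c by (intro Y.finsum_cong') (auto simp: tensor_lift_tens[OF Y C Y b] Pi_iff)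
    also have "\<dots> = ?u" by (rule power_module_expansion[OF cr assms(2) u, symmetric])
    finally show ?thesis .
  qed
  then show ?thesis using that[of ?t] YC.finsum_closed[OF tc] by blast
qed

text \<open>The target of \<open>\<iota>\<close> is a finite free module, where a map on \<open>C\<^sup>*\<close> is represented by \<open>\<Sum> e\<^sub>p \<otimes> c\<^sub>p\<close> once its
  coordinates are evaluations at elements \<open>c\<^sub>p\<close> of \<open>C\<close>.  Its values lie in the image of \<open>X\<close>, so the tensor
  can be taken from \<open>X \<otimes> C\<close>.\<close>

lemma representable_coordinatewise:
  assumes X: "module R X" and C: "module R C" and lp: "locally_projective R C" and "finite S"
    and \<iota>: "\<iota> \<in> lin_maps R X (power_module R S)" and c: "c \<in> S \<rightarrow> carrier C"
    and F: "\<And>g. g \<in> carrier (dual_module R C) \<Longrightarrow> F g \<in> carrier X \<and> \<iota> (F g) = (\<lambda>p\<in>S. g (c p))"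
  obtains t where "t \<in> carrier (tensor R X C)"
    "\<And>g. g \<in> carrier (dual_module R C) \<Longrightarrow> \<iota> (contract R X C g t) = \<iota> (F g)"
proof -
  interpret X: module R X by fact
  note Y = power_module_module[OF X.cring_axioms, of S]
  obtain t where t: "t \<in> carrier (tensor R (power_module R S) C)"
    "\<And>g. g \<in> carrier (dual_module R C) \<Longrightarrow> contract R (power_module R S) C g t = (\<lambda>p\<in>S. g (c p))"
    using tensor_of_coordinates[OF C assms(4) c] by blast
  have "contract R (power_module R S) C g t \<in> \<iota> ` carrier X" if "g \<in> carrier (dual_module R C)" for g
    using t(2)[OF that] F[OF that] by (metis image_eqI)
  then obtain s where "s \<in> carrier (tensor R X C)"
    "\<And>g. g \<in> carrier (dual_module R C) \<Longrightarrow> \<iota> (contract R X C g s) = contract R (power_module R S) C g t"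
    using locally_projective_lift[OF X Y C lp \<iota> t(1)] by blast
  then show ?thesis using that[of s] t(2) F by simp
qed

text \<open>For \<open>t = \<Sum> x\<^sub>i \<otimes> c\<^sub>i\<close> the element is \<open>e = \<Sum> h(x\<^sub>i) c\<^sub>i\<close>.\<close>

lemma functional_of_contraction:
  assumes X: "module R X" and C: "module R C" and h: "h \<in> carrier (dual_module R X)"
    and t: "t \<in> carrier (tensor R X C)"
  obtains e where "e \<in> carrier C"
    "\<And>g. g \<in> carrier (dual_module R C) \<Longrightarrow> h (contract R X C g t) = g e"
proof -
  interpret X: module R X by fact
  interpret C: module R C by fact
  let ?XC = "tensor R X C"
  note cr = X.cring_axioms
  note XC = tensor_module[OF cr, of X C]
  let ?b = "\<lambda>x c. h x \<odot>\<^bsub>C\<^esub> c"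
  note hD = dualD[OF h]
  have b: "bilinear_map R X C C ?b"
    by (rule bilinear_mapI[OF _ _ _ _ _ X C])
      (simp_all add: hD C.smult_r_distr C.smult_l_distr C.smult_assoc1[symmetric] X.m_comm)
  let ?e = "\<lambda>t\<in>carrier ?XC. tensor_lift R X C C ?b t"
  note e = tensor_lift_lin[OF X C C b]
  have "h (contract R X C g t) = g (?e t)" if g: "g \<in> carrier (dual_module R C)" for g
  proof -
    note a = act_bilinear[OF X C g]
    let ?a = "\<lambda>t\<in>carrier ?XC. contract R X C g t"
    have "(\<lambda>t\<in>carrier ?XC. h (?a t)) t = (\<lambda>t\<in>carrier ?XC. g (?e t)) t"
    proof (rule tensor_lin_unique[OF X C regular_module_module[OF cr]
          lin_maps_compose[OF XC tensor_lift_lin[OF X C X a] h[unfolded dual_carrier]]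
          lin_maps_compose[OF XC e g[unfolded dual_carrier]] _ t])
      fix x c assume "x \<in> carrier X" "c \<in> carrier C"
      then show "(\<lambda>t\<in>carrier ?XC. h (?a t)) (tens R X C x c) = (\<lambda>t\<in>carrier ?XC. g (?e t)) (tens R X C x c)"
        by (simp add: tens_closed[OF cr] tensor_lift_tens[OF X C X a] tensor_lift_tens[OF X C C b]
            hD dualD[OF g] X.m_comm)
    qed
    then show ?thesis using t by simp
  qed
  then show ?thesis using that[OF lin_mapsD(1)[OF e t]] by blast
qed

section \<open>Functionals, annihilators and coordinates\<close>

lemma dual_module_simps:
  "\<zero>\<^bsub>dual_module R M\<^esub> = (\<lambda>x\<in>carrier M. \<zero>\<^bsub>R\<^esub>)"
  "f \<oplus>\<^bsub>dual_module R M\<^esub> g = (\<lambda>x\<in>carrier M. f x \<oplus>\<^bsub>R\<^esub> g x)"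
  "r \<odot>\<^bsub>dual_module R M\<^esub> f = (\<lambda>x\<in>carrier M. r \<otimes>\<^bsub>R\<^esub> f x)"
  by (simp_all add: dual_module_def hom_module_def regular_module_def)

lemma dual_eqI:
  assumes "f \<in> carrier (dual_module R M)" "g \<in> carrier (dual_module R M)"
    and "\<And>x. x \<in> carrier M \<Longrightarrow> f x = g x"
  shows "f = g"
  using assms lin_mapsD(4)[of f R M] lin_mapsD(4)[of g R M] by (auto simp: dual_carrier intro: extensionalityI)

lemma eval_map_closed:
  assumes "module R M" "x \<in> carrier M"
  shows "eval_map R M x \<in> carrier (dual_module R (dual_module R M))"
proof -
  interpret M: module R M by fact
  interpret D: module R "dual_module R M" by (rule dual_module_module) fact
  have "f \<oplus>\<^bsub>dual_module R M\<^esub> g \<in> carrier (dual_module R M)" if "f \<in> carrier (dual_module R M)" "g \<in> carrier (dual_module R M)" for f g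
    using that by simp
  then show ?thesis
    using assms(2) dualD(1)[of _ R M]
    unfolding dual_carrier[of R "dual_module R M"] lin_maps_def
    by (simp add: eval_map_def regular_module_def) (simp add: dual_module_simps)
qed

abbreviation annihilator ::
  "('r,'k) ring_scheme \<Rightarrow> ('r,'m,'e) module_scheme \<Rightarrow> 'm set \<Rightarrow> ('m \<Rightarrow> 'r) set" where
  "annihilator R M A \<equiv> {f \<in> carrier (dual_module R M). \<forall>x\<in>A. f x = \<zero>\<^bsub>R\<^esub>}"

abbreviation common_kernel ::
  "('r,'k) ring_scheme \<Rightarrow> ('r,'m,'e) module_scheme \<Rightarrow> ('m \<Rightarrow> 'r) set \<Rightarrow> 'm set" where
  "common_kernel R M \<Phi> \<equiv> {x \<in> carrier M. \<forall>\<phi>\<in>\<Phi>. \<phi> x = \<zero>\<^bsub>R\<^esub>}"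

lemma common_kernel_submodule:
  assumes "module R M" "\<Phi> \<subseteq> carrier (dual_module R M)"
  shows "submodule (common_kernel R M \<Phi>) R M"
proof -
  interpret M: module R M by fact
  have k: "submodule {x \<in> carrier M. \<phi> x = \<zero>\<^bsub>R\<^esub>} R M" if "\<phi> \<in> \<Phi>" for \<phi>
    using lin_maps_kernel_submodule[OF assms(1) regular_module_module[OF M.cring_axioms], of \<phi>] that assms(2)
    by (auto simp: dual_carrier regular_module_def)
  show ?thesis
    by (rule M.submoduleI)
      (use k[THEN M.submoduleE(3)] k[THEN M.submoduleE(4)] k[THEN M.submoduleE(5)] k[THEN M.submodule_zero] in auto)
qed

lemma annihilator_submodule:
  assumes "module R M" "A \<subseteq> carrier M"
  shows "submodule (annihilator R M A) R (dual_module R M)"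
proof -
  have "eval_map R M x f = f x" if "x \<in> A" "f \<in> carrier (dual_module R M)" for x f
    using that assms(2) by (auto simp: eval_map_def)
  then have "annihilator R M A = common_kernel R (dual_module R M) (eval_map R M ` A)" by auto
  moreover have "eval_map R M ` A \<subseteq> carrier (dual_module R (dual_module R M))"
    using eval_map_closed[OF assms(1)] assms(2) by blast
  ultimately show ?thesis
    by (simp only: common_kernel_submodule[OF dual_module_module[OF assms(1)]])
qed

lemma functional_span_eqI:
  assumes "module R M" "f \<in> carrier (dual_module R M)" "A \<subseteq> carrier M"
    and "g \<in> carrier (dual_module R M)" "\<And>x. x \<in> A \<Longrightarrow> f x = g x" "x \<in> lin_span R M A"
  shows "f x = g x"
proof -
  interpret M: module R M by fact
  show ?thesis
    by (rule lin_maps_span_eqI[OF assms(1) regular_module_module[OF M.cring_axioms]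
          assms(2)[unfolded dual_carrier] assms(4)[unfolded dual_carrier] assms(3,5,6)])
qed

lemma annihilator_span:
  assumes "module R M" "A \<subseteq> carrier M"
  shows "annihilator R M (lin_span R M A) = annihilator R M A"
proof (intro antisym subsetI)
  fix f assume f: "f \<in> annihilator R M A"
  then have "A \<subseteq> common_kernel R M {f}" using assms(2) by auto
  then have "lin_span R M A \<subseteq> common_kernel R M {f}"
    using f by (intro lin_span_minimal common_kernel_submodule assms(1)) auto
  then show "f \<in> annihilator R M (lin_span R M A)" using f by auto
qed (use lin_span_superset[of A R M] in auto)

lemma coordinate_map_lin:
  assumes "module R M" "\<And>i. i \<in> S \<Longrightarrow> \<phi> i \<in> carrier (dual_module R M)"
  shows "(\<lambda>x\<in>carrier M. \<lambda>i\<in>S. \<phi> i x) \<in> lin_maps R M (power_module R S)"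
proof -
  interpret M: module R M by fact
  show ?thesis
    using dualD[OF assms(2)] by (auto simp: lin_maps_def power_module_def intro!: restrict_ext)
qed

text \<open>\<open>M\<close> modulo the common kernel embeds in the finite free module \<open>R\<^sup>\<Phi>\<close>.\<close>

lemma cofinite_common_kernel:
  assumes M: "module R M" and noeth: "noetherian_ring R" and "finite \<Phi>" "\<Phi> \<subseteq> carrier (dual_module R M)"
    and L: "submodule L R M" "common_kernel R M \<Phi> \<subseteq> L"
  shows "fin_gen R (quot_module R M L)"
proof -
  interpret M: module R M by fact
  let ?f = "\<lambda>x\<in>carrier M. \<lambda>\<phi>\<in>\<Phi>. \<phi> x"
  note P = power_module_module[OF M.cring_axioms, of \<Phi>]
  have f: "?f \<in> lin_maps R M (power_module R \<Phi>)"
    using coordinate_map_lin[OF M, of \<Phi> "\<lambda>\<phi>. \<phi>"] assms(4) by auto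
  show ?thesis
  proof (rule fin_gen_quotI[OF M P noeth power_module_fin_gen[OF M.cring_axioms assms(3)] f L(1)])
    fix x assume x: "x \<in> carrier M" and "?f x = \<zero>\<^bsub>power_module R \<Phi>\<^esub>"
    then have "\<phi> x = \<zero>\<^bsub>R\<^esub>" if "\<phi> \<in> \<Phi>" for \<phi>
      using that by (auto simp: power_module_def dest: fun_cong[of _ _ \<phi>])
    then show "x \<in> L" using x L(2) by blast
  qed
qed

lemma embeds_in_power_separates_points:
  fixes R :: "('r,'k) ring_scheme" and M :: "('r,'m,'e) module_scheme"
  assumes M: "module R M" and emb: "embeds_in_power R M" and x: "x \<in> carrier M"
    and van: "\<And>f. f \<in> carrier (dual_module R M) \<Longrightarrow> f x = \<zero>\<^bsub>R\<^esub>"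
  shows "x = \<zero>\<^bsub>M\<^esub>"
proof -
  interpret M: module R M by fact
  obtain I :: "('m \<Rightarrow> 'r) set" and \<phi> where \<phi>: "\<phi> \<in> lin_maps R M (power_module R I)"
    and inj: "inj_on \<phi> (carrier M)"
    using emb unfolding embeds_in_power_def by blast
  note D = lin_mapsD(1-3)[OF \<phi>]
  have "\<phi> x i = \<zero>\<^bsub>R\<^esub>" if i: "i \<in> I" for i
  proof -
    have "(\<lambda>y\<in>carrier M. \<phi> y i) \<in> carrier (dual_module R M)"
      using D i by (auto simp: dual_carrier lin_maps_def power_module_def regular_module_def)
    from van[OF this] show ?thesis using x by simp
  qed
  then have "\<phi> x = \<zero>\<^bsub>power_module R I\<^esub>"
    using D(1)[OF x] by (auto simp: power_module_def PiE_iff extensional_def fun_eq_iff)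
  also have "\<dots> = \<phi> \<zero>\<^bsub>M\<^esub>"
    by (rule lin_maps_zero[OF M power_module_module[OF M.cring_axioms] \<phi>, symmetric])
  finally show ?thesis using inj x by (auto dest: inj_onD)
qed

section \<open>Comparing linear topologies\<close>

text \<open>A submodule is open iff it contains a member of the basis.  Applied to the members of the other basis, this
  gives one direction; for the other, two bases that refine each other define the same open sets.\<close>

lemma linear_topology_eq_iff:
  assumes M: "module R M"
    and A: "\<And>H. H \<in> \<A> \<Longrightarrow> submodule H R M" "\<A> \<noteq> {}"
      "\<And>H K. H \<in> \<A> \<Longrightarrow> K \<in> \<A> \<Longrightarrow> \<exists>L\<in>\<A>. L \<subseteq> H \<inter> K"
    and B: "\<And>H. H \<in> \<B> \<Longrightarrow> submodule H R M" "\<B> \<noteq> {}"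
      "\<And>H K. H \<in> \<B> \<Longrightarrow> K \<in> \<B> \<Longrightarrow> \<exists>L\<in>\<B>. L \<subseteq> H \<inter> K"
  shows "linear_topology M \<A> = linear_topology M \<B> \<longleftrightarrow>
    (\<forall>H\<in>\<A>. \<exists>K\<in>\<B>. K \<subseteq> H) \<and> (\<forall>H\<in>\<B>. \<exists>K\<in>\<A>. K \<subseteq> H)"
proof
  interpret M: module R M by fact
  have le: "\<exists>K\<in>\<D>. K \<subseteq> H"
    if C: "\<And>H. H \<in> \<C> \<Longrightarrow> submodule H R M" "\<C> \<noteq> {}"
        "\<And>H K. H \<in> \<C> \<Longrightarrow> K \<in> \<C> \<Longrightarrow> \<exists>L\<in>\<C>. L \<subseteq> H \<inter> K"
      and D: "\<And>H. H \<in> \<D> \<Longrightarrow> submodule H R M" "\<D> \<noteq> {}"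
        "\<And>H K. H \<in> \<D> \<Longrightarrow> K \<in> \<D> \<Longrightarrow> \<exists>L\<in>\<D>. L \<subseteq> H \<inter> K"
      and eq: "linear_topology M \<C> = linear_topology M \<D>" and H: "H \<in> \<C>" for \<C> \<D> H
  proof -
    note HE = M.submoduleE[OF C(1)[OF H]]
    have "H +>\<^bsub>M\<^esub> x \<subseteq> H" if "x \<in> H" for x
      using that HE(5) by (auto simp: a_r_coset_def')
    then have "openin (linear_topology M \<C>) H"
      using HE(1) H by (subst openin_linear_topology[OF M C]) auto
    then have "openin (linear_topology M \<D>) H" by (simp add: eq)
    then obtain K where "K \<in> \<D>" "K +>\<^bsub>M\<^esub> \<zero>\<^bsub>M\<^esub> \<subseteq> H"
      using M.submodule_zero[OF C(1)[OF H]] by (subst (asm) openin_linear_topology[OF M D]) auto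
    then show ?thesis using quot_coset_zero[OF M D(1)] by auto
  qed
  show "(\<forall>H\<in>\<A>. \<exists>K\<in>\<B>. K \<subseteq> H) \<and> (\<forall>H\<in>\<B>. \<exists>K\<in>\<A>. K \<subseteq> H)"
    if eq: "linear_topology M \<A> = linear_topology M \<B>"
    using le[OF A B eq] le[OF B A eq[symmetric]] by blast
next
  have mono: "L +>\<^bsub>M\<^esub> x \<subseteq> H +>\<^bsub>M\<^esub> x" if "L \<subseteq> H" for L H x
    using that by (auto simp: a_r_coset_def')
  assume "(\<forall>H\<in>\<A>. \<exists>K\<in>\<B>. K \<subseteq> H) \<and> (\<forall>H\<in>\<B>. \<exists>K\<in>\<A>. K \<subseteq> H)"
  then have "(\<exists>H\<in>\<A>. H +>\<^bsub>M\<^esub> x \<subseteq> U) \<longleftrightarrow> (\<exists>H\<in>\<B>. H +>\<^bsub>M\<^esub> x \<subseteq> U)" for x U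
    using mono by (meson subset_trans)
  then show "linear_topology M \<A> = linear_topology M \<B>"
    by (simp add: topology_eq openin_linear_topology[OF M A] openin_linear_topology[OF M B])
qed

section \<open>Rational and cofinitely supported functionals on the dual of a comodule\<close>

context right_comodule
begin

text \<open>From here on \<open>N'\<close> is the module \<open>N\<^sup>*\<close>, \<open>C'\<close> the set of elements of \<open>C\<^sup>*\<close>, and \<open>act h g\<close> is \<open>h g\<close> for \<open>h \<in> N\<^sup>*\<close> and \<open>g \<in> C\<^sup>*\<close>.\<close>

abbreviation (input) "C' \<equiv> carrier (dual_module R C)"
abbreviation (input) "N' \<equiv> dual_module R N"
abbreviation (input) "act \<equiv> comodule_dual_act R C N \<rho>"

lemma counit_in_dual: "\<epsilon> \<in> C'"
  using counit_lin by (simp add: dual_carrier)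

lemma convolution_closed:
  assumes g: "g \<in> C'" and h: "h \<in> C'"
  shows "convolution R C \<Delta> g h \<in> C'"
proof -
  note C = module_axioms and RR = regular_module_module[OF R.cring_axioms]
  have b: "bilinear_map R C C (regular_module R) (\<lambda>x y. g x \<otimes> h y)"
    by (rule bilinear_mapI[OF _ _ _ _ _ C C])
      (simp_all add: dualD[OF g] dualD[OF h] regular_module_def R.l_distr R.r_distr R.m_assoc R.m_lcomm)
  note l = tensor_lift_lin[OF C C RR b]
  have "convolution R C \<Delta> g h
      = (\<lambda>c\<in>carrier C. (\<lambda>t\<in>carrier (tensor R C C). tensor_lift R C C (regular_module R) (\<lambda>x y. g x \<otimes> h y) t) (\<Delta> c))"
    unfolding convolution_def using lin_mapsD(1)[OF comult_lin] by (intro restrict_ext) simp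
  then show ?thesis
    using lin_maps_compose[OF C comult_lin l] by (simp add: dual_carrier)
qed

lemma comodule_act_closed: "g \<in> C' \<Longrightarrow> n \<in> carrier N \<Longrightarrow> comodule_act R C N \<rho> g n \<in> carrier N"
  using lin_mapsD(1)[OF comodule_act_lin, of g n] by simp

lemma act_apply: "n \<in> carrier N \<Longrightarrow> act h g n = h (comodule_act R C N \<rho> g n)"
  by (simp add: comodule_dual_act_def dual_right_act_def)

lemma dual_act_lin:
  assumes g: "g \<in> C'"
  shows "(\<lambda>h\<in>carrier N'. act h g) \<in> lin_maps R N' N'"
proof -
  interpret N': module R N' by (rule dual_module_module[OF N.module_axioms])
  note c = comodule_dual_act_closed[OF _ g]
  have a: "act (h \<oplus>\<^bsub>N'\<^esub> k) g = act h g \<oplus>\<^bsub>N'\<^esub> act k g" if "h \<in> carrier N'" "k \<in> carrier N'" for h k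
    using that by (intro dual_eqI[of _ R N] c N'.a_closed) (simp_all add: dual_module_simps act_apply comodule_act_closed[OF g])
  have s: "act (r \<odot>\<^bsub>N'\<^esub> h) g = r \<odot>\<^bsub>N'\<^esub> act h g" if "r \<in> carrier R" "h \<in> carrier N'" for r h
    using that by (intro dual_eqI[of _ R N] c N'.smult_closed) (simp_all add: dual_module_simps act_apply comodule_act_closed[OF g])
  show ?thesis by (simp add: lin_maps_def a s c)
qed

lemma bidual_act_closed:
  assumes "f \<in> carrier (dual_module R N')" "g \<in> C'"
  shows "dual_left_act N' act g f \<in> carrier (dual_module R N')"
proof -
  have "dual_left_act N' act g f = (\<lambda>h\<in>carrier N'. f ((\<lambda>h\<in>carrier N'. act h g) h))"
    by (auto simp: dual_left_act_def)
  then show ?thesis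
    using lin_maps_compose[OF dual_module_module[OF N.module_axioms] dual_act_lin[OF assms(2)] assms(1)[unfolded dual_carrier]]
    by (simp add: dual_carrier)
qed

text \<open>The set \<open>L = {h. f(h g) = 0 for all g}\<close> is a \<open>C\<^sup>*\<close>-submodule because \<open>(h g) k = h (g \<star> k)\<close>, and it lies in
  the kernel of \<open>f\<close> because \<open>h \<epsilon> = h\<close>.  It contains the common kernel of \<open>\<Phi>\<close>, so it is cofinite.\<close>

lemma circ_dualI_finite_orbit:
  assumes noeth: "noetherian_ring R" and f: "f \<in> carrier (dual_module R N')"
    and \<Phi>: "finite \<Phi>" "\<Phi> \<subseteq> carrier (dual_module R N')"
    and orb: "\<And>g. g \<in> C' \<Longrightarrow> dual_left_act N' act g f \<in> lin_span R (dual_module R N') \<Phi>"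
  shows "f \<in> circ_dual R C N' act"
proof -
  note N' = dual_module_module[OF N.module_axioms]
  note N'' = dual_module_module[OF N']
  define L where "L = common_kernel R N' ((\<lambda>g. dual_left_act N' act g f) ` C')"
  have L_iff: "h \<in> L \<longleftrightarrow> h \<in> carrier N' \<and> (\<forall>g\<in>C'. f (act h g) = \<zero>)" for h
    by (auto simp: L_def dual_left_act_def)
  have L: "submodule L R N'"
    unfolding L_def using bidual_act_closed[OF f] by (intro common_kernel_submodule[OF N']) auto
  have "act h g \<in> L" if h: "h \<in> L" and g: "g \<in> C'" for h g
  proof -
    have hc: "h \<in> carrier N'" using h L_iff by blast
    have "f (act (act h g) k) = \<zero>" if k: "k \<in> C'" for k
    proof -
      have "f (act h (convolution R C \<Delta> g k)) = \<zero>" using h convolution_closed[OF g k] unfolding L_iff by blast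
      then show ?thesis by (simp only: comodule_dual_act_convolution(2)[OF hc g k])
    qed
    then show ?thesis using comodule_dual_act_closed[OF hc g] by (simp add: L_iff)
  qed
  moreover have "common_kernel R N' \<Phi> \<subseteq> L"
  proof
    fix h assume h: "h \<in> common_kernel R N' \<Phi>"
    then have hc: "h \<in> carrier N'" by blast
    have "\<Phi> \<subseteq> common_kernel R (dual_module R N') {eval_map R N' h}"
      using h \<Phi>(2) by (auto simp: eval_map_def)
    then have "lin_span R (dual_module R N') \<Phi> \<subseteq> common_kernel R (dual_module R N') {eval_map R N' h}"
      by (intro lin_span_minimal common_kernel_submodule[OF N'']) (simp_all add: eval_map_closed[OF N' hc])
    then have "eval_map R N' h (dual_left_act N' act g f) = \<zero>" if "g \<in> C'" for g
      using orb[OF that] by blast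
    then show "h \<in> L"
      using hc bidual_act_closed[OF f] by (simp add: L_iff eval_map_def dual_left_act_def)
  qed
  then have "fin_gen R (quot_module R N' L)"
    by (rule cofinite_common_kernel[OF N' noeth \<Phi> L])
  ultimately have "L \<in> cofinite_submodules R C N' act"
    using L by (simp add: cofinite_submodules_def right_submodule_def)
  moreover have "f h = \<zero>" if "h \<in> L" for h
    using that comodule_dual_act_convolution(1)[of h \<epsilon> \<epsilon>] counit_in_dual by (metis L_iff)
  ultimately show ?thesis using f by (auto simp: circ_dual_def)
qed

text \<open>The orbit of a rational functional lies in the span of the finitely many functionals that occur in a tensor
  representing it.\<close>

lemma box_dual_subset_circ_dual:
  assumes noeth: "noetherian_ring R"
  shows "box_dual R C N' act \<subseteq> circ_dual R C N' act"
proof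
  note N'' = dual_module_module[OF dual_module_module[OF N.module_axioms]]
  fix f assume "f \<in> box_dual R C N' act"
  then obtain t where f: "f \<in> carrier (dual_module R N')" and t: "t \<in> carrier (tensor R (dual_module R N') C)"
    and ft: "\<And>g. g \<in> C' \<Longrightarrow> dual_left_act N' act g f = contract R (dual_module R N') C g t"
    by (auto simp: box_dual_def rational_part_def)
  obtain \<Phi> where \<Phi>: "finite \<Phi>" "\<Phi> \<subseteq> carrier (dual_module R N')"
    "\<And>g. g \<in> C' \<Longrightarrow> contract R (dual_module R N') C g t \<in> lin_span R (dual_module R N') \<Phi>"
    using contract_in_span[OF N'' module_axioms t] by blast
  show "f \<in> circ_dual R C N' act"
    using \<Phi>(3) ft by (intro circ_dualI_finite_orbit[OF noeth f \<Phi>(1,2)]) simp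
qed

text \<open>The orbit of the zero functional is zero, so it vanishes on a cofinite submodule.\<close>

lemma cofinite_submodules_nonempty:
  assumes "noetherian_ring R"
  shows "cofinite_submodules R C N' act \<noteq> {}"
proof -
  interpret N': module R N' by (rule dual_module_module[OF N.module_axioms])
  interpret N'': module R "dual_module R N'" by (rule dual_module_module[OF N'.module_axioms])
  let ?z = "\<zero>\<^bsub>dual_module R N'\<^esub>"
  have "dual_left_act N' act g ?z = ?z" if "g \<in> C'" for g
    using comodule_dual_act_closed[OF _ that] by (auto simp: dual_left_act_def dual_module_simps(1)[of R N'])
  then have "?z \<in> circ_dual R C N' act"
    using N''.submodule_zero[OF lin_span_submodule[OF N''.module_axioms empty_subsetI]]
    by (intro circ_dualI_finite_orbit[OF assms N''.zero_closed finite.emptyI]) auto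
  then show ?thesis by (auto simp: circ_dual_def)
qed

lemma cofinite_submodules_Int:
  assumes "noetherian_ring R"
    and "H \<in> cofinite_submodules R C N' act" "K \<in> cofinite_submodules R C N' act"
  shows "H \<inter> K \<in> cofinite_submodules R C N' act"
proof -
  interpret N': module R N' by (rule dual_module_module[OF N.module_axioms])
  show ?thesis
    using assms fin_gen_quot_Int[OF N'.module_axioms assms(1), of H K] N'.submodule_Int[of H K]
    by (auto simp: cofinite_submodules_def right_submodule_def)
qed

text \<open>An annihilator does not change when \<open>S\<close> is replaced by its span, so finite sets \<open>S\<close> serve as well as the
  finitely generated submodules in the definition of the finite topology.\<close>

lemma coreflexive_iff:
  assumes noeth: "noetherian_ring R"
  shows "coreflexive R C N \<rho> \<longleftrightarrow>
    (\<forall>S. finite S \<and> S \<subseteq> carrier N \<longrightarrow> (\<exists>L\<in>cofinite_submodules R C N' act. L \<subseteq> annihilator R N S)) \<and>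
    (\<forall>L\<in>cofinite_submodules R C N' act. \<exists>S. finite S \<and> S \<subseteq> carrier N \<and> annihilator R N S \<subseteq> L)"
proof -
  note NN = N.module_axioms
  note N' = dual_module_module[OF NN]
  let ?F = "{annihilator R N S | S. finite S \<and> S \<subseteq> carrier N}"
  let ?B = "cofinite_submodules R C N' act"
  have fg: "submodule K R N \<and> fin_gen R (N\<lparr>carrier := K\<rparr>) \<longleftrightarrow>
      (\<exists>S. finite S \<and> S \<subseteq> carrier N \<and> K = lin_span R N S)" for K
  proof
    assume K: "submodule K R N \<and> fin_gen R (N\<lparr>carrier := K\<rparr>)"
    then have KN: "K \<subseteq> carrier N" using N.submoduleE(1)[of K] by simp
    obtain S where "finite S" "S \<subseteq> K" "K = lin_span R N S"
      using K fin_gen_submodule_iff[OF NN conjunct1[OF K]] by blast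
    then show "\<exists>S. finite S \<and> S \<subseteq> carrier N \<and> K = lin_span R N S"
      using KN by blast
  next
    assume "\<exists>S. finite S \<and> S \<subseteq> carrier N \<and> K = lin_span R N S"
    then obtain S where S: "finite S" "S \<subseteq> carrier N" "K = lin_span R N S" by blast
    have "submodule K R N" unfolding S(3) by (rule lin_span_submodule[OF NN S(2)])
    moreover have "S \<subseteq> K" unfolding S(3) by (rule lin_span_superset)
    ultimately show "submodule K R N \<and> fin_gen R (N\<lparr>carrier := K\<rparr>)"
      using fin_gen_submodule_iff[OF NN, of K] S(1,3) by blast
  qed
  have ann: "annihilator R N (lin_span R N S) = annihilator R N S" if "S \<subseteq> carrier N" for S
    by (rule annihilator_span[OF NN that])
  have "{annihilator R N K | K. submodule K R N \<and> fin_gen R (N\<lparr>carrier := K\<rparr>)} = ?F"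
    (is "?G = _")
  proof (intro antisym subsetI)
    fix H assume "H \<in> ?G"
    then obtain S where S: "finite S" "S \<subseteq> carrier N" and H: "H = annihilator R N (lin_span R N S)"
      unfolding fg by blast
    have "H = annihilator R N S" unfolding H by (rule ann[OF S(2)])
    with S show "H \<in> ?F" by (intro CollectI exI[of _ S] conjI)
  next
    fix H assume "H \<in> ?F"
    then obtain S where S: "finite S" "S \<subseteq> carrier N" and H: "H = annihilator R N S" by blast
    have "H = annihilator R N (lin_span R N S)" unfolding H by (rule ann[OF S(2), symmetric])
    moreover have "submodule (lin_span R N S) R N \<and> fin_gen R (N\<lparr>carrier := lin_span R N S\<rparr>)"
      unfolding fg using S by blast
    ultimately show "H \<in> ?G" by (intro CollectI exI[of _ "lin_span R N S"] conjI) simp_all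
  qed
  then have ft: "finite_topology R N = linear_topology N' ?F"
    by (simp add: finite_topology_def)
  have "coreflexive R C N \<rho> \<longleftrightarrow> linear_topology N' ?F = linear_topology N' ?B"
    by (simp add: coreflexive_def ft cofinite_topology_def)
  also have "\<dots> \<longleftrightarrow> (\<forall>H\<in>?F. \<exists>K\<in>?B. K \<subseteq> H) \<and> (\<forall>H\<in>?B. \<exists>K\<in>?F. K \<subseteq> H)"
  proof (rule linear_topology_eq_iff[OF N'])
    fix H assume "H \<in> ?F" then show "submodule H R N'" using annihilator_submodule[OF NN] by blast
  next
    show "?F \<noteq> {}" by blast
  next
    fix H K assume "H \<in> ?F" "K \<in> ?F"
    then obtain S T where S: "finite S" "S \<subseteq> carrier N" "H = annihilator R N S"
      and T: "finite T" "T \<subseteq> carrier N" "K = annihilator R N T" by blast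
    then have "annihilator R N (S \<union> T) \<in> ?F" by blast
    moreover have "annihilator R N (S \<union> T) \<subseteq> H \<inter> K" using S T by blast
    ultimately show "\<exists>L\<in>?F. L \<subseteq> H \<inter> K" by blast
  next
    fix H assume "H \<in> ?B" then show "submodule H R N'"
      by (simp add: cofinite_submodules_def right_submodule_def)
  next
    show "?B \<noteq> {}" by (rule cofinite_submodules_nonempty[OF noeth])
  next
    fix H K assume "H \<in> ?B" "K \<in> ?B"
    then show "\<exists>L\<in>?B. L \<subseteq> H \<inter> K" using cofinite_submodules_Int[OF noeth] by blast
  qed
  also have "\<dots> \<longleftrightarrow> (\<forall>S. finite S \<and> S \<subseteq> carrier N \<longrightarrow> (\<exists>L\<in>?B. L \<subseteq> annihilator R N S)) \<and>
    (\<forall>L\<in>?B. \<exists>S. finite S \<and> S \<subseteq> carrier N \<and> annihilator R N S \<subseteq> L)"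
    by (simp add: setcompr_eq_image conj_assoc Bex_def[of "{S. finite S \<and> S \<subseteq> carrier N}"])
  finally show ?thesis .
qed

text \<open>Such an \<open>f\<close> sees of \<open>h\<close> only the restriction to \<open>S\<close>.\<close>

lemma functional_eq_of_agree:
  assumes f: "f \<in> carrier (dual_module R N')" and van: "\<And>h. h \<in> annihilator R N S \<Longrightarrow> f h = \<zero>"
    and "S \<subseteq> carrier N" and h: "h \<in> carrier N'" and k: "k \<in> carrier N'"
    and eq: "\<And>x. x \<in> S \<Longrightarrow> h x = k x"
  shows "f h = f k"
proof -
  note N' = dual_module_module[OF N.module_axioms]
  interpret N': module R N' by (rule N')
  define d where "d = h \<ominus>\<^bsub>N'\<^esub> k"
  have d: "d \<in> carrier N'" "d \<oplus>\<^bsub>N'\<^esub> k = h"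
    using h k by (simp_all add: d_def a_minus_def N'.a_assoc N'.l_neg)
  have "d x = \<zero>" if x: "x \<in> S" for x
  proof -
    have xN: "x \<in> carrier N" using x assms(3) by blast
    have "d x \<oplus> k x = k x"
      using fun_cong[OF d(2), of x] eq[OF x] xN by (simp add: dual_module_simps)
    then show ?thesis using dualD(1)[OF d(1) xN] dualD(1)[OF k xN] by simp
  qed
  then have "f d = \<zero>" using van d(1) by blast
  then show ?thesis
    using dualD(2)[OF f d(1) k] dualD(1)[OF f k] d(2) by simp
qed

text \<open>Restricted to \<open>S\<close>, the functional \<open>h g\<close> has the values \<open>h(g x)\<close>, \<open>x \<in> S\<close>, each of which is \<open>g\<close> evaluated at
  an element of \<open>C\<close> given by the coaction of \<open>x\<close>.  Hence there is a tensor in \<open>N\<^sup>* \<otimes> C\<close> whose contraction by \<open>g\<close>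
  agrees with \<open>h g\<close> on \<open>S\<close>, and \<open>f\<close> does not distinguish the two.  Finally apply \<open>f\<close> to the first factor of
  that tensor.\<close>

lemma orbit_evaluation_representable:
  assumes lp: "locally_projective R C"
    and f: "f \<in> carrier (dual_module R N')" and S: "finite S" "S \<subseteq> carrier N"
    and van: "\<And>h. h \<in> annihilator R N S \<Longrightarrow> f h = \<zero>" and h: "h \<in> carrier N'"
  obtains e where "e \<in> carrier C" "\<And>g. g \<in> C' \<Longrightarrow> f (act h g) = g e"
proof -
  note NN = N.module_axioms and C = module_axioms
  note N' = dual_module_module[OF NN]
  let ?i = "\<lambda>k\<in>carrier N'. \<lambda>x\<in>S. eval_map R N x k"
  have i: "?i \<in> lin_maps R N' (power_module R S)"
    using eval_map_closed[OF NN] S(2) by (intro coordinate_map_lin[OF N']) blast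
  have "\<exists>c\<in>carrier C. \<forall>g\<in>C'. h (comodule_act R C N \<rho> g x) = g c" if "x \<in> carrier N" for x
    using functional_of_contraction[OF NN C h lin_mapsD(1)[OF coact_lin that]]
    unfolding comodule_act_def by metis
  then obtain c where c: "\<And>x. x \<in> carrier N \<Longrightarrow> c x \<in> carrier C"
      "\<And>x g. x \<in> carrier N \<Longrightarrow> g \<in> C' \<Longrightarrow> h (comodule_act R C N \<rho> g x) = g (c x)" by metis
  have ci: "?i k x = k x" if "k \<in> carrier N'" "x \<in> S" for k x
    using that S(2) by (auto simp: eval_map_def)
  have "act h g \<in> carrier N' \<and> ?i (act h g) = (\<lambda>x\<in>S. g (c x))" if g: "g \<in> C'" for g
  proof
    show a: "act h g \<in> carrier N'" by (rule comodule_dual_act_closed[OF h g])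
    have "\<And>x. x \<in> S \<Longrightarrow> eval_map R N x (act h g) = g (c x)"
      using S(2) a c(2)[OF _ g] by (auto simp: eval_map_def act_apply)
    then show "?i (act h g) = (\<lambda>x\<in>S. g (c x))" using a by (simp cong: restrict_cong)
  qed
  then obtain t where t: "t \<in> carrier (tensor R N' C)"
      "\<And>g. g \<in> C' \<Longrightarrow> ?i (contract R N' C g t) = ?i (act h g)"
    using representable_coordinatewise[OF N' C lp S(1) i, of c "act h"] c(1) S(2) by blast
  obtain e where e: "e \<in> carrier C" "\<And>g. g \<in> C' \<Longrightarrow> f (contract R N' C g t) = g e"
    using functional_of_contraction[OF N' C f t(1)] by blast
  have "f (act h g) = g e" if g: "g \<in> C'" for g
  proof -
    have tc: "contract R N' C g t \<in> carrier N'" by (rule tensor_liftD(1)[OF N' C N' act_bilinear[OF N' C g] t(1)])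
    have ac: "act h g \<in> carrier N'" by (rule comodule_dual_act_closed[OF h g])
    have "f (act h g) = f (contract R N' C g t)"
      by (rule functional_eq_of_agree[OF f van S(2) ac tc]) (use ci[OF tc] ci[OF ac] t(2)[OF g] in metis)+
    then show ?thesis using e(2)[OF g] by simp
  qed
  then show ?thesis using that e(1) by blast
qed

text \<open>The orbit of \<open>f\<close> lies in the module \<open>X\<close> of functionals on \<open>N\<^sup>*\<close> that vanish on the annihilator of a finite
  set \<open>V\<close>, and elements of \<open>X\<close> are determined by their values on a finite set \<open>P \<subseteq> N\<^sup>*\<close>.  The values of \<open>g f\<close> on
  \<open>P\<close> are evaluations of \<open>g\<close> by the preceding lemma, so \<open>g \<mapsto> g f\<close> is representable in \<open>X\<close>, a fortiori
  in \<open>N\<^sup>*\<^sup>*\<close>.  Working with \<open>X\<close> instead of \<open>N\<^sup>*\<^sup>*\<close> is essential, since values on \<open>P\<close> do not determine a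
  general element of \<open>N\<^sup>*\<^sup>*\<close>.\<close>

lemma box_dualI_finite_support:
  assumes noeth: "noetherian_ring R" and lp: "locally_projective R C"
    and f: "f \<in> carrier (dual_module R N')" and S: "finite S" "S \<subseteq> carrier N"
    and van: "\<And>h. h \<in> annihilator R N S \<Longrightarrow> f h = \<zero>"
  shows "f \<in> box_dual R C N' act"
proof -
  note NN = N.module_axioms and C = module_axioms
  note N' = dual_module_module[OF NN]
  let ?N'' = "dual_module R N'"
  note N'' = dual_module_module[OF N']
  interpret N': module R N' by (rule N')
  interpret N'': module R ?N'' by (rule N'')
  have "\<exists>T. finite T \<and> T \<subseteq> carrier N \<and> (\<forall>g\<in>C'. comodule_act R C N \<rho> g x \<in> lin_span R N T)"
    if "x \<in> carrier N" for x
    using contract_in_span[OF NN C lin_mapsD(1)[OF coact_lin that]] unfolding comodule_act_def by metis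
  then obtain T where T: "\<And>x. x \<in> carrier N \<Longrightarrow> finite (T x)" "\<And>x. x \<in> carrier N \<Longrightarrow> T x \<subseteq> carrier N"
      "\<And>x g. x \<in> carrier N \<Longrightarrow> g \<in> C' \<Longrightarrow> comodule_act R C N \<rho> g x \<in> lin_span R N (T x)" by metis
  define V where "V = (\<Union>x\<in>S. T x)"
  have V: "finite V" "V \<subseteq> carrier N" using T(1,2) S by (auto simp: V_def)
  have act_V: "act h g \<in> annihilator R N S" if h: "h \<in> annihilator R N V" and g: "g \<in> C'" for h g
  proof -
    have hV: "h \<in> annihilator R N (lin_span R N V)" using h by (simp only: annihilator_span[OF NN V(2)])
    have "act h g x = \<zero>" if x: "x \<in> S" for x
    proof -
      have "comodule_act R C N \<rho> g x \<in> lin_span R N V"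
        using T(3)[of x g] x S(2) g N.lin_span_mono[of "T x" V] by (auto simp: V_def)
      then show ?thesis using hV x S(2) by (auto simp: act_apply)
    qed
    then show ?thesis using comodule_dual_act_closed[of h g] h g by blast
  qed
  define X0 where "X0 = annihilator R N' (annihilator R N V)"
  have X0: "submodule X0 R ?N''" unfolding X0_def by (rule annihilator_submodule[OF N']) blast
  define X where "X = ?N''\<lparr>carrier := X0\<rparr>"
  have X: "module R X" unfolding X_def by (rule submodule.submodule_is_module[OF X0 N''])
  have cX: "carrier X = X0" by (simp add: X_def)
  have X0c: "F \<in> carrier ?N''" if "F \<in> X0" for F using that by (simp add: X0_def)
  have gf: "dual_left_act N' act g f \<in> X0" if g: "g \<in> C'" for g
    using bidual_act_closed[OF f g] van[OF act_V[OF _ g]] by (auto simp: X0_def dual_left_act_def)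
  \<comment> \<open>\<open>P\<close> spans \<open>N\<^sup>*\<close> modulo the annihilator of \<open>V\<close>.\<close>
  let ?j = "\<lambda>k\<in>carrier N'. \<lambda>x\<in>V. eval_map R N x k"
  have j: "?j \<in> lin_maps R N' (power_module R V)"
    using eval_map_closed[OF NN] V(2) by (intro coordinate_map_lin[OF N']) blast
  have cj: "?j k x = k x" if "k \<in> carrier N'" "x \<in> V" for k x
    using that V(2) by (auto simp: eval_map_def)
  obtain P where P: "finite P" "P \<subseteq> carrier N'"
      "\<And>h. h \<in> carrier N' \<Longrightarrow> \<exists>p\<in>lin_span R N' P. ?j h = ?j p"
    using noetherian_representatives[OF N' power_module_module[OF R.cring_axioms] noeth
        power_module_fin_gen[OF R.cring_axioms V(1)] j N'.carrier_is_submodule] by blast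
  have X0_eq: "F = G" if F: "F \<in> X0" and G: "G \<in> X0" and FG: "\<And>p. p \<in> P \<Longrightarrow> F p = G p" for F G
  proof (rule dual_eqI[OF X0c[OF F] X0c[OF G]])
    fix h assume h: "h \<in> carrier N'"
    then obtain p where p: "p \<in> lin_span R N' P" "?j h = ?j p" using P(3) by blast
    have pc: "p \<in> carrier N'" using p(1) N'.lin_span_closed[OF P(2)] by blast
    have hp: "h x = p x" if "x \<in> V" for x using cj[OF h that] cj[OF pc that] p(2) by metis
    have "F h = F p" by (rule functional_eq_of_agree[OF X0c[OF F] _ V(2) h pc hp]) (use F in \<open>auto simp: X0_def\<close>)
    also have "F p = G p" by (rule functional_span_eqI[OF N' X0c[OF F] P(2) X0c[OF G] FG p(1)])
    also have "G p = G h" by (rule functional_eq_of_agree[OF X0c[OF G] _ V(2) pc h hp[symmetric]]) (use G in \<open>auto simp: X0_def\<close>)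
    finally show "F h = G h" .
  qed
  let ?i = "\<lambda>F\<in>carrier ?N''. \<lambda>p\<in>P. eval_map R N' p F"
  have i: "restrict ?i X0 \<in> lin_maps R X (power_module R P)"
    unfolding X_def using eval_map_closed[OF N'] P(2)
    by (intro lin_maps_restrict[OF N'' X0] coordinate_map_lin[OF N'']) blast
  have ci: "restrict ?i X0 F p = F p" if "F \<in> X0" "p \<in> P" for F p
    using that X0c[OF that(1)] P(2) by (auto simp: eval_map_def)
  have "\<exists>e\<in>carrier C. \<forall>g\<in>C'. f (act h g) = g e" if "h \<in> carrier N'" for h
    using orbit_evaluation_representable[OF lp f S van that] by metis
  then obtain e where e: "\<And>h. h \<in> carrier N' \<Longrightarrow> e h \<in> carrier C"
      "\<And>h g. h \<in> carrier N' \<Longrightarrow> g \<in> C' \<Longrightarrow> f (act h g) = g (e h)" by metis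
  have "dual_left_act N' act g f \<in> carrier X \<and> restrict ?i X0 (dual_left_act N' act g f) = (\<lambda>p\<in>P. g (e p))"
    if g: "g \<in> C'" for g
  proof
    show "dual_left_act N' act g f \<in> carrier X" using gf[OF g] by (simp add: cX)
    have "\<And>p. p \<in> P \<Longrightarrow> eval_map R N' p (dual_left_act N' act g f) = g (e p)"
      using P(2) bidual_act_closed[OF f g] e(2)[OF _ g] by (auto simp: eval_map_def dual_left_act_def)
    then show "restrict ?i X0 (dual_left_act N' act g f) = (\<lambda>p\<in>P. g (e p))"
      using gf[OF g] bidual_act_closed[OF f g] by (simp cong: restrict_cong)
  qed
  then obtain t where t: "t \<in> carrier (tensor R X C)"
      "\<And>g. g \<in> C' \<Longrightarrow> restrict ?i X0 (contract R X C g t) = restrict ?i X0 (dual_left_act N' act g f)"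
    using representable_coordinatewise[OF X C lp P(1) i, of e "\<lambda>g. dual_left_act N' act g f"] e(1) P(2) by blast
  have tf: "contract R X C g t = dual_left_act N' act g f" if g: "g \<in> C'" for g
  proof (rule X0_eq[OF _ gf[OF g]])
    show c: "contract R X C g t \<in> X0"
      using tensor_liftD(1)[OF X C X act_bilinear[OF X C g] t(1)] by (simp add: cX)
    show "contract R X C g t p = dual_left_act N' act g f p" if "p \<in> P" for p
      using ci[OF c that] ci[OF gf[OF g] that] t(2)[OF g] by metis
  qed
  have incl: "restrict (\<lambda>F\<in>carrier ?N''. F) X0 \<in> lin_maps R X ?N''"
    unfolding X_def by (rule lin_maps_restrict[OF N'' X0 lin_maps_id[OF N'']])
  let ?t = "tensor_map R X C ?N'' C (restrict (\<lambda>F\<in>carrier ?N''. F) X0) (\<lambda>c. c) t"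
  have "?t \<in> carrier (tensor R ?N'' C)"
    using lin_mapsD(1)[OF tensor_map_id_lin(2)[OF X N'' C incl] t(1)] t(1) by simp
  moreover have "dual_left_act N' act g f = contract R ?N'' C g ?t" if g: "g \<in> C'" for g
    using contract_tensor_map[OF X N'' C incl g t(1)] tf[OF g] gf[OF g] X0c[OF gf[OF g]] by simp
  ultimately show ?thesis using f unfolding box_dual_def rational_part_def by blast
qed

lemma coreflexive_box_eq_circ:
  assumes noeth: "noetherian_ring R" and lp: "locally_projective R C" and "coreflexive R C N \<rho>"
  shows "box_dual R C N' act = circ_dual R C N' act"
proof
  show "box_dual R C N' act \<subseteq> circ_dual R C N' act" by (rule box_dual_subset_circ_dual[OF noeth])
  show "circ_dual R C N' act \<subseteq> box_dual R C N' act"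
  proof
    fix f assume "f \<in> circ_dual R C N' act"
    then obtain L where f: "f \<in> carrier (dual_module R N')" and L: "L \<in> cofinite_submodules R C N' act"
      "\<And>h. h \<in> L \<Longrightarrow> f h = \<zero>" by (auto simp: circ_dual_def)
    obtain S where S: "finite S" "S \<subseteq> carrier N" "annihilator R N S \<subseteq> L"
      using assms(3)[unfolded coreflexive_iff[OF noeth], THEN conjunct2, rule_format, OF L(1)] by (elim exE conjE)
    show "f \<in> box_dual R C N' act"
      by (rule box_dualI_finite_support[OF noeth lp f S(1,2)]) (rule L(2), rule subsetD[OF S(3)])
  qed
qed

text \<open>For a cofinite submodule \<open>L\<close> let \<open>K\<close> be its orthogonal in \<open>N\<close>.  Two facts are needed.  First, \<open>K\<^sup>\<bottom> \<subseteq> L\<close>: a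
  functional on \<open>N\<^sup>* / L\<close> is an element of \<open>N\<^sup>*\<^sup>\<circ>\<close>, hence evaluation at a point of \<open>K\<close>, and such functionals
  separate the points of \<open>N\<^sup>* / L\<close>.  Second, \<open>K\<close> is finitely generated: evaluation at finitely many generators
  of \<open>N\<^sup>*\<close> modulo \<open>L\<close> is injective on \<open>K\<close>.\<close>

lemma coreflexive_of_eval_iso_circ:
  assumes noeth: "noetherian_ring R" and cog: "cofinitely_cogenerated R C N' act"
    and iso: "eval_iso R N (circ_dual R C N' act)"
  shows "coreflexive R C N \<rho>"
  unfolding coreflexive_iff[OF noeth]
proof (intro conjI allI impI ballI)
  note NN = N.module_axioms
  note N' = dual_module_module[OF NN]
  interpret N': module R N' by (rule N')
  fix S assume "finite S \<and> S \<subseteq> carrier N"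
  then have "finite S" "S \<subseteq> carrier N" by auto
  then show "\<exists>L\<in>cofinite_submodules R C N' act. L \<subseteq> annihilator R N S"
  proof (induction S)
    case empty
    obtain L where "L \<in> cofinite_submodules R C N' act" using cofinite_submodules_nonempty[OF noeth] by blast
    then show ?case using N'.submoduleE(1)[of L]
      by (intro bexI[of _ L]) (auto simp: cofinite_submodules_def right_submodule_def)
  next
    case (insert x S)
    from insert.prems have "S \<subseteq> carrier N" by blast
    from insert.IH[OF this] obtain L where L: "L \<in> cofinite_submodules R C N' act" "L \<subseteq> annihilator R N S" by (rule bexE)
    have "eval_map R N x \<in> circ_dual R C N' act" using iso insert.prems by (auto simp: eval_iso_def)
    then obtain K where K: "K \<in> cofinite_submodules R C N' act" "\<forall>h\<in>K. eval_map R N x h = \<zero>"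
      by (auto simp: circ_dual_def)
    have "K \<inter> L \<subseteq> annihilator R N (insert x S)"
      using K(2) L(2) insert.prems by (auto simp: eval_map_def subset_iff)
    then show ?case using cofinite_submodules_Int[OF noeth K(1) L(1)] by (rule bexI)
  qed
next
  note NN = N.module_axioms
  note N' = dual_module_module[OF NN]
  interpret N': module R N' by (rule N')
  fix L assume L: "L \<in> cofinite_submodules R C N' act"
  then have Ls: "submodule L R N'" and Lf: "fin_gen R (quot_module R N' L)"
    by (auto simp: cofinite_submodules_def right_submodule_def)
  note Q = quot_module_module[OF N' Ls] and pr = quot_proj_lin[OF N' Ls]
  let ?q = "\<lambda>h\<in>carrier N'. L +>\<^bsub>N'\<^esub> h"
  have Lc: "L \<subseteq> carrier N'" by (rule N'.submoduleE(1)[OF Ls])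
  define K where "K = common_kernel R N L"
  have K: "submodule K R N" unfolding K_def by (rule common_kernel_submodule[OF NN Lc])
  have Kc: "K \<subseteq> carrier N" by (auto simp: K_def)
  have emb: "embeds_in_power R (quot_module R N' L)"
    using cog L unfolding cofinitely_cogenerated_def by blast
  have KL: "annihilator R N K \<subseteq> L"
  proof
    fix h assume h: "h \<in> annihilator R N K"
    then have hc: "h \<in> carrier N'" by blast
    have "?q h = \<zero>\<^bsub>quot_module R N' L\<^esub>"
    proof (rule embeds_in_power_separates_points[OF Q emb lin_mapsD(1)[OF pr hc]])
      fix F assume F: "F \<in> carrier (dual_module R (quot_module R N' L))"
      let ?f = "\<lambda>k\<in>carrier N'. F (?q k)"
      have f: "?f \<in> carrier (dual_module R N')"
        using lin_maps_compose[OF N' pr F[unfolded dual_carrier]] by (simp only: dual_carrier)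
      have fL: "?f l = \<zero>" if "l \<in> L" for l
      proof -
        have lc: "l \<in> carrier N'" using that Lc by blast
        have "?q l = \<zero>\<^bsub>quot_module R N' L\<^esub>"
          using that lc quot_coset_eq_zero_iff[OF N' Ls lc] by (simp add: quot_zero)
        then show ?thesis
          using lc lin_maps_zero[OF Q regular_module_module[OF R.cring_axioms] F[unfolded dual_carrier]]
          by (simp add: regular_module_def)
      qed
      from f fL L have "?f \<in> circ_dual R C N' act" unfolding circ_dual_def by blast
      then obtain n where n: "n \<in> carrier N" "?f = eval_map R N n"
        using iso unfolding eval_iso_def by blast
      have fn: "?f k = k n" if "k \<in> carrier N'" for k
        using fun_cong[OF n(2), of k] that n(1) by (simp add: eval_map_def)
      have "l n = \<zero>" if "l \<in> L" for l
        using fn[of l] fL[OF that] that Lc by auto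
      then have "n \<in> K" using n(1) by (simp add: K_def)
      then have "h n = \<zero>" using h by blast
      then show "F (?q h) = \<zero>" using fn[OF hc] hc by simp
    qed
    then show "h \<in> L" using hc quot_coset_eq_zero_iff[OF N' Ls hc] by (simp add: quot_zero)
  qed
  \<comment> \<open>Elements of \<open>K\<close> are killed by \<open>L\<close> and \<open>N\<^sup>*\<close> separates the points of \<open>N\<close>,
    so they are determined by their values on generators of \<open>N\<^sup>*\<close> modulo \<open>L\<close>.\<close>
  obtain P where P: "finite P" "P \<subseteq> carrier N'"
      "\<And>h. h \<in> carrier N' \<Longrightarrow> \<exists>p\<in>lin_span R N' P. ?q h = ?q p"
    using noetherian_representatives[OF N' Q noeth Lf pr N'.carrier_is_submodule] by blast
  let ?j = "\<lambda>x\<in>carrier N. \<lambda>p\<in>P. p x"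
  have j: "?j \<in> lin_maps R N (power_module R P)"
    using coordinate_map_lin[OF NN, of P "\<lambda>p. p"] P(2) by blast
  obtain B where B: "finite B" "B \<subseteq> K" "\<And>x. x \<in> K \<Longrightarrow> \<exists>b\<in>lin_span R N B. ?j x = ?j b"
    using noetherian_representatives[OF NN power_module_module[OF R.cring_axioms] noeth
        power_module_fin_gen[OF R.cring_axioms P(1)] j K] by blast
  have BN: "B \<subseteq> carrier N" using B(2) Kc by blast
  have BK: "lin_span R N B \<subseteq> K" by (rule lin_span_minimal[OF K B(2)])
  have "x \<in> lin_span R N B" if x: "x \<in> K" for x
  proof -
    obtain b where b: "b \<in> lin_span R N B" "?j x = ?j b" using B(3)[OF x] by blast
    have xb: "x \<in> carrier N" "b \<in> carrier N" "b \<in> K" using x b(1) BK Kc by auto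
    have "eval_map R N x = eval_map R N b"
    proof (rule dual_eqI[OF eval_map_closed[OF NN xb(1)] eval_map_closed[OF NN xb(2)]])
      note ec = eval_map_closed[OF NN]
      fix h assume h: "h \<in> carrier N'"
      then obtain p where p: "p \<in> lin_span R N' P" "?q h = ?q p" using P(3) by blast
      have pc: "p \<in> carrier N'" using p(1) N'.lin_span_closed[OF P(2)] by blast
      interpret L: abelian_subgroup L N' by (rule submodule_abelian_subgroup[OF N' Ls])
      have "h \<in> L +>\<^bsub>N'\<^esub> p" using L.a_rcos_self[OF h] p(2) h pc by simp
      then obtain l where l: "l \<in> L" "h = l \<oplus>\<^bsub>N'\<^esub> p" by (auto simp: a_r_coset_def')
      have lK: "h y = p y" if "y \<in> K" for y
        using that l Kc dualD(1)[OF pc] by (auto simp: K_def dual_module_simps)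
      have "eval_map R N x p = eval_map R N b p"
      proof (rule functional_span_eqI[OF N' ec[OF xb(1)] P(2) ec[OF xb(2)] _ p(1)])
        fix r assume "r \<in> P"
        then show "eval_map R N x r = eval_map R N b r"
          using fun_cong[OF b(2), of r] xb P(2) by (auto simp: eval_map_def)
      qed
      then show "eval_map R N x h = eval_map R N b h"
        using lK[OF x] lK[OF xb(3)] h pc xb by (simp add: eval_map_def)
    qed
    then have "x = b" using iso xb by (auto simp: eval_iso_def dest: inj_onD)
    then show ?thesis using b(1) by simp
  qed
  then have "annihilator R N (lin_span R N B) \<subseteq> annihilator R N K" by blast
  then have "annihilator R N B \<subseteq> annihilator R N K" by (simp only: annihilator_span[OF NN BN])
  then have "annihilator R N B \<subseteq> L" using KL by (rule subset_trans)
  with B(1) BN show "\<exists>S. finite S \<and> S \<subseteq> carrier N \<and> annihilator R N S \<subseteq> L"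
    by (intro exI[of _ B] conjI)
qed

end

theorem corollary5p16:
  fixes R :: "('r,'k) ring_scheme" and C :: "('r,'c,'e) module_scheme"
    and N :: "('r,'n,'d) module_scheme"
    and \<Delta> :: "'c \<Rightarrow> ('c \<times> 'c \<Rightarrow> 'r) set" and \<epsilon> :: "'c \<Rightarrow> 'r"
    and \<rho> :: "'n \<Rightarrow> ('n \<times> 'c \<Rightarrow> 'r) set"
  assumes "cring R" and "\<one>\<^bsub>R\<^esub> \<noteq> \<zero>\<^bsub>R\<^esub>" and "noetherian_ring R"
    and "coalgebra R C \<Delta> \<epsilon>" and "locally_projective R C"
    and "right_comodule R C \<Delta> \<epsilon> N \<rho>"
  shows "(coreflexive R C N \<rho> \<longrightarrow>
        box_dual R C (dual_module R N) (comodule_dual_act R C N \<rho>)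
          = circ_dual R C (dual_module R N) (comodule_dual_act R C N \<rho>)) \<and>
    (cofinitely_cogenerated R C (dual_module R N) (comodule_dual_act R C N \<rho>) \<longrightarrow>
       (eval_iso R N (circ_dual R C (dual_module R N) (comodule_dual_act R C N \<rho>)) \<longrightarrow>
          coreflexive R C N \<rho>) \<and>
       (weakly_coreflexive R C N \<rho> \<longrightarrow>
          (coreflexive R C N \<rho> \<longleftrightarrow>
           eval_iso R N (circ_dual R C (dual_module R N) (comodule_dual_act R C N \<rho>)))))"
proof -
  interpret right_comodule R C \<Delta> \<epsilon> N \<rho> by fact
  note box = coreflexive_box_eq_circ[OF assms(3,5)]
    and core = coreflexive_of_eval_iso_circ[OF assms(3)]
  show ?thesis
    using box core by (auto simp: weakly_coreflexive_def)
qed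

end
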